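(* If $A$ is a regular weak multiplier Hopf algebra with a single faithful left cointegral $h\in A$, then $A$ has integrals (both a left integral and a right integral on $A$ exist).
   Context: All algebras are over $\mathbb{C}$, associative, possibly non-unital, with non-degenerate product. $A$ is idempotent if $A^2=A$; $M(A)$ is the multiplier algebra (identity $1$); $A'$ is the space of all linear functionals on $A$. A coproduct is a homomorphism $\Delta:A\to M(A\otimes A)$ with $\Delta(a)(1\otimes b),(a\otimes 1)\Delta(b)\in A\otimes A$, coassociative: $(a\otimes1\otimes1)(\Delta\otimes id)(\Delta(b)(1\otimes c))=(id\otimes\Delta)((a\otimes1)\Delta(b))(1\otimes1\otimes c)$. Put $T_1(a\otimes b)=\Delta(a)(1\otimes b)$, $T_2(a\otimes b)=(a\otimes1)\Delta(b)$. $\Delta$ is full if the smallest subspaces $V,W\subset A$ with $\Delta(A)(1\otimes A)\subset V\otimes A$ and $(A\otimes1)\Delta(A)\subset A\otimes W$ both equal $A$. A counit is a linear functional $\varepsilon$ with $(\varepsilon\otimes id)(\Delta(a)(1\otimes b))=ab$, $(id\otimes\varepsilon)((c\otimes1)\Delta(a))=ca$. A weak multiplier Hopf algebra is a non-degenerate idempotent algebra $A$ with a full coproduct $\Delta$ and a counit such that: (i) there is an idempotent $E\in M(A\otimes A)$ with $T_1(A\otimes A)=E(A\otimes A)$, $T_2(A\otimes A)=(A\otimes A)E$; (ii) $(id\otimes\Delta)E=(E\otimes1)(1\otimes E)=(1\otimes E)(E\otimes1)$; (iii) $\mathrm{Ker}(T_i)=(1-G_i)(A\otimes A)$, $i=1,2$,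 where $G_1,G_2$ are the linear maps on $A\otimes A$ given by $(G_1\otimes id)(\Delta_{13}(a)(1\otimes b\otimes c))=\Delta_{13}(a)(1\otimes E)(1\otimes b\otimes c)$ and $(id\otimes G_2)((a\otimes b\otimes1)\Delta_{13}(c))=(a\otimes b\otimes1)(E\otimes1)\Delta_{13}(c)$. Here $\Delta$ (and likewise $id\otimes\Delta$) is uniquely extended to multipliers, with $\Delta(1)=E$. With Sweedler notation $\Delta(a)=\sum a_{(1)}\otimes a_{(2)}$, the antipode $S$ is the non-degenerate anti-homomorphism $A\to M(A)$ with $E(a\otimes b)=\sum a_{(1)}\otimes a_{(2)}S(a_{(3)})b$, $(a\otimes b)E=\sum aS(b_{(1)})b_{(2)}\otimes b_{(3)}$, $G_1(a\otimes b)=\sum a_{(1)}\otimes S(a_{(2)})a_{(3)}b$, $G_2(a\otimes b)=\sum ab_{(1)}S(b_{(2)})\otimes b_{(3)}$, $\sum S(a_{(1)})a_{(2)}S(a_{(3)})=S(a)$; it extends to $M(A)$. $A$ is regular if $S$ is bijective from $A$ to $A$; then also $\Delta(a)(b\otimes1),(1\otimes a)\Delta(b)\in A\otimes A$. Put $\varepsilon_t(a)=\sum a_{(1)}S(a_{(2)})$, $A_s=\{y\in M(A):\Delta(y)=E(1\otimes y)\}$, $A_t=\{x\in M(A):\Delta(x)=(x\otimes1)E\}$. For $f\in A'$, $(id\otimes f)\Delta(a)$ and $(f\otimes id)\Delta(a)$ are the elements of $M(A)$ defined by slicing after multiplying, on either side, by $b\otimes1$, resp. $1\otimes b$, $b\in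 A$. A left cointegral is a non-zero $h\in M(A)$ with $ah=\varepsilon_t(a)h$ for all $a\in A$. It is faithful if for $f\in A'$, $(id\otimes f)\Delta(h)=0$ or $(f\otimes id)\Delta(h)=0$ implies $f=0$. ("Single" means that one element $h$ alone is faithful.) A left integral is a non-zero $\varphi\in A'$ with $(id\otimes\varphi)\Delta(a)\in A_t$ for all $a\in A$; a right integral is a non-zero $\psi\in A'$ with $(\psi\otimes id)\Delta(a)\in A_s$ for all $a\in A$. *)

theory Defs
  imports Complex_Main
begin

section \<open>Complex vector spaces and non-unital complex algebras\<close>

class complex_vector = ab_group_add +
  fixes cscale :: "complex \<Rightarrow> 'a \<Rightarrow> 'a"  (infixr "*\<^sub>c" 75)
  assumes cscale_right_distrib: "c *\<^sub>c (x + y) = c *\<^sub>c x + c *\<^sub>c y"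
    and cscale_left_distrib: "(c + d) *\<^sub>c x = c *\<^sub>c x + d *\<^sub>c x"
    and cscale_cscale: "c *\<^sub>c d *\<^sub>c x = (c * d) *\<^sub>c x"
    and cscale_one: "1 *\<^sub>c x = x"

global_interpretation cvec: vector_space "cscale :: complex \<Rightarrow> 'a \<Rightarrow> 'a::complex_vector"
  by unfold_locales
    (simp_all add: cscale_right_distrib cscale_left_distrib cscale_cscale cscale_one)

class complex_algebra = complex_vector + ring +
  assumes mult_cscale_left: "(c *\<^sub>c x) * y = c *\<^sub>c (x * y)"
    and mult_cscale_right: "x * (c *\<^sub>c y) = c *\<^sub>c (x * y)"

instantiation complex :: complex_algebra
begin
definition cscale_complex :: "complex \<Rightarrow> complex \<Rightarrow> complex" where "cscale_complex = (*)"
instance by standard (simp_all add: cscale_complex_def algebra_simps)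
end

abbreviation clinear :: "('a::complex_vector \<Rightarrow> 'b::complex_vector) \<Rightarrow> bool" where
  "clinear \<equiv> Vector_Spaces.linear cscale cscale"

lemma clinear_iff:
  "clinear f \<longleftrightarrow> (\<forall>x y. f (x + y) = f x + f y) \<and> (\<forall>c x. f (c *\<^sub>c x) = c *\<^sub>c f x)"
  by (simp add: Vector_Spaces.linear_def module_hom_def module_hom_axioms_def
      cvec.vector_space_axioms cvec.module_axioms)

lemma clinearI:
  assumes "\<And>x y. f (x + y) = f x + f y" "\<And>c x. f (c *\<^sub>c x) = c *\<^sub>c f x"
  shows "clinear f"
  using assms by (simp add: clinear_iff)

lemma clinear_add: "clinear f \<Longrightarrow> f (x + y) = f x + f y"
  by (simp add: clinear_iff)

lemma clinear_cscale: "clinear f \<Longrightarrow> f (c *\<^sub>c x) = c *\<^sub>c f x"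
  by (simp add: clinear_iff)

lemma clinear_zero: "clinear f \<Longrightarrow> f 0 = 0"
  using clinear_cscale[of f 0 0] by simp

lemma clinear_minus: "clinear f \<Longrightarrow> f (- x) = - f x"
  using clinear_cscale[of f "-1" x] by simp

lemma clinear_id: "clinear (\<lambda>x. x)"
  by (simp add: clinear_iff)

lemma clinear_compose: "clinear f \<Longrightarrow> clinear g \<Longrightarrow> clinear (\<lambda>x. f (g x))"
  by (simp add: clinear_iff)

definition cbilinear ::
  "('a::complex_vector \<Rightarrow> 'b::complex_vector \<Rightarrow> 'c::complex_vector) \<Rightarrow> bool" where
  "cbilinear h \<longleftrightarrow> (\<forall>a. clinear (h a)) \<and> (\<forall>b. clinear (\<lambda>a. h a b))"

lemma cbilinearI:
  assumes "\<And>a a' b. h (a + a') b = h a b + h a' b" "\<And>a b b'. h a (b + b') = h a b + h a b'"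
    "\<And>c a b. h (c *\<^sub>c a) b = c *\<^sub>c h a b" "\<And>c a b. h a (c *\<^sub>c b) = c *\<^sub>c h a b"
  shows "cbilinear h"
  using assms by (simp add: cbilinear_def clinear_iff)

definition algebra_hom :: "('a::complex_algebra \<Rightarrow> 'b::complex_algebra) \<Rightarrow> bool" where
  "algebra_hom f \<longleftrightarrow> clinear f \<and> (\<forall>a b. f (a * b) = f a * f b)"

definition algebra_antihom :: "('a::complex_algebra \<Rightarrow> 'b::complex_algebra) \<Rightarrow> bool" where
  "algebra_antihom f \<longleftrightarrow> clinear f \<and> (\<forall>a b. f (a * b) = f b * f a)"

definition nondegenerate :: "'a::complex_algebra itself \<Rightarrow> bool" where
  "nondegenerate _ \<longleftrightarrow>
     (\<forall>a::'a. (\<forall>b. a * b = 0) \<longrightarrow> a = 0) \<and> (\<forall>b::'a. (\<forall>a. a * b = 0) \<longrightarrow> b = 0)"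

definition idempotent_algebra :: "'a::complex_algebra itself \<Rightarrow> bool" where
  "idempotent_algebra _ \<longleftrightarrow> cvec.span {a * b | a b :: 'a. True} = UNIV"


section \<open>The algebraic tensor product\<close>

text \<open>
  A list of pairs stands for a formal sum of pure tensors; scalars are absorbed into the
  left factors. The tensor product is the presentation by generators and relations.
\<close>

inductive tensor_eq ::
  "('a::complex_vector \<times> 'b::complex_vector) list \<Rightarrow> ('a \<times> 'b) list \<Rightarrow> bool" where
  refl: "tensor_eq xs xs"
| sym: "tensor_eq xs ys \<Longrightarrow> tensor_eq ys xs"
| trans: "tensor_eq xs ys \<Longrightarrow> tensor_eq ys zs \<Longrightarrow> tensor_eq xs zs"
| append: "tensor_eq xs xs' \<Longrightarrow> tensor_eq ys ys' \<Longrightarrow> tensor_eq (xs @ ys) (xs' @ ys')"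
| comm: "tensor_eq (xs @ ys) (ys @ xs)"
| zero: "tensor_eq [(0, b)] []"
| add_left: "tensor_eq [(a + a', b)] [(a, b), (a', b)]"
| add_right: "tensor_eq [(a, b + b')] [(a, b), (a, b')]"
| scale: "tensor_eq [(c *\<^sub>c a, b)] [(a, c *\<^sub>c b)]"

quotient_type (overloaded) ('a, 'b) tensor =
  "('a::complex_vector \<times> 'b::complex_vector) list" / tensor_eq
  by (rule equivpI) (auto intro!: reflpI sympI transpI intro: tensor_eq.intros)

lemma tensor_eq_map_scale:
  assumes "tensor_eq xs ys"
  shows "tensor_eq (map (\<lambda>(a, b). (c *\<^sub>c a, b)) xs) (map (\<lambda>(a, b). (c *\<^sub>c a, b)) ys)"
  using assms
proof (induction rule: tensor_eq.induct)
  case (scale d a b)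
  show ?case
    using tensor_eq.scale[of d "c *\<^sub>c a" b] by (simp add: mult.commute)
qed (auto intro: tensor_eq.intros simp: cscale_right_distrib)

lemma tensor_eq_cancel: "tensor_eq (map (\<lambda>(a, b). ((- 1) *\<^sub>c a, b)) xs @ xs) []"
proof (induction xs)
  case Nil
  show ?case by (simp add: tensor_eq.refl)
next
  case (Cons x xs)
  obtain a b where x: "x = (a, b)" by (cases x)
  let ?n = "map (\<lambda>(a, b). ((- 1) *\<^sub>c a, b)) xs"
  have "tensor_eq ([(- a, b)] @ (?n @ ([(a, b)] @ xs))) ([(- a, b)] @ (([(a, b)] @ xs) @ ?n))"
    by (intro tensor_eq.append tensor_eq.refl tensor_eq.comm)
  moreover have "tensor_eq (([(- a, b), (a, b)]) @ (xs @ ?n)) ([] @ (?n @ xs))"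
  proof (rule tensor_eq.append[OF _ tensor_eq.comm])
    show "tensor_eq [(- a, b), (a, b)] []"
      using tensor_eq.trans[OF tensor_eq.sym[OF tensor_eq.add_left[of "- a" a b]]]
      by (simp add: tensor_eq.zero)
  qed
  ultimately have "tensor_eq ([(- a, b)] @ (?n @ ([(a, b)] @ xs))) (?n @ xs)"
    using tensor_eq.trans by simp blast
  from tensor_eq.trans[OF this Cons.IH] show ?case
    by (simp add: x)
qed

instantiation tensor :: (complex_vector, complex_vector) complex_vector
begin

lift_definition zero_tensor :: "('a, 'b) tensor" is "[]" .

lift_definition plus_tensor :: "('a, 'b) tensor \<Rightarrow> ('a, 'b) tensor \<Rightarrow> ('a, 'b) tensor" is "(@)"
  by (rule tensor_eq.append)

lift_definition cscale_tensor :: "complex \<Rightarrow> ('a, 'b) tensor \<Rightarrow> ('a, 'b) tensor"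
  is "\<lambda>c. map (\<lambda>(a, b). (c *\<^sub>c a, b))"
  by (rule tensor_eq_map_scale)

definition uminus_tensor :: "('a, 'b) tensor \<Rightarrow> ('a, 'b) tensor" where
  "uminus_tensor x = (- 1) *\<^sub>c x"

definition minus_tensor :: "('a, 'b) tensor \<Rightarrow> ('a, 'b) tensor \<Rightarrow> ('a, 'b) tensor" where
  "minus_tensor x y = x + - y"

instance
proof
  fix x y z :: "('a, 'b) tensor" and c d :: complex
  show "x + y + z = x + (y + z)" by transfer (simp add: tensor_eq.refl)
  show "x + y = y + x" by transfer (rule tensor_eq.comm)
  show "0 + x = x" by transfer (simp add: tensor_eq.refl)
  show "- x + x = 0"
    unfolding uminus_tensor_def by transfer (rule tensor_eq_cancel)
  show "x - y = x + - y" by (rule minus_tensor_def)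
  show "c *\<^sub>c (x + y) = c *\<^sub>c x + c *\<^sub>c y" by transfer (simp add: tensor_eq.refl)
  show "c *\<^sub>c d *\<^sub>c x = (c * d) *\<^sub>c x"
    by transfer (simp add: tensor_eq.refl case_prod_unfold comp_def)
  show "1 *\<^sub>c x = x"
    by transfer (simp add: tensor_eq.refl case_prod_unfold)
  show "(c + d) *\<^sub>c x = c *\<^sub>c x + d *\<^sub>c x"
  proof transfer
    fix c d :: complex and xs :: "('a \<times> 'b) list"
    let ?m = "\<lambda>c. map (\<lambda>(a, b). (c *\<^sub>c a, b))"
    show "tensor_eq (?m (c + d) xs) (?m c xs @ ?m d xs)"
    proof (induction xs)
      case Nil
      show ?case by (simp add: tensor_eq.refl)
    next
      case (Cons x xs)
      obtain a b where x: "x = (a, b)" by (cases x)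
      have "tensor_eq ([((c + d) *\<^sub>c a, b)] @ ?m (c + d) xs)
              ([(c *\<^sub>c a, b), (d *\<^sub>c a, b)] @ (?m c xs @ ?m d xs))"
        using tensor_eq.append[OF tensor_eq.add_left[of "c *\<^sub>c a" "d *\<^sub>c a" b] Cons.IH]
        by (simp add: cscale_left_distrib)
      moreover have "tensor_eq ([(c *\<^sub>c a, b)] @ (([(d *\<^sub>c a, b)] @ ?m c xs) @ ?m d xs))
              ([(c *\<^sub>c a, b)] @ ((?m c xs @ [(d *\<^sub>c a, b)]) @ ?m d xs))"
        by (intro tensor_eq.append tensor_eq.refl tensor_eq.comm)
      ultimately show ?case
        using tensor_eq.trans by (simp add: x) blast
    qed
  qed
qed

end

lift_definition pure_tensor ::
    "'a::complex_vector \<Rightarrow> 'b::complex_vector \<Rightarrow> ('a, 'b) tensor"  (infixr "\<otimes>" 75)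
  is "\<lambda>a b. [(a, b)]" .

lemma pure_tensor_add_left: "(a + a') \<otimes> b = a \<otimes> b + a' \<otimes> b"
  by transfer (simp add: tensor_eq.add_left)

lemma pure_tensor_add_right: "a \<otimes> (b + b') = a \<otimes> b + a \<otimes> b'"
  by transfer (simp add: tensor_eq.add_right)

lemma pure_tensor_cscale_left: "(c *\<^sub>c a) \<otimes> b = c *\<^sub>c (a \<otimes> b)"
  by transfer (simp add: tensor_eq.refl)

lemma pure_tensor_cscale_right: "a \<otimes> (c *\<^sub>c b) = c *\<^sub>c (a \<otimes> b)"
  by transfer (simp add: tensor_eq.sym[OF tensor_eq.scale])

lemma pure_tensor_zero_left: "0 \<otimes> b = 0"
  by transfer (rule tensor_eq.zero)

lemma pure_tensor_zero_right: "a \<otimes> 0 = 0"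
  using pure_tensor_cscale_right[of a 0 0] by simp

lemma cbilinear_pure_tensor: "cbilinear (\<otimes>)"
  by (rule cbilinearI)
    (simp_all add: pure_tensor_add_left pure_tensor_add_right
      pure_tensor_cscale_left pure_tensor_cscale_right)

lemma tensor_induct [case_names zero pure add, induct type: tensor]:
  assumes "P 0" "\<And>a b. P (a \<otimes> b)" "\<And>x y. P x \<Longrightarrow> P y \<Longrightarrow> P (x + y)"
  shows "P x"
proof -
  have "P (abs_tensor xs)" for xs
  proof (induction xs)
    case Nil
    show ?case using assms(1) by (simp add: zero_tensor_def)
  next
    case (Cons p xs)
    obtain a b where p: "p = (a, b)" by (cases p)
    have "abs_tensor (p # xs) = (a \<otimes> b) + abs_tensor xs"
      by (simp add: p pure_tensor.abs_eq plus_tensor.abs_eq)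
    then show ?case using assms(2,3) Cons.IH by simp
  qed
  then show ?thesis by (metis Quotient3_abs_rep Quotient3_tensor)
qed

text \<open>
  The linear map on the tensor product induced by a bilinear map. For a map that is not bilinear
  the value depends on the chosen representative and is meaningless.
\<close>

definition tensor_lift ::
  "('a::complex_vector \<Rightarrow> 'b::complex_vector \<Rightarrow> 'c::complex_vector) \<Rightarrow> ('a, 'b) tensor \<Rightarrow> 'c" where
  "tensor_lift h x = sum_list (map (\<lambda>(a, b). h a b) (rep_tensor x))"

lemma tensor_eq_sum_list:
  assumes "tensor_eq xs ys" "cbilinear h"
  shows "sum_list (map (\<lambda>(a, b). h a b) xs) = sum_list (map (\<lambda>(a, b). h a b) ys)"
  using assms
proof (induction rule: tensor_eq.induct)
  case (zero b)
  then have "clinear (\<lambda>a. h a b)" by (simp add: cbilinear_def)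
  from clinear_zero[OF this] show ?case by simp
qed (auto simp: cbilinear_def clinear_iff add.commute)

lemma tensor_lift_abs:
  assumes "cbilinear h"
  shows "tensor_lift h (abs_tensor xs) = sum_list (map (\<lambda>(a, b). h a b) xs)"
  unfolding tensor_lift_def
  by (rule tensor_eq_sum_list[OF _ assms])
    (metis Quotient3_rep_abs Quotient3_tensor tensor_eq.refl)

lemma tensor_lift_pure:
  assumes "cbilinear h"
  shows "tensor_lift h (a \<otimes> b) = h a b"
  by (simp add: pure_tensor.abs_eq tensor_lift_abs[OF assms])

lemma clinear_tensor_lift:
  assumes "cbilinear h"
  shows "clinear (tensor_lift h)"
proof (rule clinearI)
  have ex: "\<exists>xs. x = abs_tensor xs" for x :: "('a, 'b) tensor"
    by (metis Quotient3_abs_rep Quotient3_tensor)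
  fix x y :: "('a, 'b) tensor" and c
  obtain xs ys where xy: "x = abs_tensor xs" "y = abs_tensor ys" using ex by metis
  show "tensor_lift h (x + y) = tensor_lift h x + tensor_lift h y"
    by (simp add: xy plus_tensor.abs_eq tensor_lift_abs[OF assms])
  have "sum_list (map (\<lambda>(a, b). h a b) (map (\<lambda>(a, b). (c *\<^sub>c a, b)) xs)) =
      c *\<^sub>c sum_list (map (\<lambda>(a, b). h a b) xs)"
    using assms by (induction xs) (auto simp: cbilinear_def clinear_iff cscale_right_distrib)
  then show "tensor_lift h (c *\<^sub>c x) = c *\<^sub>c tensor_lift h x"
    by (simp add: xy cscale_tensor.abs_eq tensor_lift_abs[OF assms])
qed

lemma tensor_map_eqI:
  assumes "clinear f" "clinear g" "\<And>a b. f (a \<otimes> b) = g (a \<otimes> b)"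
  shows "f x = g x"
  by (induction x) (simp_all add: assms clinear_zero clinear_add)

definition tensor_map ::
  "('a::complex_vector \<Rightarrow> 'c::complex_vector) \<Rightarrow> ('b::complex_vector \<Rightarrow> 'd::complex_vector)
    \<Rightarrow> ('a, 'b) tensor \<Rightarrow> ('c, 'd) tensor" where
  "tensor_map f g = tensor_lift (\<lambda>a b. f a \<otimes> g b)"

lemma cbilinear_tensor_map:
  "clinear f \<Longrightarrow> clinear g \<Longrightarrow> cbilinear (\<lambda>a b. f a \<otimes> g b)"
  by (rule cbilinearI)
    (simp_all add: clinear_iff pure_tensor_add_left pure_tensor_add_right
      pure_tensor_cscale_left pure_tensor_cscale_right)

lemma tensor_map_pure: "clinear f \<Longrightarrow> clinear g \<Longrightarrow> tensor_map f g (a \<otimes> b) = f a \<otimes> g b"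
  by (simp add: tensor_map_def tensor_lift_pure cbilinear_tensor_map)

lemma clinear_tensor_map: "clinear f \<Longrightarrow> clinear g \<Longrightarrow> clinear (tensor_map f g)"
  by (simp add: tensor_map_def clinear_tensor_lift cbilinear_tensor_map)

instantiation tensor :: (complex_algebra, complex_algebra) complex_algebra
begin

definition times_tensor :: "('a, 'b) tensor \<Rightarrow> ('a, 'b) tensor \<Rightarrow> ('a, 'b) tensor" where
  "times_tensor x y = tensor_lift (\<lambda>a b. tensor_map ((*) a) ((*) b) y) x"

lemma clinear_times_left [simp]: "clinear ((*) (a::'x::complex_algebra))"
  by (simp add: clinear_iff distrib_left mult_cscale_right)

lemma clinear_times_right [simp]: "clinear (\<lambda>x. x * (a::'x::complex_algebra))"
  by (simp add: clinear_iff distrib_right mult_cscale_left)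

lemma cbilinear_tensor_times:
  "cbilinear (\<lambda>(a::'a) (b::'b). tensor_map ((*) a) ((*) b) y)"
proof -
  note lin = clinear_tensor_map[OF clinear_times_left clinear_times_left]
  note s = tensor_map_pure clinear_add[OF lin] clinear_zero[OF lin]
    distrib_right mult_cscale_left
    pure_tensor_add_left pure_tensor_add_right pure_tensor_cscale_left pure_tensor_cscale_right
    cscale_right_distrib add.assoc add.left_commute
  show ?thesis
    by (rule cbilinearI; induction y) (simp_all add: s)
qed

lemma pure_tensor_times: "(a \<otimes> b) * (a' \<otimes> b') = (a * a') \<otimes> (b * (b'::'b))" for a :: 'a
  unfolding times_tensor_def tensor_lift_pure[OF cbilinear_tensor_times]
  by (rule tensor_map_pure) simp_all

instance
proof
  fix x y z :: "('a, 'b) tensor" and c :: complex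
  note linl = clinear_tensor_lift[OF cbilinear_tensor_times]
  note lin = clinear_tensor_map[OF clinear_times_left clinear_times_left]
  show dr: "(x + y) * z = x * z + y * z" for x y z :: "('a, 'b) tensor"
    by (simp add: times_tensor_def clinear_add[OF linl])
  show sl: "(c *\<^sub>c x) * y = c *\<^sub>c (x * y)" for c and x y :: "('a, 'b) tensor"
    by (simp add: times_tensor_def clinear_cscale[OF linl])
  have zl: "0 * x = 0" for x :: "('a, 'b) tensor"
    by (simp add: times_tensor_def clinear_zero[OF linl])
  have pure: "(a \<otimes> b) * x = tensor_map ((*) a) ((*) b) x" for a b and x :: "('a, 'b) tensor"
    by (simp add: times_tensor_def tensor_lift_pure[OF cbilinear_tensor_times])
  show dl: "x * (y + z) = x * y + x * z" for x y z :: "('a, 'b) tensor"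
    by (induction x)
      (simp_all add: zl dr pure clinear_add[OF lin] add.assoc add.left_commute)
  show "x * (c *\<^sub>c y) = c *\<^sub>c (x * y)" for x y :: "('a, 'b) tensor"
    by (induction x)
      (simp_all add: zl dr pure clinear_cscale[OF lin] cscale_right_distrib)
  have zr: "x * 0 = 0" for x :: "('a, 'b) tensor"
    by (induction x) (simp_all add: zl dr pure clinear_zero[OF lin])
  have "(a \<otimes> b) * (a' \<otimes> b') * z = (a \<otimes> b) * ((a' \<otimes> b') * z)" for a a' :: 'a and b b' :: 'b
    by (induction z) (simp_all add: zr dl pure_tensor_times mult.assoc)
  then have "(a \<otimes> b) * y * z = (a \<otimes> b) * (y * z)" for a b
    by (induction y) (simp_all add: zl zr dl dr)
  then show "x * y * z = x * (y * z)"
    by (induction x) (simp_all add: zl dr)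
qed

end

definition tensor_assoc ::
  "(('a::complex_vector, 'b::complex_vector) tensor, 'c::complex_vector) tensor
     \<Rightarrow> ('a, ('b, 'c) tensor) tensor" where
  "tensor_assoc = tensor_lift (\<lambda>x c. tensor_lift (\<lambda>a b. a \<otimes> (b \<otimes> c)) x)"

definition tensor_swap ::
  "('a::complex_vector, 'b::complex_vector) tensor \<Rightarrow> ('b, 'a) tensor" where
  "tensor_swap = tensor_lift (\<lambda>a b. b \<otimes> a)"


section \<open>The multiplier algebra\<close>

typedef (overloaded) 'a multiplier =
  "{(L :: 'a::complex_algebra \<Rightarrow> 'a, R :: 'a \<Rightarrow> 'a). clinear L \<and> clinear R \<and>
     (\<forall>a b. L (a * b) = L a * b) \<and> (\<forall>a b. R (a * b) = a * R b) \<and> (\<forall>a b. a * L b = R a * b)}"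
  by (rule exI[of _ "(\<lambda>_. 0, \<lambda>_. 0)"]) (simp add: clinear_iff)

setup_lifting type_definition_multiplier

text \<open>For a multiplier \<open>m\<close>, \<open>lact m a\<close> is the element $ma$ and \<open>ract a m\<close> is the element $am$.\<close>

lift_definition lact :: "'a::complex_algebra multiplier \<Rightarrow> 'a \<Rightarrow> 'a" is fst .

lift_definition ract :: "'a::complex_algebra \<Rightarrow> 'a multiplier \<Rightarrow> 'a" is "\<lambda>a m. snd m a" .

lemma multiplier_eqI:
  assumes "\<And>a. lact m a = lact n a" "\<And>a. ract a m = ract a n"
  shows "m = n"
  using assms by transfer (auto simp: prod_eq_iff fun_eq_iff)

lemma clinear_lact: "clinear (lact m)"
  by transfer auto

lemma clinear_ract: "clinear (\<lambda>a. ract a m)"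
  by transfer auto

lemma lact_times: "lact m (a * b) = lact m a * b"
  by transfer auto

lemma ract_times: "ract (a * b) m = a * ract b m"
  by transfer auto

lemma times_lact: "a * lact m b = ract a m * b"
  by transfer auto

instantiation multiplier :: (complex_algebra) complex_algebra
begin

lift_definition zero_multiplier :: "'a multiplier" is "(\<lambda>_. 0, \<lambda>_. 0)"
  by (simp add: clinear_iff)

lift_definition plus_multiplier :: "'a multiplier \<Rightarrow> 'a multiplier \<Rightarrow> 'a multiplier"
  is "\<lambda>(L, R) (L', R'). (\<lambda>a. L a + L' a, \<lambda>a. R a + R' a)"
  by (auto simp: clinear_iff algebra_simps)

lift_definition cscale_multiplier :: "complex \<Rightarrow> 'a multiplier \<Rightarrow> 'a multiplier"
  is "\<lambda>c (L, R). (\<lambda>a. c *\<^sub>c L a, \<lambda>a. c *\<^sub>c R a)"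
  by (auto simp: clinear_iff cscale_right_distrib mult_cscale_left mult_cscale_right mult.commute)

lift_definition uminus_multiplier :: "'a multiplier \<Rightarrow> 'a multiplier"
  is "\<lambda>(L, R). (\<lambda>a. - L a, \<lambda>a. - R a)"
  by (auto simp: clinear_iff)

lift_definition minus_multiplier :: "'a multiplier \<Rightarrow> 'a multiplier \<Rightarrow> 'a multiplier"
  is "\<lambda>(L, R) (L', R'). (\<lambda>a. L a - L' a, \<lambda>a. R a - R' a)"
  by (auto simp: clinear_iff algebra_simps cvec.scale_right_diff_distrib)

lift_definition times_multiplier :: "'a multiplier \<Rightarrow> 'a multiplier \<Rightarrow> 'a multiplier"
  is "\<lambda>(L, R) (L', R'). (\<lambda>a. L (L' a), \<lambda>a. R' (R a))"
  by (auto simp: clinear_iff)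

instance
  by standard
    (transfer; force simp: clinear_iff algebra_simps cscale_right_distrib cscale_left_distrib)+

end

instantiation multiplier :: (complex_algebra) monoid_mult
begin

lift_definition one_multiplier :: "'a multiplier" is "(\<lambda>a. a, \<lambda>a. a)"
  by (simp add: clinear_iff)

instance
  by standard (transfer; auto)+

end

lemma lact_mult: "lact (m * n) a = lact m (lact n a)"
  by transfer auto

lemma ract_mult: "ract a (m * n) = ract (ract a m) n"
  by transfer auto

lemma lact_one: "lact 1 a = a"
  by transfer auto

lemma ract_one: "ract a 1 = a"
  by transfer auto

lift_definition embed :: "'a::complex_algebra \<Rightarrow> 'a multiplier" is "\<lambda>a. (\<lambda>b. a * b, \<lambda>b. b * a)"
  by (auto simp: clinear_iff algebra_simps mult_cscale_left mult_cscale_right)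

lemma lact_embed: "lact (embed a) b = a * b"
  by transfer auto

lemma ract_embed: "ract b (embed a) = b * a"
  by transfer auto

lemma inj_embed:
  assumes "nondegenerate TYPE('a::complex_algebra)"
  shows "inj (embed :: 'a \<Rightarrow> 'a multiplier)"
proof (rule injI)
  fix x y :: 'a
  assume "embed x = embed y"
  then have "(x - y) * b = 0" for b
    by (metis lact_embed left_diff_distrib right_minus_eq)
  then have "x - y = 0"
    using assms unfolding nondegenerate_def by blast
  then show "x = y" by simp
qed

text \<open>
  The inverse of the embedding, used for multipliers that are known to lie in the algebra.
\<close>

definition element_of :: "'a::complex_algebra multiplier \<Rightarrow> 'a" where
  "element_of m = (THE a. embed a = m)"

lift_definition tensor_mult ::
    "'a::complex_algebra multiplier \<Rightarrow> 'b::complex_algebra multiplier \<Rightarrow> ('a, 'b) tensor multiplier"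
    (infixr "\<otimes>\<^sub>m" 75)
  is "\<lambda>(L, R) (L', R'). (tensor_map L L', tensor_map R R')"
proof (clarsimp, intro conjI allI)
  fix L R :: "'a \<Rightarrow> 'a" and L' R' :: "'b \<Rightarrow> 'b"
  assume lin: "clinear L" "clinear R" "clinear L'" "clinear R'"
    and m: "\<forall>a b. L (a * b) = L a * b" "\<forall>a b. R (a * b) = a * R b" "\<forall>a b. a * L b = R a * b"
    and m': "\<forall>a b. L' (a * b) = L' a * b" "\<forall>a b. R' (a * b) = a * R' b" "\<forall>a b. a * L' b = R' a * b"
  note tl = clinear_tensor_map[OF lin(1,3)] and tr = clinear_tensor_map[OF lin(2,4)]
  note s = clinear_zero[OF tl] clinear_add[OF tl] clinear_zero[OF tr] clinear_add[OF tr]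
    tensor_map_pure[OF lin(1,3)] tensor_map_pure[OF lin(2,4)] pure_tensor_times
    distrib_left distrib_right
  show "clinear (tensor_map L L')" by (rule tl)
  show "clinear (tensor_map R R')" by (rule tr)
  fix x y :: "('a, 'b) tensor"
  have "tensor_map L L' ((a \<otimes> b) * y) = tensor_map L L' (a \<otimes> b) * y" for a b
    by (induction y) (simp_all add: s m m')
  then show "tensor_map L L' (x * y) = tensor_map L L' x * y"
    by (induction x) (simp_all add: s)
  have "tensor_map R R' ((a \<otimes> b) * y) = (a \<otimes> b) * tensor_map R R' y" for a b
    by (induction y) (simp_all add: s m m')
  then show "tensor_map R R' (x * y) = x * tensor_map R R' y"
    by (induction x) (simp_all add: s)
  have "(a \<otimes> b) * tensor_map L L' y = tensor_map R R' (a \<otimes> b) * y" for a b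
    by (induction y) (simp_all add: s m m')
  then show "x * tensor_map L L' y = tensor_map R R' x * y"
    by (induction x) (simp_all add: s)
qed

text \<open>
  Transport of multipliers along an algebra isomorphism; it is only applied to the associativity
  isomorphism and to the exchange of the last two tensor factors.
\<close>

definition transport ::
  "('a::complex_algebra \<Rightarrow> 'b::complex_algebra) \<Rightarrow> 'a multiplier \<Rightarrow> 'b multiplier" where
  "transport \<theta> m = Abs_multiplier (\<lambda>b. \<theta> (lact m (inv \<theta> b)), \<lambda>b. \<theta> (ract (inv \<theta> b) m))"

lemma transport_iso:
  assumes "algebra_hom \<theta>" "bij \<theta>"
  shows "lact (transport \<theta> m) (\<theta> a) = \<theta> (lact m a)"
    and "ract (\<theta> a) (transport \<theta> m) = \<theta> (ract a m)"
proof -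
  have i: "inv \<theta> (\<theta> a) = a" "\<theta> (inv \<theta> b) = b" for a b
    using assms(2) by (simp_all add: bij_is_inj bij_is_surj surj_f_inv_f)
  have t: "\<theta> (a * a') = \<theta> a * \<theta> a'" and l: "clinear \<theta>" for a a'
    using assms(1) by (simp_all add: algebra_hom_def)
  have it: "inv \<theta> (b * b') = inv \<theta> b * inv \<theta> b'" for b b'
    using t[of "inv \<theta> b" "inv \<theta> b'"] by (metis i)
  have il: "clinear (inv \<theta>)"
  proof (rule clinearI)
    fix x y c
    show "inv \<theta> (x + y) = inv \<theta> x + inv \<theta> y"
      using clinear_add[OF l, of "inv \<theta> x" "inv \<theta> y"] by (metis i)
    show "inv \<theta> (c *\<^sub>c x) = c *\<^sub>c inv \<theta> x"
      using clinear_cscale[OF l, of c "inv \<theta> x"] by (metis i)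
  qed
  have "b * \<theta> (lact m (inv \<theta> b')) = \<theta> (ract (inv \<theta> b) m) * b'" for b b'
    using t[of "inv \<theta> b" "lact m (inv \<theta> b')"] t[of "ract (inv \<theta> b) m" "inv \<theta> b'"]
    by (simp add: i times_lact)
  then have "(\<lambda>b. \<theta> (lact m (inv \<theta> b)), \<lambda>b. \<theta> (ract (inv \<theta> b) m)) \<in>
      {(L, R). clinear L \<and> clinear R \<and> (\<forall>a b. L (a * b) = L a * b) \<and>
        (\<forall>a b. R (a * b) = a * R b) \<and> (\<forall>a b. a * L b = R a * b)}"
    using clinear_compose[OF l clinear_compose[OF clinear_lact il]]
      clinear_compose[OF l clinear_compose[OF clinear_ract il]]
    by (simp add: it lact_times ract_times t i)
  then have "Rep_multiplier (transport \<theta> m) =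
      (\<lambda>b. \<theta> (lact m (inv \<theta> b)), \<lambda>b. \<theta> (ract (inv \<theta> b) m))"
    unfolding transport_def by (rule Abs_multiplier_inverse)
  then show "lact (transport \<theta> m) (\<theta> a) = \<theta> (lact m a)"
    and "ract (\<theta> a) (transport \<theta> m) = \<theta> (ract a m)"
    by (simp_all add: lact.rep_eq ract.rep_eq i)
qed

lemma cbilinear_pure_assoc:
  "cbilinear (\<lambda>(a::'a::complex_vector) (b::'b::complex_vector). a \<otimes> (b \<otimes> (c::'c::complex_vector)))"
  by (rule cbilinearI)
    (simp_all add: pure_tensor_add_left pure_tensor_add_right
      pure_tensor_cscale_left pure_tensor_cscale_right)

lemma cbilinear_pure_swap:
  "cbilinear (\<lambda>(a::'a::complex_vector) (b::'b::complex_vector). b \<otimes> a)"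
  by (rule cbilinearI)
    (simp_all add: pure_tensor_add_left pure_tensor_add_right
      pure_tensor_cscale_left pure_tensor_cscale_right)

lemma cbilinear_tensor_assoc:
  "cbilinear (\<lambda>x (c::'c::complex_vector).
     tensor_lift (\<lambda>(a::'a::complex_vector) (b::'b::complex_vector). a \<otimes> (b \<otimes> c)) x)"
proof -
  note l = clinear_tensor_lift[OF cbilinear_pure_assoc]
  have r: "clinear (\<lambda>c::'c. tensor_lift (\<lambda>(a::'a) (b::'b). a \<otimes> (b \<otimes> c)) x)" for x
  proof (induction x)
    case zero
    show ?case by (simp add: clinear_zero[OF l] clinear_iff)
  next
    case (pure a b)
    show ?case
      by (simp add: tensor_lift_pure[OF cbilinear_pure_assoc] clinear_iff
          pure_tensor_add_right pure_tensor_cscale_right)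
  next
    case (add x y)
    then show ?case
      by (simp add: clinear_add[OF l] clinear_iff cscale_right_distrib add.assoc add.left_commute)
  qed
  show ?thesis
    unfolding cbilinear_def using l r by blast
qed

lemma clinear_tensor_assoc: "clinear tensor_assoc"
  unfolding tensor_assoc_def by (rule clinear_tensor_lift[OF cbilinear_tensor_assoc])

lemma tensor_assoc_pure: "tensor_assoc ((a \<otimes> b) \<otimes> c) = a \<otimes> (b \<otimes> c)"
  by (simp only: tensor_assoc_def tensor_lift_pure[OF cbilinear_tensor_assoc]
      tensor_lift_pure[OF cbilinear_pure_assoc])

lemma clinear_tensor_swap: "clinear tensor_swap"
  unfolding tensor_swap_def by (rule clinear_tensor_lift[OF cbilinear_pure_swap])

lemma tensor_swap_pure: "tensor_swap (a \<otimes> b) = b \<otimes> a"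
  by (simp only: tensor_swap_def tensor_lift_pure[OF cbilinear_pure_swap])

lemma algebra_hom_tensor_assoc: "algebra_hom tensor_assoc"
  unfolding algebra_hom_def
proof (intro conjI allI)
  show lin: "clinear (tensor_assoc ::
      (('a::complex_algebra, 'b::complex_algebra) tensor, 'c::complex_algebra) tensor \<Rightarrow> _)"
    by (rule clinear_tensor_assoc)
  note s = clinear_zero[OF lin] clinear_add[OF lin] distrib_left distrib_right
  fix x y :: "(('a, 'b) tensor, 'c) tensor"
  have ppp: "tensor_assoc (((a \<otimes> b) \<otimes> c) * ((a' \<otimes> b') \<otimes> c')) =
      tensor_assoc ((a \<otimes> b) \<otimes> c) * tensor_assoc ((a' \<otimes> b') \<otimes> c')"
    for a a' :: 'a and b b' :: 'b and c c' :: 'c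
    by (simp add: pure_tensor_times tensor_assoc_pure)
  have ppt: "tensor_assoc (((a \<otimes> b) \<otimes> c) * (t \<otimes> c')) =
      tensor_assoc ((a \<otimes> b) \<otimes> c) * tensor_assoc (t \<otimes> c')"
    for a :: 'a and b :: 'b and c c' :: 'c and t
    by (induction t) (simp_all add: s pure_tensor_zero_left ppp pure_tensor_add_left)
  have pt: "tensor_assoc (((a \<otimes> b) \<otimes> c) * y) = tensor_assoc ((a \<otimes> b) \<otimes> c) * tensor_assoc y"
    for a :: 'a and b :: 'b and c :: 'c
    by (induction y) (simp_all add: s ppt)
  have tt: "tensor_assoc ((t \<otimes> c) * y) = tensor_assoc (t \<otimes> c) * tensor_assoc y" for t and c :: 'c
    by (induction t) (simp_all add: s pure_tensor_zero_left pt pure_tensor_add_left)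
  show "tensor_assoc (x * y) = tensor_assoc x * tensor_assoc y"
    by (induction x) (simp_all add: s tt)
qed

lemma bij_tensor_assoc:
  "bij (tensor_assoc ::
     (('a::complex_vector, 'b::complex_vector) tensor, 'c::complex_vector) tensor \<Rightarrow> _)"
proof (rule o_bij)
  let ?b = "tensor_swap \<circ> tensor_assoc \<circ> tensor_swap \<circ> tensor_assoc \<circ> tensor_swap ::
    ('a, ('b, 'c) tensor) tensor \<Rightarrow> _"
  note r = clinear_zero[OF clinear_tensor_swap] clinear_add[OF clinear_tensor_swap]
    clinear_zero[OF clinear_tensor_assoc] clinear_add[OF clinear_tensor_assoc]
    tensor_swap_pure tensor_assoc_pure pure_tensor_add_left pure_tensor_add_right
    pure_tensor_zero_left pure_tensor_zero_right
  have "?b (tensor_assoc (t \<otimes> c)) = t \<otimes> c"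
    for t :: "('a, 'b) tensor" and c :: "'c"
    by (induction t) (simp_all add: r)
  then have "?b (tensor_assoc x) = x"
    for x :: "(('a, 'b) tensor, 'c) tensor"
    by (induction x) (simp_all add: r)
  then show "?b \<circ> tensor_assoc = id"
    by (auto simp: fun_eq_iff)
  have "tensor_assoc (?b (a \<otimes> t)) = a \<otimes> t"
    for t :: "('b, 'c) tensor" and a :: "'a"
    by (induction t) (simp_all add: r)
  then have "tensor_assoc (?b x) = x"
    for x :: "('a, ('b, 'c) tensor) tensor"
    by (induction x) (simp_all add: r)
  then show "tensor_assoc \<circ> ?b = id"
    by (auto simp: fun_eq_iff)
qed

text \<open>
  The three-fold tensor product is nested to the right. \<open>mult_assoc\<close> moves a multiplier of the
  left-nested product there, and \<open>leg13\<close> is $X \mapsto X_{13}$.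
\<close>

definition mult_assoc ::
  "(('a::complex_algebra, 'b::complex_algebra) tensor, 'c::complex_algebra) tensor multiplier
     \<Rightarrow> ('a, ('b, 'c) tensor) tensor multiplier" where
  "mult_assoc = transport tensor_assoc"

definition leg13 ::
  "('a::complex_algebra, 'c::complex_algebra) tensor multiplier
     \<Rightarrow> ('a, ('b::complex_algebra, 'c) tensor) tensor multiplier" where
  "leg13 X = transport (tensor_map id tensor_swap) (mult_assoc (X \<otimes>\<^sub>m 1))"

text \<open>
  The extension of a homomorphism \<open>\<phi> : A \<rightarrow> M(B)\<close> to a homomorphism on \<open>M(A)\<close> with value \<open>F\<close> at the
  identity. It exists and is unique if \<open>A\<close> and \<open>B\<close> are non-degenerate, \<open>F\<close> is idempotent and the
  spans of \<open>\<phi>(A)B\<close> and \<open>B\<phi>(A)\<close> are \<open>FB\<close> and \<open>BF\<close>.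
\<close>

definition mult_extension ::
  "('a::complex_algebra \<Rightarrow> 'b::complex_algebra multiplier) \<Rightarrow> 'b multiplier
     \<Rightarrow> 'a multiplier \<Rightarrow> 'b multiplier" where
  "mult_extension \<phi> F = (THE \<Phi>. algebra_hom \<Phi> \<and> (\<forall>a. \<Phi> (embed a) = \<phi> a) \<and> \<Phi> 1 = F)"

definition slice_left :: "('a::complex_vector \<Rightarrow> complex) \<Rightarrow> ('a, 'b::complex_vector) tensor \<Rightarrow> 'b" where
  "slice_left f = tensor_lift (\<lambda>a b. f a *\<^sub>c b)"

definition slice_right :: "('b::complex_vector \<Rightarrow> complex) \<Rightarrow> ('a::complex_vector, 'b) tensor \<Rightarrow> 'a" where
  "slice_right f = tensor_lift (\<lambda>a b. f b *\<^sub>c a)"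

text \<open>
  $(f \otimes id)X$ and $(id \otimes f)X$ for a multiplier \<open>X\<close> of \<open>A \<otimes> B\<close> such that
  \<open>X(1 \<otimes> b)\<close> and \<open>(1 \<otimes> b)X\<close>, respectively \<open>X(a \<otimes> 1)\<close> and \<open>(a \<otimes> 1)X\<close>, lie in \<open>A \<otimes> B\<close>.
\<close>

definition mult_slice_left ::
  "('a::complex_algebra \<Rightarrow> complex) \<Rightarrow> ('a, 'b::complex_algebra) tensor multiplier \<Rightarrow> 'b multiplier" where
  "mult_slice_left f X = (THE m. \<forall>b.
     lact m b = slice_left f (element_of (X * (1 \<otimes>\<^sub>m embed b))) \<and>
     ract b m = slice_left f (element_of ((1 \<otimes>\<^sub>m embed b) * X)))"

definition mult_slice_right ::
  "('b::complex_algebra \<Rightarrow> complex) \<Rightarrow> ('a::complex_algebra, 'b) tensor multiplier \<Rightarrow> 'a multiplier" where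
  "mult_slice_right f X = (THE m. \<forall>a.
     lact m a = slice_right f (element_of (X * (embed a \<otimes>\<^sub>m 1))) \<and>
     ract a m = slice_right f (element_of ((embed a \<otimes>\<^sub>m 1) * X)))"


section \<open>Weak multiplier Hopf algebras\<close>

definition T1 ::
  "('a::complex_algebra \<Rightarrow> ('a, 'a) tensor multiplier) \<Rightarrow> ('a, 'a) tensor \<Rightarrow> ('a, 'a) tensor" where
  "T1 \<Delta> = tensor_lift (\<lambda>a b. element_of (\<Delta> a * (1 \<otimes>\<^sub>m embed b)))"

definition T2 ::
  "('a::complex_algebra \<Rightarrow> ('a, 'a) tensor multiplier) \<Rightarrow> ('a, 'a) tensor \<Rightarrow> ('a, 'a) tensor" where
  "T2 \<Delta> = tensor_lift (\<lambda>a b. element_of ((embed a \<otimes>\<^sub>m 1) * \<Delta> b))"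

definition Delta_id ::
  "('a::complex_algebra \<Rightarrow> ('a, 'a) tensor multiplier)
     \<Rightarrow> ('a, 'a) tensor \<Rightarrow> ('a, ('a, 'a) tensor) tensor multiplier" where
  "Delta_id \<Delta> = tensor_lift (\<lambda>a b. mult_assoc (\<Delta> a \<otimes>\<^sub>m embed b))"

definition id_Delta ::
  "('a::complex_algebra \<Rightarrow> ('a, 'a) tensor multiplier)
     \<Rightarrow> ('a, 'a) tensor \<Rightarrow> ('a, ('a, 'a) tensor) tensor multiplier" where
  "id_Delta \<Delta> = tensor_lift (\<lambda>a b. embed a \<otimes>\<^sub>m \<Delta> b)"

definition coproduct :: "('a::complex_algebra \<Rightarrow> ('a, 'a) tensor multiplier) \<Rightarrow> bool" where
  "coproduct \<Delta> \<longleftrightarrow>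
     algebra_hom \<Delta> \<and>
     (\<forall>a b. \<Delta> a * (1 \<otimes>\<^sub>m embed b) \<in> range embed) \<and>
     (\<forall>a b. (embed a \<otimes>\<^sub>m 1) * \<Delta> b \<in> range embed) \<and>
     (\<forall>a b c. (embed a \<otimes>\<^sub>m 1 \<otimes>\<^sub>m 1) * Delta_id \<Delta> (T1 \<Delta> (b \<otimes> c)) =
        id_Delta \<Delta> (T2 \<Delta> (a \<otimes> b)) * (1 \<otimes>\<^sub>m 1 \<otimes>\<^sub>m embed c))"

definition tensor_subspace ::
  "'a::complex_vector set \<Rightarrow> 'b::complex_vector set \<Rightarrow> ('a, 'b) tensor set" where
  "tensor_subspace V W = cvec.span {v \<otimes> w | v w. v \<in> V \<and> w \<in> W}"

definition full_coproduct :: "('a::complex_algebra \<Rightarrow> ('a, 'a) tensor multiplier) \<Rightarrow> bool" where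
  "full_coproduct \<Delta> \<longleftrightarrow>
     \<Inter>{V. cvec.subspace V \<and> (\<forall>a b. T1 \<Delta> (a \<otimes> b) \<in> tensor_subspace V UNIV)} = UNIV \<and>
     \<Inter>{W. cvec.subspace W \<and> (\<forall>a b. T2 \<Delta> (a \<otimes> b) \<in> tensor_subspace UNIV W)} = UNIV"

definition counit ::
  "('a::complex_algebra \<Rightarrow> ('a, 'a) tensor multiplier) \<Rightarrow> ('a \<Rightarrow> complex) \<Rightarrow> bool" where
  "counit \<Delta> \<epsilon> \<longleftrightarrow>
     clinear \<epsilon> \<and>
     (\<forall>a b. slice_left \<epsilon> (T1 \<Delta> (a \<otimes> b)) = a * b) \<and>
     (\<forall>a c. slice_right \<epsilon> (T2 \<Delta> (c \<otimes> a)) = c * a)"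

text \<open>The extension of \<open>\<Delta>\<close> to \<open>M(A)\<close> and of \<open>id \<otimes> \<Delta>\<close> to \<open>M(A \<otimes> A)\<close>.\<close>

definition Delta_ext ::
  "('a::complex_algebra \<Rightarrow> ('a, 'a) tensor multiplier) \<Rightarrow> ('a, 'a) tensor multiplier
     \<Rightarrow> 'a multiplier \<Rightarrow> ('a, 'a) tensor multiplier" where
  "Delta_ext \<Delta> E = mult_extension \<Delta> E"

definition id_Delta_ext ::
  "('a::complex_algebra \<Rightarrow> ('a, 'a) tensor multiplier) \<Rightarrow> ('a, 'a) tensor multiplier
     \<Rightarrow> ('a, 'a) tensor multiplier \<Rightarrow> ('a, ('a, 'a) tensor) tensor multiplier" where
  "id_Delta_ext \<Delta> E = mult_extension (id_Delta \<Delta>) (1 \<otimes>\<^sub>m E)"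

text \<open>The maps $G_1 \otimes id$ and $id \otimes G_2$ on the right-nested three-fold tensor product.\<close>

definition tensor_id ::
  "(('a::complex_vector, 'a) tensor \<Rightarrow> ('a, 'a) tensor)
     \<Rightarrow> ('a, ('a, 'a) tensor) tensor \<Rightarrow> ('a, ('a, 'a) tensor) tensor" where
  "tensor_id G x = tensor_assoc (tensor_map G id (inv tensor_assoc x))"

definition id_tensor ::
  "(('a::complex_vector, 'a) tensor \<Rightarrow> ('a, 'a) tensor)
     \<Rightarrow> ('a, ('a, 'a) tensor) tensor \<Rightarrow> ('a, ('a, 'a) tensor) tensor" where
  "id_tensor G = tensor_map id G"

text \<open>
  The idempotent \<open>E\<close>, the counit and the maps \<open>G1\<close>, \<open>G2\<close> are parameters; each is uniquely
  determined by the assumptions and \<open>\<Delta>\<close>.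
\<close>

locale weak_multiplier_Hopf_algebra =
  fixes \<Delta> :: "'a::complex_algebra \<Rightarrow> ('a, 'a) tensor multiplier"
    and \<epsilon> :: "'a \<Rightarrow> complex"
    and E :: "('a, 'a) tensor multiplier"
    and G1 G2 :: "('a, 'a) tensor \<Rightarrow> ('a, 'a) tensor"
  assumes nondegenerate: "nondegenerate TYPE('a)"
    and idempotent: "idempotent_algebra TYPE('a)"
    and coproduct: "coproduct \<Delta>"
    and full: "full_coproduct \<Delta>"
    and counit: "counit \<Delta> \<epsilon>"
    and E_idempotent: "E * E = E"
    and range_T1: "range (T1 \<Delta>) = range (lact E)"
    and range_T2: "range (T2 \<Delta>) = range (\<lambda>x. ract x E)"
    and id_Delta_E1: "id_Delta_ext \<Delta> E E = mult_assoc (E \<otimes>\<^sub>m 1) * (1 \<otimes>\<^sub>m E)"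
    and id_Delta_E2: "id_Delta_ext \<Delta> E E = (1 \<otimes>\<^sub>m E) * mult_assoc (E \<otimes>\<^sub>m 1)"
    and G1_linear: "clinear G1"
    and G2_linear: "clinear G2"
    and G1: "embed (tensor_id G1
               (element_of (leg13 (\<Delta> a) * (1 \<otimes>\<^sub>m embed b \<otimes>\<^sub>m embed c)))) =
             leg13 (\<Delta> a) * (1 \<otimes>\<^sub>m E) * (1 \<otimes>\<^sub>m embed b \<otimes>\<^sub>m embed c)"
    and G2: "embed (id_tensor G2
               (element_of ((embed a \<otimes>\<^sub>m embed b \<otimes>\<^sub>m 1) * leg13 (\<Delta> c)))) =
             (embed a \<otimes>\<^sub>m embed b \<otimes>\<^sub>m 1) * mult_assoc (E \<otimes>\<^sub>m 1) * leg13 (\<Delta> c)"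
    and ker_T1: "{x. T1 \<Delta> x = 0} = range (\<lambda>x. x - G1 x)"
    and ker_T2: "{x. T2 \<Delta> x = 0} = range (\<lambda>x. x - G2 x)"

text \<open>
  The Sweedler formulas for the antipode are stated after multiplying by elements that bring every
  leg into \<open>A\<close>; as the product is non-degenerate, nothing is lost:
  \<^item> \<open>antipode_E_left\<close>: $(c \otimes d)\,E(a \otimes b) = \sum ca_{(1)} \otimes da_{(2)}S(a_{(3)})b$
  \<^item> \<open>antipode_E_right\<close>: $(a \otimes b)E\,(c \otimes d) = \sum aS(b_{(1)})b_{(2)}c \otimes b_{(3)}d$
  \<^item> \<open>antipode_G1\<close>: $(c \otimes 1)\,G_1(a \otimes b) = \sum ca_{(1)} \otimes S(a_{(2)})a_{(3)}b$
  \<^item> \<open>antipode_G2\<close>: $G_2(a \otimes b)(1 \otimes c) = \sum ab_{(1)}S(b_{(2)}) \otimes b_{(3)}c$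
  \<^item> \<open>antipode_S\<close>: $\sum S(a_{(1)})\,a_{(2)}S(a_{(3)})b = S(a)b$, where
    $\sum a_{(1)} \otimes a_{(2)}S(a_{(3)})b$ is the element $E(a \otimes b)$ of $A \otimes A$.

  For instance, in \<open>antipode_E_left\<close>, \<open>u \<otimes> v\<close> stands for $\sum ca_{(1)} \otimes a_{(2)}$ and
  \<open>p \<otimes> q\<close> for $\sum dv_{(1)} \otimes v_{(2)}$.
\<close>

locale weak_multiplier_Hopf_algebra_antipode = weak_multiplier_Hopf_algebra \<Delta> \<epsilon> E G1 G2
  for \<Delta> :: "'a::complex_algebra \<Rightarrow> ('a, 'a) tensor multiplier" and \<epsilon> E G1 G2 +
  fixes S :: "'a \<Rightarrow> 'a multiplier"
  assumes antipode_antihom: "algebra_antihom S"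
    and antipode_nondegenerate_left: "cvec.span {lact (S a) b | a b. True} = UNIV"
    and antipode_nondegenerate_right: "cvec.span {ract b (S a) | a b. True} = UNIV"
    and antipode_E_left:
      "(c \<otimes> d) * lact E (a \<otimes> b) =
         tensor_lift (\<lambda>u v. u \<otimes> tensor_lift (\<lambda>p q. p * lact (S q) b) (T2 \<Delta> (d \<otimes> v))) (T2 \<Delta> (c \<otimes> a))"
    and antipode_E_right:
      "ract (a \<otimes> b) E * (c \<otimes> d) =
         tensor_lift (\<lambda>u v. tensor_lift (\<lambda>p q. ract a (S p) * q) (T1 \<Delta> (u \<otimes> c)) \<otimes> v) (T1 \<Delta> (b \<otimes> d))"
    and antipode_G1:
      "lact (embed c \<otimes>\<^sub>m 1) (G1 (a \<otimes> b)) =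
         tensor_lift (\<lambda>u v. tensor_lift (\<lambda>p q. p \<otimes> lact (S q) v) (T2 \<Delta> (c \<otimes> u))) (T1 \<Delta> (a \<otimes> b))"
    and antipode_G2:
      "ract (G2 (a \<otimes> b)) (1 \<otimes>\<^sub>m embed c) =
         tensor_lift (\<lambda>u v. tensor_lift (\<lambda>p q. ract u (S p) \<otimes> q) (T1 \<Delta> (v \<otimes> c))) (T2 \<Delta> (a \<otimes> b))"
    and antipode_S:
      "tensor_lift (\<lambda>u v. lact (S u) v) (lact E (a \<otimes> b)) = lact (S a) b"

locale regular_weak_multiplier_Hopf_algebra = weak_multiplier_Hopf_algebra_antipode \<Delta> \<epsilon> E G1 G2 S
  for \<Delta> :: "'a::complex_algebra \<Rightarrow> ('a, 'a) tensor multiplier" and \<epsilon> E G1 G2 S +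
  assumes antipode_bij: "bij_betw S UNIV (range embed)"

text \<open>$\varepsilon_t(a) = \sum a_{(1)}S(a_{(2)})$, determined by $d\,\varepsilon_t(a) = \sum da_{(1)}S(a_{(2)})$ for all $d$.\<close>

definition eps_t ::
  "('a::complex_algebra \<Rightarrow> ('a, 'a) tensor multiplier) \<Rightarrow> ('a \<Rightarrow> 'a multiplier)
     \<Rightarrow> 'a \<Rightarrow> 'a multiplier" where
  "eps_t \<Delta> S a = (THE m. \<forall>d. embed d * m = tensor_lift (\<lambda>p q. embed p * S q) (T2 \<Delta> (d \<otimes> a)))"

definition A_s ::
  "('a::complex_algebra \<Rightarrow> ('a, 'a) tensor multiplier) \<Rightarrow> ('a, 'a) tensor multiplier
     \<Rightarrow> 'a multiplier set" where
  "A_s \<Delta> E = {y. Delta_ext \<Delta> E y = E * (1 \<otimes>\<^sub>m y)}"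

definition A_t ::
  "('a::complex_algebra \<Rightarrow> ('a, 'a) tensor multiplier) \<Rightarrow> ('a, 'a) tensor multiplier
     \<Rightarrow> 'a multiplier set" where
  "A_t \<Delta> E = {x. Delta_ext \<Delta> E x = (x \<otimes>\<^sub>m 1) * E}"

definition left_cointegral ::
  "('a::complex_algebra \<Rightarrow> ('a, 'a) tensor multiplier) \<Rightarrow> ('a \<Rightarrow> 'a multiplier)
     \<Rightarrow> 'a multiplier \<Rightarrow> bool" where
  "left_cointegral \<Delta> S h \<longleftrightarrow> h \<noteq> 0 \<and> (\<forall>a. embed a * h = eps_t \<Delta> S a * h)"

definition faithful_cointegral ::
  "('a::complex_algebra \<Rightarrow> ('a, 'a) tensor multiplier) \<Rightarrow> ('a, 'a) tensor multiplier
     \<Rightarrow> 'a multiplier \<Rightarrow> bool" where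
  "faithful_cointegral \<Delta> E h \<longleftrightarrow>
     (\<forall>f. clinear f \<longrightarrow>
        mult_slice_right f (Delta_ext \<Delta> E h) = 0 \<or> mult_slice_left f (Delta_ext \<Delta> E h) = 0 \<longrightarrow>
        f = (\<lambda>_. 0))"

definition left_integral ::
  "('a::complex_algebra \<Rightarrow> ('a, 'a) tensor multiplier) \<Rightarrow> ('a, 'a) tensor multiplier
     \<Rightarrow> ('a \<Rightarrow> complex) \<Rightarrow> bool" where
  "left_integral \<Delta> E \<phi> \<longleftrightarrow>
     clinear \<phi> \<and> \<phi> \<noteq> (\<lambda>_. 0) \<and> (\<forall>a. mult_slice_right \<phi> (\<Delta> a) \<in> A_t \<Delta> E)"

definition right_integral ::
  "('a::complex_algebra \<Rightarrow> ('a, 'a) tensor multiplier) \<Rightarrow> ('a, 'a) tensor multiplier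
     \<Rightarrow> ('a \<Rightarrow> complex) \<Rightarrow> bool" where
  "right_integral \<Delta> E \<psi> \<longleftrightarrow>
     clinear \<psi> \<and> \<psi> \<noteq> (\<lambda>_. 0) \<and> (\<forall>a. mult_slice_left \<psi> (\<Delta> a) \<in> A_s \<Delta> E)"

end

theory Submission
  imports Defs
begin

text \<open>
  Call a functional \<open>\<phi>\<close> normalized if $(id \otimes \varphi)\Delta(h) = 1$. By
  coassociativity such a \<open>\<phi>\<close> satisfies $\sum h_{(1)} \otimes h_{(2)} \varphi(h_{(3)}) =
  \Delta(1) = E$. Put $x_a = (id \otimes \varphi)\Delta(a)$; the claim that \<open>\<phi>\<close> is a left
  integral is the identity $\Delta(x_a) = (x_a \otimes 1)E$, which is linear in \<open>a\<close>.
  Faithfulness of \<open>h\<close> says that a linear identity in \<open>a\<close> holds on all of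
  \<open>A\<close> as soon as it holds for the second leg of $\Delta(h)$, that is, after replacing
  \<open>a\<close> by $h_{(2)}$ and tensoring with $h_{(1)}$ on the left. There the two sides become $(id
  \otimes \Delta)E = (1 \otimes E)(E \otimes 1)$ and $(E \otimes 1)(1 \otimes E)$, which agree
  (\<open>slice_invariance\<close>).

  A normalized functional has to satisfy $\varphi((g \otimes id)((b \otimes 1)\Delta(h))) = g(b)$ for all
  functionals \<open>g\<close> and all \<open>b\<close>, and it exists if every linear relation between the
  arguments on the left is also satisfied by the values on the right. A relation $\sum (g_i \otimes id)((b_i
  \otimes 1)\Delta(h)) = 0$ says that the functional $\sum g_i(b_i\,\cdot\,)$ annihilates the first leg of
  $\Delta(h)$, so it is zero because \<open>h\<close> is faithful; evaluating it at a common right unit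
  \<open>e\<close> of the $b_i$ gives $\sum g_i(b_i) = 0$ (\<open>normalized_functional_exists\<close>).

  This presupposes local units, and the slices of $\Delta(a)$ make sense only if $\Delta(a)(b \otimes 1)$
  and $(1 \otimes b)\Delta(a)$ lie in $A \otimes A$. Both facts come from the bijectivity of
  \<open>S\<close>. The element $\sum a_{(1)} \otimes S(a_{(2)})b$ lies in $A \otimes A$ because the map
  sending $a \otimes b$ to it, a generalized inverse of $T_1$, takes the same value on $a \otimes b$ and on
  $E(a \otimes b)$ and is known to carry $E(A \otimes A)$ into $A \otimes A$; applying $S^{-1}$ to its
  second leg yields $(1 \otimes b')\Delta(a)$ (\<open>l1_left_cover\<close>). For local units
  (\<open>S_right_unit\<close>), $E(x \otimes 1)$ is a finite sum $\sum u_i \otimes m_i$ with $u_i \in Ax$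
  and $m_i \in M(A)$, so that $S(x) = \sum S(u_i)m_i$ lies in $S(x)A$.

  The right integral is obtained from the left one by passing to the opposite product and the opposite
  coproduct. To make this symmetry available, the argument is carried out in the locales
  \<open>weak_hopf_core\<close> and \<open>weak_hopf_core_antipode\<close>, which mention only the product
  and linear maps on $A$ and $A \otimes A$. The second one contains the identity $\sum
  S(a_{(1)})a_{(2)}S(a_{(3)}) = S(a)$ for the left multiplication by \<open>E\<close> only; its counterpart
  for the right multiplication (\<open>antipode_right\<close>) has to be proved before the opposite
  structure is seen to satisfy the same assumptions (\<open>flipped\<close>).
\<close>

section \<open>Linear maps on tensor products\<close>

text \<open>
  Read \<open>tsum z (\<lambda>u v. h u v)\<close> as $\sum h(u, v)$ over a representation $z = \sum u
  \otimes v$; with this argument order nested sums follow the order of Sweedler notation.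
\<close>

abbreviation tsum ::
  "('a::complex_vector, 'b::complex_vector) tensor \<Rightarrow> ('a \<Rightarrow> 'b \<Rightarrow> 'c::complex_vector) \<Rightarrow> 'c" where
  "tsum z h \<equiv> tensor_lift h z"

lemma cscale_complex: "(c::complex) *\<^sub>c x = c * x"
  by (simp add: cscale_complex_def)

lemma clinear_minus_eq: "clinear f \<Longrightarrow> f (x - y) = f x - f y"
  using clinear_add[of f x "- y"] clinear_minus[of f y] by simp

text \<open>
  The rules that decide linearity by following the syntax of a term. They discharge the side conditions of
  all rearrangements of sums below.
\<close>

named_theorems lin

lemma cbilinear_iff [lin]:
  "cbilinear h \<longleftrightarrow> (\<forall>a. clinear (\<lambda>b. h a b)) \<and> (\<forall>b. clinear (\<lambda>a. h a b))"
  by (simp add: cbilinear_def)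

lemma clinear_ident [lin]: "clinear (\<lambda>x. x)" "clinear id"
  by (simp_all add: clinear_iff)

lemma clinear_const0 [lin]: "clinear (\<lambda>x. 0)"
  by (simp add: clinear_iff)

lemma clinear_plus [lin]: "clinear f \<Longrightarrow> clinear g \<Longrightarrow> clinear (\<lambda>x. f x + g x)"
  by (simp add: clinear_iff cscale_right_distrib add_ac)

lemma clinear_diff [lin]: "clinear f \<Longrightarrow> clinear g \<Longrightarrow> clinear (\<lambda>x. f x - g x)"
  by (simp add: clinear_iff cvec.scale_right_diff_distrib)

lemma clinear_scale [lin]: "clinear f \<Longrightarrow> clinear (\<lambda>x. c *\<^sub>c f x)"
  by (simp add: clinear_iff cscale_right_distrib mult.commute)

lemma clinear_scale_left [lin]: "clinear f \<Longrightarrow> clinear (\<lambda>x. f x *\<^sub>c b)"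
  by (auto intro!: clinearI simp: clinear_add clinear_cscale cscale_left_distrib cscale_cscale
      cscale_complex)

lemma clinear_pure_left [lin]: "clinear f \<Longrightarrow> clinear (\<lambda>x. f x \<otimes> b)"
  by (simp add: clinear_iff pure_tensor_add_left pure_tensor_cscale_left)

lemma clinear_pure_right [lin]: "clinear f \<Longrightarrow> clinear (\<lambda>x. a \<otimes> f x)"
  by (simp add: clinear_iff pure_tensor_add_right pure_tensor_cscale_right)

lemma clinear_times_fixed_right [lin]: "clinear f \<Longrightarrow> clinear (\<lambda>x. f x * (b::'b::complex_algebra))"
  by (simp add: clinear_iff distrib_right mult_cscale_left)

lemma clinear_times_fixed_left [lin]: "clinear f \<Longrightarrow> clinear (\<lambda>x. (a::'b::complex_algebra) * f x)"
  by (simp add: clinear_iff distrib_left mult_cscale_right)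

lemma clinear_tsum [lin]:
  "(\<And>a. clinear (\<lambda>b. h a b)) \<Longrightarrow> (\<And>b. clinear (\<lambda>a. h a b)) \<Longrightarrow> clinear f \<Longrightarrow> clinear (\<lambda>x. tsum (f x) h)"
  by (rule clinear_compose[OF clinear_tensor_lift]) (auto simp: cbilinear_iff)

text \<open>
  Linearity in a parameter of the summand holds for arbitrary summands, since the sum runs over one fixed
  representative of \<open>z\<close>; the same reason makes \<open>tsum_commute\<close> unconditional.
\<close>

lemma clinear_tsum_body [lin]: "(\<And>a b. clinear (\<lambda>x. h x a b)) \<Longrightarrow> clinear (\<lambda>x. tsum z (\<lambda>u v. h x u v))"
proof -
  assume h: "\<And>a b. clinear (\<lambda>x. h x a b)"
  have "clinear (\<lambda>x. sum_list (map (\<lambda>(a, b). h x a b) xs))" for xs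
    by (induction xs) (auto intro!: lin h)
  then show ?thesis by (simp add: tensor_lift_def)
qed

lemma clinear_tmap [lin]:
  "clinear f \<Longrightarrow> clinear g \<Longrightarrow> clinear k \<Longrightarrow> clinear (\<lambda>x. tensor_map f g (k x))"
  by (rule clinear_compose[OF clinear_tensor_map])

lemma clinear_slice_left [lin]: "clinear g \<Longrightarrow> clinear f \<Longrightarrow> clinear (\<lambda>x. slice_left g (f x))"
  unfolding slice_left_def by (intro lin)

lemma clinear_slice_right [lin]: "clinear g \<Longrightarrow> clinear f \<Longrightarrow> clinear (\<lambda>x. slice_right g (f x))"
  unfolding slice_right_def by (intro lin)

lemma clinear_swap [lin]: "clinear f \<Longrightarrow> clinear (\<lambda>x. tensor_swap (f x))"
  by (rule clinear_compose[OF clinear_tensor_swap])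

lemma tsum_pure: "cbilinear h \<Longrightarrow> tsum (a \<otimes> b) h = h a b"
  by (rule tensor_lift_pure)

lemma slice_left_pure: "clinear g \<Longrightarrow> slice_left g (a \<otimes> b) = g a *\<^sub>c b"
  unfolding slice_left_def by (rule tsum_pure) (simp add: lin)

lemma slice_right_pure: "clinear g \<Longrightarrow> slice_right g (a \<otimes> b) = g b *\<^sub>c a"
  unfolding slice_right_def by (rule tsum_pure) (simp add: lin)

lemma linear_tsum: "clinear F \<Longrightarrow> F (tsum z h) = tsum z (\<lambda>u v. F (h u v))"
proof -
  assume F: "clinear F"
  have "F (sum_list (map (\<lambda>(a, b). h a b) xs)) = sum_list (map (\<lambda>(a, b). F (h a b)) xs)" for xs
    by (induction xs) (auto simp: clinear_add[OF F] clinear_zero[OF F])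
  then show ?thesis by (simp add: tensor_lift_def)
qed

lemma tsum_commute: "tsum z (\<lambda>u v. tsum w (h u v)) = tsum w (\<lambda>p q. tsum z (\<lambda>u v. h u v p q))"
proof -
  have "sum_list (map (\<lambda>x. sum_list (map (f x) ys)) xs) =
      sum_list (map (\<lambda>y. sum_list (map (\<lambda>x. f x y) xs)) ys)" for f :: "_ \<Rightarrow> _ \<Rightarrow> 'a" and xs ys
    by (induction xs) (simp_all add: sum_list_addf)
  from this[of "\<lambda>(u, v) (p, q). h u v p q" "rep_tensor w" "rep_tensor z"]
  show ?thesis by (simp add: tensor_lift_def case_prod_unfold)
qed

lemma tsum_tsum: "cbilinear k \<Longrightarrow> tsum (tsum z h) k = tsum z (\<lambda>u v. tsum (h u v) k)"
  by (rule linear_tsum[OF clinear_tensor_lift])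

lemma tsum_eq_pure: "tsum z (\<otimes>) = z"
  by (rule tensor_map_eqI[where f="\<lambda>z. tsum z (\<otimes>)" and g="\<lambda>z. z"])
    (auto simp: tsum_pure cbilinear_pure_tensor intro!: lin)

lemma linear_eq_tsum: "clinear F \<Longrightarrow> F z = tsum z (\<lambda>u v. F (u \<otimes> v))"
  using linear_tsum[where F=F and z=z and h="(\<otimes>)"] by (simp add: tsum_eq_pure)

lemma tsum_tmap: "clinear f \<Longrightarrow> clinear g \<Longrightarrow> cbilinear k \<Longrightarrow>
    tsum (tensor_map f g z) k = tsum z (\<lambda>u v. k (f u) (g v))"
  unfolding tensor_map_def by (simp add: tsum_tsum tsum_pure)

lemma tsum_swap: "cbilinear k \<Longrightarrow> tsum (tensor_swap z) k = tsum z (\<lambda>u v. k v u)"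
  unfolding tensor_swap_def by (simp add: tsum_tsum tsum_pure)

lemma tmap_tmap:
  "clinear f \<Longrightarrow> clinear g \<Longrightarrow> clinear f' \<Longrightarrow> clinear g' \<Longrightarrow>
    tensor_map f g (tensor_map f' g' z) = tensor_map (\<lambda>x. f (f' x)) (\<lambda>x. g (g' x)) z"
  by (rule tensor_map_eqI[where f="\<lambda>z. tensor_map f g (tensor_map f' g' z)"])
    (auto simp: tensor_map_pure clinear_compose intro!: lin clinear_compose[of f f'] clinear_compose[of g g'])

lemma tmap_swap: "clinear f \<Longrightarrow> clinear g \<Longrightarrow>
    tensor_map f g (tensor_swap z) = tensor_swap (tensor_map g f z)"
  by (rule tensor_map_eqI[where f="\<lambda>z. tensor_map f g (tensor_swap z)"])
    (auto simp: tensor_map_pure tensor_swap_pure lin intro!: lin)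

lemma swap_swap: "tensor_swap (tensor_swap z) = z"
  by (rule tensor_map_eqI[where g="\<lambda>z. z"]) (auto simp: tensor_swap_pure intro!: lin)

lemma swap_tsum: "tensor_swap (tsum z h) = tsum z (\<lambda>u v. tensor_swap (h u v))"
  by (rule linear_tsum) (intro lin)

lemma pure_tsum_right: "a \<otimes> tsum z h = tsum z (\<lambda>u v. a \<otimes> h u v)"
  by (rule linear_tsum) (intro lin)

lemma pure_tsum_left: "tsum z h \<otimes> a = tsum z (\<lambda>u v. h u v \<otimes> a)"
  by (rule linear_tsum[of "\<lambda>x. x \<otimes> a"]) (intro lin)

lemma range_conj_swap:
  fixes f :: "('b::complex_vector, 'a::complex_vector) tensor \<Rightarrow> ('c::complex_vector, 'd::complex_vector) tensor"
  shows "range (\<lambda>z. tensor_swap (f (tensor_swap z))) = tensor_swap ` range f"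
proof -
  have "surj (tensor_swap :: ('a, 'b) tensor \<Rightarrow> _)" by (rule surjI[of _ tensor_swap]) (rule swap_swap)
  then have "range f = range (\<lambda>z. f (tensor_swap z))" by (metis image_image)
  then show ?thesis by (simp add: image_image)
qed

lemma slice_left_tmap: "clinear f \<Longrightarrow> clinear g \<Longrightarrow> clinear k \<Longrightarrow>
    slice_left k (tensor_map f g z) = g (slice_left (\<lambda>x. k (f x)) z)"
  unfolding slice_left_def
  by (subst tsum_tmap) (simp_all add: lin clinear_compose linear_tsum[of g] clinear_cscale)

lemma slice_right_tmap: "clinear f \<Longrightarrow> clinear g \<Longrightarrow> clinear k \<Longrightarrow>
    slice_right k (tensor_map f g z) = f (slice_right (\<lambda>x. k (g x)) z)"
  unfolding slice_right_def
  by (subst tsum_tmap) (simp_all add: lin clinear_compose linear_tsum[of f] clinear_cscale)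

lemma slice_left_swap: "clinear k \<Longrightarrow> slice_left k (tensor_swap z) = slice_right k z"
  unfolding slice_right_def slice_left_def by (simp add: tsum_swap lin)

lemma slice_right_swap: "clinear k \<Longrightarrow> slice_right k (tensor_swap z) = slice_left k z"
  unfolding slice_right_def slice_left_def by (simp add: tsum_swap lin)

section \<open>Functionals and separation\<close>

text \<open>
  The coordinates with respect to a Hamel basis, indexed by all vectors; those of the vectors outside the
  basis vanish.
\<close>

lemma coordinate_functionals:
  obtains r :: "'a::complex_vector \<Rightarrow> 'a \<Rightarrow> complex" where
    "\<And>b. clinear (r b)" "\<And>v. finite {b. r b v \<noteq> 0}"
    "\<And>v. v = (\<Sum>b | r b v \<noteq> 0. r b v *\<^sub>c b)"
proof -
  obtain B :: "'a set" where B: "cvec.independent B" "cvec.span B = UNIV"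
    by (metis cvec.maximal_independent_subset top.extremum_uniqueI)
  let ?r = "\<lambda>b v. cvec.representation B v b"
  have "clinear (?r b)" for b
    using B by (auto intro!: clinearI
        simp: cvec.representation_add cvec.representation_scale cscale_complex)
  moreover have "finite {b. ?r b v \<noteq> 0}" for v
    by (rule cvec.finite_representation)
  moreover have "v = (\<Sum>b | ?r b v \<noteq> 0. ?r b v *\<^sub>c b)" for v
    using B by (simp add: cvec.sum_nonzero_representation_eq)
  ultimately show thesis by (rule that)
qed

lemma functionals_separate:
  assumes "\<And>g :: 'a::complex_vector \<Rightarrow> complex. clinear g \<Longrightarrow> g v = g w"
  shows "v = w"
proof -
  obtain r :: "'a \<Rightarrow> 'a \<Rightarrow> complex" where r: "\<And>b. clinear (r b)"
    "\<And>v. v = (\<Sum>b | r b v \<noteq> 0. r b v *\<^sub>c b)"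
    by (rule coordinate_functionals) blast
  have "(\<lambda>b. r b v) = (\<lambda>b. r b w)" using assms r(1) by auto
  then show ?thesis using r(2)[of v] r(2)[of w] by metis
qed

lemma clinear_sum: "clinear f \<Longrightarrow> f (\<Sum>i\<in>I. g i) = (\<Sum>i\<in>I. f (g i))"
  by (induction I rule: infinite_finite_induct) (simp_all add: clinear_zero clinear_add)

text \<open>
  All large enough finite index sets are admitted so that several tensors can be expanded over the same one.
\<close>

lemma tensor_expansion:
  fixes z :: "('a::complex_vector, 'b::complex_vector) tensor"
  assumes r: "\<And>b. clinear (r b)" "\<And>v. finite {b. r b v \<noteq> 0}"
    "\<And>v. v = (\<Sum>b | r b v \<noteq> 0. r b v *\<^sub>c b)"
  shows "\<exists>F. finite F \<and> (\<forall>G. finite G \<longrightarrow> F \<subseteq> G \<longrightarrow> z = (\<Sum>b\<in>G. slice_right (r b) z \<otimes> b))"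
proof (induction z)
  case zero
  have "slice_right (r b) (0::('a, 'b) tensor) = 0" for b
    by (rule clinear_zero) (intro lin r)
  then show ?case by (auto simp: pure_tensor_zero_left)
next
  case (pure a v)
  show ?case
  proof (intro exI[of _ "{b. r b v \<noteq> 0}"] conjI allI impI)
    fix G assume G: "finite G" "{b. r b v \<noteq> 0} \<subseteq> G"
    have "a \<otimes> v = a \<otimes> (\<Sum>b | r b v \<noteq> 0. r b v *\<^sub>c b)" using r(3)[of v] by simp
    also have "\<dots> = (\<Sum>b | r b v \<noteq> 0. (r b v *\<^sub>c a) \<otimes> b)"
      by (subst clinear_sum[of "\<lambda>x. a \<otimes> x"])
        (auto simp: lin pure_tensor_cscale_left pure_tensor_cscale_right)
    also have "\<dots> = (\<Sum>b\<in>G. (r b v *\<^sub>c a) \<otimes> b)"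
      by (rule sum.mono_neutral_left) (use G in \<open>auto simp: pure_tensor_zero_left\<close>)
    finally show "a \<otimes> v = (\<Sum>b\<in>G. slice_right (r b) (a \<otimes> v) \<otimes> b)"
      unfolding slice_right_pure[OF r(1)] .
  qed (rule r(2))
next
  case (add x y)
  then obtain F F' where F: "finite F" "\<And>G. finite G \<Longrightarrow> F \<subseteq> G \<Longrightarrow> x = (\<Sum>b\<in>G. slice_right (r b) x \<otimes> b)"
    "finite F'" "\<And>G. finite G \<Longrightarrow> F' \<subseteq> G \<Longrightarrow> y = (\<Sum>b\<in>G. slice_right (r b) y \<otimes> b)" by blast
  have l: "clinear (slice_right (r b) :: ('a, 'b) tensor \<Rightarrow> 'a)" for b
    by (intro lin r)
  show ?case
  proof (intro exI[of _ "F \<union> F'"] conjI allI impI)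
    fix G assume "finite G" "F \<union> F' \<subseteq> G"
    then have "x = (\<Sum>b\<in>G. slice_right (r b) x \<otimes> b)" "y = (\<Sum>b\<in>G. slice_right (r b) y \<otimes> b)"
      using F by simp_all
    then show "x + y = (\<Sum>b\<in>G. slice_right (r b) (x + y) \<otimes> b)"
      by (simp add: clinear_add[OF l] pure_tensor_add_left sum.distrib)
  qed (use F in auto)
qed

lemma slices_separate_right:
  fixes z :: "('a::complex_vector, 'b::complex_vector) tensor"
  assumes "\<And>g. clinear g \<Longrightarrow> slice_right g z = 0"
  shows "z = 0"
proof -
  obtain r :: "'b \<Rightarrow> 'b \<Rightarrow> complex" where r: "\<And>b. clinear (r b)" "\<And>v. finite {b. r b v \<noteq> 0}"
    "\<And>v. v = (\<Sum>b | r b v \<noteq> 0. r b v *\<^sub>c b)"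
    by (rule coordinate_functionals) blast
  obtain F where "finite F" "\<And>G. finite G \<Longrightarrow> F \<subseteq> G \<Longrightarrow> z = (\<Sum>b\<in>G. slice_right (r b) z \<otimes> b)"
    using tensor_expansion[OF r] by blast
  from this(2)[OF this(1) order_refl] show ?thesis
    by (simp add: assms r(1) pure_tensor_zero_left)
qed

text \<open>
  Slicing the second leg with a functional reduces this to the joint injectivity of the maps \<open>f
  c\<close>. It serves to compare elements of tensor products after covering one leg by elements of
  \<open>A\<close>.
\<close>

lemma tmap_left_cancel:
  fixes z w :: "('a::complex_vector, 'b::complex_vector) tensor"
  assumes f: "\<And>c. clinear (f c)" and sep: "\<And>x. (\<And>c. f c x = 0) \<Longrightarrow> x = 0"
    and eq: "\<And>c. tensor_map (f c) (\<lambda>x. x) z = tensor_map (f c) (\<lambda>x. x) w"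
  shows "z = w"
proof -
  have "z - w = 0"
  proof (rule slices_separate_right, rule sep)
    fix g :: "'b \<Rightarrow> complex" and c
    assume g: "clinear g"
    have "f c (slice_right g (z - w)) = slice_right g (tensor_map (f c) (\<lambda>x. x) (z - w))"
      by (simp add: slice_right_tmap f g lin)
    also have "tensor_map (f c) (\<lambda>x. x) (z - w) = 0"
      unfolding clinear_minus_eq[OF clinear_tensor_map[OF f[of c] clinear_ident(1)]] eq[of c] by simp
    finally show "f c (slice_right g (z - w)) = 0"
      by (simp add: clinear_zero[OF clinear_slice_right[OF g clinear_ident(1)]])
  qed
  then show ?thesis by simp
qed

lemma tmap_right_cancel:
  assumes f: "\<And>c. clinear (f c)" and sep: "\<And>x. (\<And>c. f c x = 0) \<Longrightarrow> x = 0"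
    and eq: "\<And>c. tensor_map (\<lambda>x. x) (f c) z = tensor_map (\<lambda>x. x) (f c) w"
  shows "z = w"
proof -
  have "tensor_swap z = tensor_swap w"
    by (rule tmap_left_cancel[OF f sep]) (simp_all add: tmap_swap f lin eq)
  then show ?thesis using swap_swap by metis
qed

text \<open>
  An identity $\sum \alpha(x, e) \otimes y = \sum \beta(x', e) \otimes y'$ that holds for all
  \<open>e\<close> may be contracted by substituting for \<open>e\<close> a linear expression in the second
  leg: expand both sides along a common basis of the second leg and compare coefficients. It is needed where
  the covering element of one leg is produced by the other leg.
\<close>

lemma tsum_contract:
  fixes \<theta> :: "'b::complex_vector \<Rightarrow> 'e::complex_vector"
  assumes \<alpha>: "\<And>e. clinear (\<lambda>x. \<alpha> x e)" "\<And>x. clinear (\<alpha> x)"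
    and \<beta>: "\<And>e. clinear (\<lambda>x. \<beta> x e)" "\<And>x. clinear (\<beta> x)" and \<theta>: "clinear \<theta>"
    and eq: "\<And>e. tensor_map (\<lambda>x. \<alpha> x e) (\<lambda>x. x) z = tensor_map (\<lambda>x. \<beta> x e) (\<lambda>x. x) w"
  shows "tsum z (\<lambda>x y. \<alpha> x (\<theta> y)) = tsum w (\<lambda>x y. \<beta> x (\<theta> y))"
proof -
  obtain r :: "'b \<Rightarrow> 'b \<Rightarrow> complex" where r: "\<And>b. clinear (r b)" "\<And>v. finite {b. r b v \<noteq> 0}"
    "\<And>v. v = (\<Sum>b | r b v \<noteq> 0. r b v *\<^sub>c b)"
    by (rule coordinate_functionals) blast
  obtain F where F: "finite F" "\<And>G. finite G \<Longrightarrow> F \<subseteq> G \<Longrightarrow> z = (\<Sum>b\<in>G. slice_right (r b) z \<otimes> b)"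
    using tensor_expansion[OF r] by blast
  obtain F' where F': "finite F'" "\<And>G. finite G \<Longrightarrow> F' \<subseteq> G \<Longrightarrow> w = (\<Sum>b\<in>G. slice_right (r b) w \<otimes> b)"
    using tensor_expansion[OF r] by blast
  have z: "z = (\<Sum>b\<in>F \<union> F'. slice_right (r b) z \<otimes> b)" and w: "w = (\<Sum>b\<in>F \<union> F'. slice_right (r b) w \<otimes> b)"
    using F F' by simp_all
  have coeff: "\<alpha> (slice_right (r b) z) e = \<beta> (slice_right (r b) w) e" for b e
    using arg_cong[OF eq[of e], of "slice_right (r b)"]
    by (simp add: slice_right_tmap \<alpha> \<beta> r lin)
  have ca: "clinear (\<lambda>z. tsum z (\<lambda>x y. \<alpha> x (\<theta> y)))" and cb: "clinear (\<lambda>z. tsum z (\<lambda>x y. \<beta> x (\<theta> y)))"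
    using \<theta> \<alpha> \<beta> by (auto intro!: lin intro: clinear_compose)
  have pa: "tsum (x \<otimes> y) (\<lambda>x y. \<alpha> x (\<theta> y)) = \<alpha> x (\<theta> y)" for x y
    by (rule tsum_pure) (use \<theta> \<alpha> in \<open>auto simp: cbilinear_iff intro: clinear_compose\<close>)
  have pb: "tsum (x \<otimes> y) (\<lambda>x y. \<beta> x (\<theta> y)) = \<beta> x (\<theta> y)" for x y
    by (rule tsum_pure) (use \<theta> \<beta> in \<open>auto simp: cbilinear_iff intro: clinear_compose\<close>)
  show ?thesis
    by (subst z, subst w) (simp add: clinear_sum[OF ca] clinear_sum[OF cb] pa pb coeff)
qed

text \<open>
  Applied to an identity between sums of $a \otimes (b \otimes c)$, the map \<open>K\<close> turns it into
  the same identity for an arbitrary trilinear expression.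
\<close>

lemma trilinear_lift:
  fixes H :: "'a::complex_vector \<Rightarrow> 'b::complex_vector \<Rightarrow> 'c::complex_vector \<Rightarrow> 'd::complex_vector"
  assumes "\<And>b c. clinear (\<lambda>a. H a b c)" "\<And>a c. clinear (\<lambda>b. H a b c)" "\<And>a b. clinear (\<lambda>c. H a b c)"
  obtains K where "clinear K" "\<And>a b c. K (a \<otimes> (b \<otimes> c)) = H a b c"
proof
  show "clinear (\<lambda>z. tsum z (\<lambda>a w. tsum w (\<lambda>b c. H a b c)))"
    by (intro lin assms)
  show "tsum (a \<otimes> (b \<otimes> c)) (\<lambda>a w. tsum w (\<lambda>b c. H a b c)) = H a b c" for a b c
    by (subst tsum_pure; simp add: lin assms tsum_pure)
qed

text \<open>
  Choose a basis of the span of the family among its vectors and extend linearly. The other vectors of the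
  family are related to the basis, so the hypothesis on relations yields the values there.
\<close>

lemma linear_functional_prescribed:
  fixes v :: "'i \<Rightarrow> 'a::complex_vector" and \<gamma> :: "'i \<Rightarrow> complex"
  assumes rel: "\<And>F c. finite F \<Longrightarrow> F \<subseteq> X \<Longrightarrow> (\<Sum>i\<in>F. c i *\<^sub>c v i) = 0 \<Longrightarrow> (\<Sum>i\<in>F. c i * \<gamma> i) = 0"
  shows "\<exists>\<phi>. clinear \<phi> \<and> (\<forall>i\<in>X. \<phi> (v i) = \<gamma> i)"
proof -
  obtain B where B: "B \<subseteq> v ` X" "cvec.independent B" "v ` X \<subseteq> cvec.span B"
    by (rule cvec.maximal_independent_subset)
  define f where "f = inv_into X v"
  have f: "f b \<in> X" "v (f b) = b" if "b \<in> B" for b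
    using B(1) that by (auto simp: f_def inv_into_into f_inv_into_f)
  obtain \<phi> where \<phi>: "clinear \<phi>" "\<And>b. b \<in> B \<Longrightarrow> \<phi> b = \<gamma> (f b)"
    using vector_space_pair.linear_independent_extend[OF vector_space_pair.intro[OF
      cvec.vector_space_axioms cvec.vector_space_axioms] B(2), of "\<lambda>b. \<gamma> (f b)"] by blast
  have "\<phi> (v i) = \<gamma> i" if i: "i \<in> X" for i
  proof -
    have "v i \<in> cvec.span B" using B(3) i by auto
    then obtain t u where t: "finite t" "t \<subseteq> B" "v i = (\<Sum>b\<in>t. u b *\<^sub>c b)"
      unfolding cvec.span_explicit by blast
    define F where "F = insert i (f ` t)"
    define c where "c j = (if j \<in> f ` t then u (v j) else 0) - (if j = i then 1 else 0)" for j
    have inj: "inj_on f t" by (rule inj_on_inverseI[of _ v]) (use f t in auto)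
    have F: "finite F" "F \<subseteq> X" using t f i by (auto simp: F_def)
    have split: "(\<Sum>j\<in>F. c j *\<^sub>c w j) = (\<Sum>b\<in>t. u b *\<^sub>c w (f b)) - w i" for w :: "'i \<Rightarrow> 'e::complex_vector"
    proof -
      have "(\<Sum>j\<in>F. (if j \<in> f ` t then u (v j) else 0) *\<^sub>c w j) = (\<Sum>j\<in>f ` t. u (v j) *\<^sub>c w j)"
        using F(1) by (intro sum.mono_neutral_cong_right) (auto simp: F_def)
      also have "\<dots> = (\<Sum>b\<in>t. u b *\<^sub>c w (f b))"
        using f t by (subst sum.reindex[OF inj]) (auto intro!: sum.cong)
      finally have a: "(\<Sum>j\<in>F. (if j \<in> f ` t then u (v j) else 0) *\<^sub>c w j) = (\<Sum>b\<in>t. u b *\<^sub>c w (f b))" .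
      have "(\<Sum>j\<in>F. (if j = i then 1 else 0) *\<^sub>c w j) = (\<Sum>j\<in>{i}. w j)"
        using F(1) by (intro sum.mono_neutral_cong_right) (auto simp: F_def)
      then show ?thesis
        by (simp add: c_def cvec.scale_left_diff_distrib sum_subtractf a)
    qed
    have "(\<Sum>j\<in>F. c j *\<^sub>c v j) = 0"
      unfolding split t(3) using f t(2) by (simp add: subset_eq)
    from rel[OF F this] have "(\<Sum>b\<in>t. u b * \<gamma> (f b)) = \<gamma> i"
      using split[of \<gamma>] by (simp add: cscale_complex)
    moreover have "\<phi> (v i) = (\<Sum>b\<in>t. u b * \<gamma> (f b))"
      unfolding t(3) clinear_sum[OF \<phi>(1)] using \<phi>(2) t(2)
      by (intro sum.cong) (auto simp: clinear_cscale[OF \<phi>(1)] cscale_complex)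
    ultimately show ?thesis by simp
  qed
  then show ?thesis using \<phi>(1) by blast
qed

lemma clinear_functional_sum: "(\<And>i. i \<in> F \<Longrightarrow> clinear (g i)) \<Longrightarrow> clinear (\<lambda>x. \<Sum>i\<in>F. g i x)"
  by (induction F rule: infinite_finite_induct) (auto intro: lin)

lemma slice_left_sum:
  assumes "\<And>i. i \<in> F \<Longrightarrow> clinear (g i)"
  shows "slice_left (\<lambda>x. \<Sum>i\<in>F. c i * g i x) z = (\<Sum>i\<in>F. c i *\<^sub>c slice_left (g i) z)"
proof -
  have *: "clinear (\<lambda>x. c i * g i x)" if "i \<in> F" for i
    using clinear_scale[of "g i" "c i"] assms that by (simp add: cscale_complex)
  show ?thesis
    by (rule tensor_map_eqI) (use assms * in \<open>auto intro!: lin clinear_functional_sum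
      simp: slice_left_pure clinear_functional_sum cvec.scale_sum_left cscale_cscale\<close>)
qed

section \<open>Weak Hopf structures in terms of maps on the tensor square\<close>

text \<open>
  The structure used in the main argument: \<open>T\<^sub>1\<close> and \<open>T\<^sub>2\<close> are the
  canonical maps, \<open>E\<^sub>l\<close> and \<open>E\<^sub>r\<close> are the left and the right
  multiplication by \<open>E\<close>, and \<open>S\<close> is a bijective antipode on \<open>A\<close>. The
  product is a parameter rather than the one of the type class, so that the opposite product on the same
  type is again an instance. All identities are covered: they are multiplied by elements of \<open>A\<close>
  so that every leg lies in \<open>A\<close>.

  \<^item> \<open>T1_T2\<close>: both sides are $(c \otimes 1)\Delta(a)(1 \otimes b)$.
  \<^item> \<open>E_compat\<close>: both sides are $(c \otimes d)E(a \otimes b)$.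
  \<^item> \<open>T1_mul\<close>, \<open>T2_mul\<close>: if $E(a \otimes b) = \sum \Delta(x)(1 \otimes y)$,
    then $\Delta(u)(a \otimes b) = \sum \Delta(ux)(1 \otimes y)$, as $\Delta(u)E = \Delta(u)$ and $\Delta$
    is multiplicative; and the same on the other side.
  \<^item> \<open>G_left\<close>, \<open>G_right\<close>: the elements $\sum a_{(1)} \otimes
    S(a_{(2)})a_{(3)}b$ and $\sum ab_{(1)}S(b_{(2)}) \otimes b_{(3)}$ belong to $A \otimes A$.
  \<^item> \<open>El_comm\<close>, \<open>Er_comm\<close>: $E \otimes 1$ and $1 \otimes E$ commute, for the
    left and the right multiplication.
\<close>

locale weak_hopf_core =
  fixes mul :: "'a::complex_vector \<Rightarrow> 'a \<Rightarrow> 'a"  (infixl "\<cdot>" 80)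
    and T\<^sub>1 T\<^sub>2 E\<^sub>l E\<^sub>r :: "('a, 'a) tensor \<Rightarrow> ('a, 'a) tensor"
    and S :: "'a \<Rightarrow> 'a"
  assumes mul_bilinear: "cbilinear (\<cdot>)"
    and mul_assoc: "a \<cdot> b \<cdot> c = a \<cdot> (b \<cdot> c)"
    and nondeg_left: "(\<And>b. b \<cdot> a = 0) \<Longrightarrow> a = 0"
    and nondeg_right: "(\<And>b. a \<cdot> b = 0) \<Longrightarrow> a = 0"
    and idempotent: "cvec.span {a \<cdot> b | a b. True} = UNIV"
    and linear_maps: "clinear T\<^sub>1" "clinear T\<^sub>2" "clinear E\<^sub>l" "clinear E\<^sub>r" "clinear S"
    and S_bij: "bij S"
    and S_mul: "S (a \<cdot> b) = S b \<cdot> S a"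
    and T1_T2: "tensor_map (\<lambda>x. c \<cdot> x) (\<lambda>x. x) (T\<^sub>1 (a \<otimes> b)) = tensor_map (\<lambda>x. x) (\<lambda>x. x \<cdot> b) (T\<^sub>2 (c \<otimes> a))"
    and coassoc: "tsum (T\<^sub>1 (b \<otimes> c)) (\<lambda>u v. tsum (T\<^sub>2 (a \<otimes> u)) (\<lambda>p q. p \<otimes> (q \<otimes> v))) =
      tsum (T\<^sub>2 (a \<otimes> b)) (\<lambda>p q. tsum (T\<^sub>1 (q \<otimes> c)) (\<lambda>u v. p \<otimes> (u \<otimes> v)))"
    and E_compat: "tensor_map (\<lambda>x. c \<cdot> x) (\<lambda>x. d \<cdot> x) (E\<^sub>l (a \<otimes> b)) =
      tensor_map (\<lambda>x. x \<cdot> a) (\<lambda>x. x \<cdot> b) (E\<^sub>r (c \<otimes> d))"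
    and El_idem: "E\<^sub>l (E\<^sub>l z) = E\<^sub>l z"
    and Er_idem: "E\<^sub>r (E\<^sub>r z) = E\<^sub>r z"
    and range_T1: "range T\<^sub>1 = range E\<^sub>l"
    and range_T2: "range T\<^sub>2 = range E\<^sub>r"
    and T1_mul: "T\<^sub>1 w = E\<^sub>l (a \<otimes> b) \<Longrightarrow>
      T\<^sub>1 (tensor_map (\<lambda>x. u \<cdot> x) (\<lambda>x. x) w) = tensor_map (\<lambda>x. x \<cdot> a) (\<lambda>x. x) (T\<^sub>1 (u \<otimes> b))"
    and T2_mul: "T\<^sub>2 w = E\<^sub>r (c \<otimes> d) \<Longrightarrow>
      T\<^sub>2 (tensor_map (\<lambda>x. x) (\<lambda>x. x \<cdot> u) w) = tensor_map (\<lambda>x. x) (\<lambda>x. d \<cdot> x) (T\<^sub>2 (c \<otimes> u))"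
    and E_left: "tensor_map (\<lambda>x. c \<cdot> x) (\<lambda>x. d \<cdot> x) (E\<^sub>l (a \<otimes> b)) =
      tsum (T\<^sub>2 (c \<otimes> a)) (\<lambda>u v. tsum (T\<^sub>2 (d \<otimes> v)) (\<lambda>p q. u \<otimes> (p \<cdot> (S q \<cdot> b))))"
    and E_right: "tensor_map (\<lambda>x. x \<cdot> c) (\<lambda>x. x \<cdot> d) (E\<^sub>r (a \<otimes> b)) =
      tsum (T\<^sub>1 (b \<otimes> d)) (\<lambda>u v. tsum (T\<^sub>1 (u \<otimes> c)) (\<lambda>p q. (a \<cdot> S p \<cdot> q) \<otimes> v))"
    and G_left: "\<exists>z. \<forall>c. tensor_map (\<lambda>x. c \<cdot> x) (\<lambda>x. x) z =
      tsum (T\<^sub>1 w) (\<lambda>u v. tsum (T\<^sub>2 (c \<otimes> u)) (\<lambda>p q. p \<otimes> (S q \<cdot> v)))"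
    and G_right: "\<exists>z. \<forall>c. tensor_map (\<lambda>x. x) (\<lambda>x. x \<cdot> c) z =
      tsum (T\<^sub>2 w) (\<lambda>u v. tsum (T\<^sub>1 (v \<otimes> c)) (\<lambda>p q. (u \<cdot> S p) \<otimes> q))"
    and El_comm: "tsum (E\<^sub>l (a \<otimes> b)) (\<lambda>p q. tsum (E\<^sub>l (q \<otimes> c)) (\<lambda>r s. p \<otimes> (r \<otimes> s))) =
      tsum (E\<^sub>l (b \<otimes> c)) (\<lambda>p q. tsum (E\<^sub>l (a \<otimes> p)) (\<lambda>r s. r \<otimes> (s \<otimes> q)))"
    and Er_comm: "tsum (E\<^sub>r (a \<otimes> b)) (\<lambda>p q. tsum (E\<^sub>r (q \<otimes> c)) (\<lambda>r s. p \<otimes> (r \<otimes> s))) =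
      tsum (E\<^sub>r (b \<otimes> c)) (\<lambda>p q. tsum (E\<^sub>r (a \<otimes> p)) (\<lambda>r s. r \<otimes> (s \<otimes> q)))"
begin

abbreviation l1 where "l1 c \<equiv> tensor_map (\<lambda>x. c \<cdot> x) (\<lambda>x::'a. x)"
abbreviation l2 where "l2 c \<equiv> tensor_map (\<lambda>x::'a. x) (\<lambda>x. c \<cdot> x)"
abbreviation r1 where "r1 c \<equiv> tensor_map (\<lambda>x. x \<cdot> c) (\<lambda>x::'a. x)"
abbreviation r2 where "r2 c \<equiv> tensor_map (\<lambda>x::'a. x) (\<lambda>x. x \<cdot> c)"

lemma clinear_mul_left [lin]: "clinear f \<Longrightarrow> clinear (\<lambda>x. f x \<cdot> b)"
  using mul_bilinear by (simp add: clinear_compose[of "\<lambda>x. x \<cdot> b"] cbilinear_def)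

lemma clinear_mul_right [lin]: "clinear f \<Longrightarrow> clinear (\<lambda>x. a \<cdot> f x)"
  using mul_bilinear by (simp add: clinear_compose[of "\<lambda>x. a \<cdot> x"] cbilinear_def)

lemma clinear_maps [lin]:
  "clinear f \<Longrightarrow> clinear (\<lambda>x. T\<^sub>1 (f x))" "clinear f \<Longrightarrow> clinear (\<lambda>x. T\<^sub>2 (f x))"
  "clinear f \<Longrightarrow> clinear (\<lambda>x. E\<^sub>l (f x))" "clinear f \<Longrightarrow> clinear (\<lambda>x. E\<^sub>r (f x))"
  "clinear k \<Longrightarrow> clinear (\<lambda>x. S (k x))"
  using linear_maps by (simp_all add: clinear_compose)

lemmas expand = tsum_tmap tsum_tsum tsum_pure tmap_tmap tensor_map_pure

lemma Er_preimage: obtains w where "T\<^sub>2 w = E\<^sub>r z"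
  using range_T2 by (metis rangeE rangeI)

lemma El_preimage: obtains w where "T\<^sub>1 w = E\<^sub>l z"
  using range_T1 by (metis rangeE rangeI)

lemma tmap_tsum: "clinear f \<Longrightarrow> clinear g \<Longrightarrow> tensor_map f g (tsum z h) = tsum z (\<lambda>u v. tensor_map f g (h u v))"
  by (rule linear_tsum[OF clinear_tensor_map])

lemma mul_tsum_right: "a \<cdot> tsum z h = tsum z (\<lambda>u v. a \<cdot> h u v)"
  by (rule linear_tsum) (intro lin)

lemma mul_tsum_left: "tsum z h \<cdot> a = tsum z (\<lambda>u v. h u v \<cdot> a)"
  by (rule linear_tsum[of "\<lambda>x. x \<cdot> a"]) (intro lin)

text \<open>
  The elements $d\,\varepsilon_t(v)$ and $\varepsilon_s(u)\,c$ of \<open>A\<close>.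
\<close>

definition mul_eps_t where "mul_eps_t d v = tsum (T\<^sub>2 (d \<otimes> v)) (\<lambda>p q. p \<cdot> S q)"

definition eps_s_mul where "eps_s_mul u c = tsum (T\<^sub>1 (u \<otimes> c)) (\<lambda>p q. S p \<cdot> q)"

lemma clinear_mul_eps_t [lin]:
  "clinear f \<Longrightarrow> clinear (\<lambda>x. mul_eps_t d (f x))"
  "clinear f \<Longrightarrow> clinear (\<lambda>x. mul_eps_t (f x) v)"
  by (simp_all add: mul_eps_t_def lin)

lemma clinear_eps_s_mul [lin]:
  "clinear f \<Longrightarrow> clinear (\<lambda>x. eps_s_mul d (f x))"
  "clinear f \<Longrightarrow> clinear (\<lambda>x. eps_s_mul (f x) v)"
  by (simp_all add: eps_s_mul_def lin)

lemma E_left_eps_t: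
  "tensor_map (\<lambda>x. c \<cdot> x) (\<lambda>x. d \<cdot> x) (E\<^sub>l (a \<otimes> b)) =
    tsum (T\<^sub>2 (c \<otimes> a)) (\<lambda>u v. u \<otimes> mul_eps_t d v \<cdot> b)"
  by (simp add: E_left mul_eps_t_def mul_tsum_left pure_tsum_right mul_assoc)

lemma E_right_eps_s:
  "tensor_map (\<lambda>x. x \<cdot> c) (\<lambda>x. x \<cdot> d) (E\<^sub>r (a \<otimes> b)) =
    tsum (T\<^sub>1 (b \<otimes> d)) (\<lambda>u v. a \<cdot> eps_s_mul u c \<otimes> v)"
  by (simp add: E_right eps_s_mul_def mul_tsum_right pure_tsum_left mul_assoc)

lemma l1_cancel:
  assumes "\<And>c. l1 c z = l1 c w"
  shows "z = w"
  by (rule tmap_left_cancel[of "\<lambda>c x. c \<cdot> x"], intro lin, erule nondeg_left, rule assms)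

lemma r1_cancel:
  assumes "\<And>c. r1 c z = r1 c w"
  shows "z = w"
  by (rule tmap_left_cancel[of "\<lambda>c x. x \<cdot> c"], intro lin, erule nondeg_right, rule assms)

lemma l2_cancel:
  assumes "\<And>c. l2 c z = l2 c w"
  shows "z = w"
  by (rule tmap_right_cancel[of "\<lambda>c x. c \<cdot> x"], intro lin, erule nondeg_left, rule assms)

lemma r2_cancel:
  assumes "\<And>c. r2 c z = r2 c w"
  shows "z = w"
  by (rule tmap_right_cancel[of "\<lambda>c x. x \<cdot> c"], intro lin, erule nondeg_right, rule assms)

lemma tmap_zero: "clinear f \<Longrightarrow> clinear g \<Longrightarrow> tensor_map f g 0 = 0"
  by (rule clinear_zero[OF clinear_tensor_map])

lemma l1_cancel_zero: "(\<And>c. l1 c z = 0) \<Longrightarrow> z = 0"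
  by (rule l1_cancel) (simp add: tmap_zero lin)

lemma l2_cancel_zero: "(\<And>c. l2 c z = 0) \<Longrightarrow> z = 0"
  by (rule l2_cancel) (simp add: tmap_zero lin)

lemma r2_cancel_zero: "(\<And>c. r2 c z = 0) \<Longrightarrow> z = 0"
  by (rule r2_cancel) (simp add: tmap_zero lin)

lemma coassoc_sum:
  assumes H: "\<And>b c. clinear (\<lambda>a. H a b c)" "\<And>a c. clinear (\<lambda>b. H a b c)" "\<And>a b. clinear (\<lambda>c. H a b c)"
  shows "tsum (T\<^sub>1 (b \<otimes> c)) (\<lambda>u v. tsum (T\<^sub>2 (a \<otimes> u)) (\<lambda>p q. H p q v)) =
      tsum (T\<^sub>2 (a \<otimes> b)) (\<lambda>p q. tsum (T\<^sub>1 (q \<otimes> c)) (\<lambda>u v. H p u v))"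
proof -
  obtain K where K: "clinear K" "\<And>a b c. K (a \<otimes> (b \<otimes> c)) = H a b c"
    using trilinear_lift[OF H] by blast
  show ?thesis
    using arg_cong[OF coassoc[where a=a and b=b and c=c], of K] by (simp add: linear_tsum[OF K(1)] K(2))
qed

lemma T2_mul_tsum:
  assumes "T\<^sub>2 w = E\<^sub>r (c \<otimes> d)"
  shows "l2 d (T\<^sub>2 (c \<otimes> u)) = tsum w (\<lambda>x y. T\<^sub>2 (x \<otimes> y \<cdot> u))"
  unfolding T2_mul[OF assms, symmetric]
  by (subst linear_eq_tsum[of "\<lambda>w. T\<^sub>2 (r2 u w)"]) (simp_all add: lin expand)

text \<open>
  Coassociativity covered on the left only: $(c \otimes d \otimes 1)(\Delta \otimes id)\Delta(a) = (c
  \otimes d \otimes 1)(id \otimes \Delta)\Delta(a)$. On the left-hand side $(c \otimes d)\Delta(u) = (c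
  \otimes d)E\Delta(u) = \sum (x \otimes 1)\Delta(yu)$ for $(c \otimes d)E = \sum (x \otimes 1)\Delta(y)$.
  Covering the third leg on the right as well reduces it to \<open>coassoc\<close>.
\<close>

lemma T2_coassoc:
  assumes w: "T\<^sub>2 w = E\<^sub>r (c \<otimes> d)"
  shows "tsum w (\<lambda>x y. tsum (T\<^sub>2 (y \<otimes> a)) (\<lambda>u v. tsum (T\<^sub>2 (x \<otimes> u)) (\<lambda>p q. p \<otimes> (q \<otimes> v)))) =
    tsum (T\<^sub>2 (c \<otimes> a)) (\<lambda>p q. p \<otimes> T\<^sub>2 (d \<otimes> q))" (is "?L = ?R")
proof (rule tmap_right_cancel[of r2])
  fix e
  have "tensor_map (\<lambda>x. x) (r2 e) ?L =
      tsum w (\<lambda>x y. tsum (r2 e (T\<^sub>2 (y \<otimes> a))) (\<lambda>u v. tsum (T\<^sub>2 (x \<otimes> u)) (\<lambda>p q. p \<otimes> (q \<otimes> v))))"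
    by (simp add: tmap_tsum expand lin)
  also have "\<dots> = tsum w (\<lambda>x y. tsum (T\<^sub>1 (a \<otimes> e)) (\<lambda>u v. tsum (T\<^sub>2 (x \<otimes> (y \<cdot> u))) (\<lambda>p q. p \<otimes> (q \<otimes> v))))"
    by (simp add: T1_T2[symmetric] expand lin)
  also have "\<dots> = tsum (T\<^sub>1 (a \<otimes> e)) (\<lambda>u v. tsum w (\<lambda>x y. tsum (T\<^sub>2 (x \<otimes> (y \<cdot> u))) (\<lambda>p q. p \<otimes> (q \<otimes> v))))"
    by (rule tsum_commute)
  also have "\<dots> = tsum (T\<^sub>1 (a \<otimes> e)) (\<lambda>u v. tsum (T\<^sub>2 (c \<otimes> u)) (\<lambda>p q. p \<otimes> (d \<cdot> q \<otimes> v)))"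
    by (simp add: tsum_tsum[symmetric] T2_mul_tsum[OF w, symmetric] lin) (simp add: expand lin)
  also have "\<dots> = tsum (T\<^sub>2 (c \<otimes> a)) (\<lambda>p q. tsum (T\<^sub>1 (q \<otimes> e)) (\<lambda>u v. p \<otimes> (d \<cdot> u \<otimes> v)))"
    by (rule coassoc_sum) (intro lin)+
  also have "\<dots> = tsum (T\<^sub>2 (c \<otimes> a)) (\<lambda>p q. p \<otimes> l1 d (T\<^sub>1 (q \<otimes> e)))"
    by (simp add: tensor_map_def pure_tsum_right lin)
  also have "\<dots> = tensor_map (\<lambda>x. x) (r2 e) ?R"
    by (simp add: T1_T2 tmap_tsum expand lin)
  finally show "tensor_map (\<lambda>x. x) (r2 e) ?L = tensor_map (\<lambda>x. x) (r2 e) ?R" .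
qed (simp add: lin, erule r2_cancel_zero)

lemma l12_cancel_zero:
  assumes "\<And>c d. tensor_map (\<lambda>x. c \<cdot> x) (\<lambda>x. d \<cdot> x) z = 0"
  shows "z = 0"
proof (rule l1_cancel_zero, rule l2_cancel_zero)
  fix c d
  show "l2 d (l1 c z) = 0" using assms[of c d] by (simp add: expand lin)
qed

lemma l12_cancel:
  assumes "\<And>c d. tensor_map (\<lambda>x. c \<cdot> x) (\<lambda>x. d \<cdot> x) z = tensor_map (\<lambda>x. c \<cdot> x) (\<lambda>x. d \<cdot> x) w"
  shows "z = w"
proof (rule l1_cancel, rule l2_cancel)
  fix c d
  show "l2 d (l1 c z) = l2 d (l1 c w)" using assms[of c d] by (simp add: expand lin)
qed

lemma right_l12_cancel:
  assumes "\<And>c d. tensor_map (\<lambda>x. x) (tensor_map (\<lambda>x. c \<cdot> x) (\<lambda>x. d \<cdot> x)) z =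
    tensor_map (\<lambda>x. x) (tensor_map (\<lambda>x. c \<cdot> x) (\<lambda>x. d \<cdot> x)) w"
  shows "z = w"
  by (rule tmap_right_cancel[of "\<lambda>cd. tensor_map (\<lambda>x. fst cd \<cdot> x) (\<lambda>x. snd cd \<cdot> x)"], intro lin,
      rule l12_cancel_zero, use fst_conv snd_conv in metis, rule assms)

lemma T2_coassoc_sum:
  assumes w: "T\<^sub>2 w = E\<^sub>r (c \<otimes> d)"
    and H: "\<And>b c. clinear (\<lambda>a. H a b c)" "\<And>a c. clinear (\<lambda>b. H a b c)" "\<And>a b. clinear (\<lambda>c. H a b c)"
  shows "tsum w (\<lambda>x y. tsum (T\<^sub>2 (y \<otimes> a)) (\<lambda>u v. tsum (T\<^sub>2 (x \<otimes> u)) (\<lambda>p q. H p q v))) =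
    tsum (T\<^sub>2 (c \<otimes> a)) (\<lambda>p q. tsum (T\<^sub>2 (d \<otimes> q)) (\<lambda>u v. H p u v))"
proof -
  obtain K where K: "clinear K" "\<And>a b c. K (a \<otimes> (b \<otimes> c)) = H a b c"
    using trilinear_lift[OF H] by blast
  have "K (p \<otimes> z) = tsum z (\<lambda>u v. H p u v)" for p z
    using linear_eq_tsum[of "\<lambda>z. K (p \<otimes> z)" z] K by (simp add: clinear_compose[OF K(1)] lin)
  moreover have "cbilinear (H p)" for p using H by (simp add: cbilinear_iff)
  ultimately show ?thesis
    using arg_cong[OF T2_coassoc[OF w, of a], of K] by (simp add: linear_tsum[OF K(1)] tsum_pure)
qed

text \<open>
  This is $(\Delta \otimes id)(E) = (1 \otimes E)(E \otimes 1)$ in the form $(\Delta \otimes id)(E(a \otimes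
  b)) = (1 \otimes E)(\Delta(a) \otimes b)$. It follows from $E(a \otimes b) = \sum a_{(1)} \otimes
  \varepsilon_t(a_{(2)})b$ and coassociativity.
\<close>

lemma Delta_id_El:
  "tsum (E\<^sub>l (a \<otimes> b)) (\<lambda>u v. tsum (T\<^sub>2 (c \<otimes> u)) (\<lambda>p q. p \<otimes> (q \<otimes> v))) =
    tsum (T\<^sub>2 (c \<otimes> a)) (\<lambda>p q. p \<otimes> E\<^sub>l (q \<otimes> b))" (is "?L = ?R")
proof (rule right_l12_cancel)
  fix d e
  obtain w where w: "T\<^sub>2 w = E\<^sub>r (c \<otimes> d)" by (rule Er_preimage)
  let ?D = "tensor_map (\<lambda>x::'a. x) (tensor_map (\<lambda>x. d \<cdot> x) (\<lambda>x. e \<cdot> x))"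
  have "?D ?L = tsum (E\<^sub>l (a \<otimes> b)) (\<lambda>u v. tsum (l2 d (T\<^sub>2 (c \<otimes> u))) (\<lambda>p q. p \<otimes> (q \<otimes> e \<cdot> v)))"
    by (simp add: tmap_tsum expand lin)
  also have "\<dots> = tsum (E\<^sub>l (a \<otimes> b)) (\<lambda>u v. tsum w (\<lambda>x y. tsum (T\<^sub>2 (x \<otimes> (y \<cdot> u))) (\<lambda>p q. p \<otimes> (q \<otimes> e \<cdot> v))))"
    by (simp add: T2_mul_tsum[OF w] expand lin)
  also have "\<dots> = tsum w (\<lambda>x y. tsum (E\<^sub>l (a \<otimes> b)) (\<lambda>u v. tsum (T\<^sub>2 (x \<otimes> (y \<cdot> u))) (\<lambda>p q. p \<otimes> (q \<otimes> e \<cdot> v))))"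
    by (rule tsum_commute)
  also have "\<dots> = tsum w (\<lambda>x y. tsum (tensor_map (\<lambda>x. y \<cdot> x) (\<lambda>x. e \<cdot> x) (E\<^sub>l (a \<otimes> b)))
      (\<lambda>u v. tsum (T\<^sub>2 (x \<otimes> u)) (\<lambda>p q. p \<otimes> (q \<otimes> v))))"
    by (simp add: expand lin)
  also have "\<dots> = tsum w (\<lambda>x y. tsum (T\<^sub>2 (y \<otimes> a)) (\<lambda>u v. tsum (T\<^sub>2 (x \<otimes> u))
      (\<lambda>p q. p \<otimes> (q \<otimes> mul_eps_t e v \<cdot> b))))"
    by (simp add: E_left_eps_t expand lin)
  also have "\<dots> = tsum (T\<^sub>2 (c \<otimes> a)) (\<lambda>p q. tsum (T\<^sub>2 (d \<otimes> q))
      (\<lambda>u v. p \<otimes> (u \<otimes> mul_eps_t e v \<cdot> b)))"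
    by (rule T2_coassoc_sum[OF w]) (intro lin)+
  also have "\<dots> = ?D ?R"
    by (simp add: tmap_tsum expand lin E_left_eps_t pure_tsum_right)
  finally show "?D ?L = ?D ?R" .
qed

lemma Delta_id_El_sum:
  assumes H: "\<And>b c. clinear (\<lambda>a. H a b c)" "\<And>a c. clinear (\<lambda>b. H a b c)" "\<And>a b. clinear (\<lambda>c. H a b c)"
  shows "tsum (E\<^sub>l (a \<otimes> b)) (\<lambda>u v. tsum (T\<^sub>2 (c \<otimes> u)) (\<lambda>p q. H p q v)) =
    tsum (T\<^sub>2 (c \<otimes> a)) (\<lambda>p q. tsum (E\<^sub>l (q \<otimes> b)) (\<lambda>u v. H p u v))"
proof -
  obtain K where K: "clinear K" "\<And>a b c. K (a \<otimes> (b \<otimes> c)) = H a b c"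
    using trilinear_lift[OF H] by blast
  have "K (p \<otimes> z) = tsum z (\<lambda>u v. H p u v)" for p z
    using linear_eq_tsum[of "\<lambda>z. K (p \<otimes> z)" z] K by (simp add: clinear_compose[OF K(1)] lin)
  moreover have "cbilinear (H p)" for p using H by (simp add: cbilinear_iff)
  ultimately show ?thesis
    using arg_cong[OF Delta_id_El[where a=a and b=b and c=c], of K]
    by (simp add: linear_tsum[OF K(1)] tsum_pure)
qed

lemma mul_diff_left: "(a - b) \<cdot> c = a \<cdot> c - b \<cdot> c"
  by (rule clinear_minus_eq[of "\<lambda>x. x \<cdot> c"]) (intro lin)

lemma mul_diff_right: "a \<cdot> (b - c) = a \<cdot> b - a \<cdot> c"
  by (rule clinear_minus_eq[of "\<lambda>x. a \<cdot> x"]) (intro lin)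

lemma E_comm_sum:
  assumes H: "\<And>b c. clinear (\<lambda>a. H a b c)" "\<And>a c. clinear (\<lambda>b. H a b c)" "\<And>a b. clinear (\<lambda>c. H a b c)"
  shows "tsum (E\<^sub>l (a \<otimes> b)) (\<lambda>p q. tsum (E\<^sub>l (q \<otimes> c)) (\<lambda>r s. H p r s)) =
      tsum (E\<^sub>l (b \<otimes> c)) (\<lambda>p q. tsum (E\<^sub>l (a \<otimes> p)) (\<lambda>r s. H r s q))"
    and "tsum (E\<^sub>r (a \<otimes> b)) (\<lambda>p q. tsum (E\<^sub>r (q \<otimes> c)) (\<lambda>r s. H p r s)) =
      tsum (E\<^sub>r (b \<otimes> c)) (\<lambda>p q. tsum (E\<^sub>r (a \<otimes> p)) (\<lambda>r s. H r s q))"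
proof -
  obtain K where K: "clinear K" "\<And>a b c. K (a \<otimes> (b \<otimes> c)) = H a b c"
    using trilinear_lift[OF H] by blast
  show "tsum (E\<^sub>l (a \<otimes> b)) (\<lambda>p q. tsum (E\<^sub>l (q \<otimes> c)) (\<lambda>r s. H p r s)) =
      tsum (E\<^sub>l (b \<otimes> c)) (\<lambda>p q. tsum (E\<^sub>l (a \<otimes> p)) (\<lambda>r s. H r s q))"
    using arg_cong[OF El_comm[where a=a and b=b and c=c], of K] by (simp add: linear_tsum[OF K(1)] K(2))
  show "tsum (E\<^sub>r (a \<otimes> b)) (\<lambda>p q. tsum (E\<^sub>r (q \<otimes> c)) (\<lambda>r s. H p r s)) =
      tsum (E\<^sub>r (b \<otimes> c)) (\<lambda>p q. tsum (E\<^sub>r (a \<otimes> p)) (\<lambda>r s. H r s q))"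
    using arg_cong[OF Er_comm[where a=a and b=b and c=c], of K] by (simp add: linear_tsum[OF K(1)] K(2))
qed

lemma linear_inv_S: "clinear (inv S)"
proof (rule clinearI)
  have i: "S (inv S x) = x" "inv S (S x) = x" for x
    using S_bij by (simp_all add: bij_is_inj bij_is_surj surj_f_inv_f)
  fix x y c
  show "inv S (x + y) = inv S x + inv S y"
    using clinear_add[OF linear_maps(5), of "inv S x" "inv S y"] by (metis i)
  show "inv S (c *\<^sub>c x) = c *\<^sub>c inv S x"
    using clinear_cscale[OF linear_maps(5), of c "inv S x"] by (metis i)
qed

lemma inv_S [simp]: "inv S (S x) = x" "S (inv S x) = x"
  using S_bij by (simp_all add: bij_is_inj bij_is_surj surj_f_inv_f)

lemma clinear_inv_S [lin]: "clinear f \<Longrightarrow> clinear (\<lambda>x. inv S (f x))"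
  by (rule clinear_compose[OF linear_inv_S])

lemma Er_times_right_leg: "E\<^sub>r (a \<otimes> e \<cdot> p) = l2 e (E\<^sub>r (a \<otimes> p))"
proof (rule r1_cancel, rule r2_cancel)
  fix x y
  show "r2 y (r1 x (E\<^sub>r (a \<otimes> e \<cdot> p))) = r2 y (r1 x (l2 e (E\<^sub>r (a \<otimes> p))))"
    using E_compat[of a "e \<cdot> p" x y] E_compat[of a p x y, THEN arg_cong, of "l2 e"]
    by (simp add: expand lin mul_assoc)
qed

end

section \<open>Coverings of the coproduct by the first and the second leg\<close>

text \<open>
  The assumption is $\sum S(a_{(1)})a_{(2)}S(a_{(3)})b = S(a)b$, which singles out one side.
\<close>

locale weak_hopf_core_antipode = weak_hopf_core +
  assumes antipode_left: "tsum (E\<^sub>l (a \<otimes> b)) (\<lambda>u v. S u \<cdot> v) = S a \<cdot> b"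
begin

text \<open>
  The element $\sum a_{(1)} \otimes S(a_{(2)})b$. It belongs to $A \otimes A$ for the following reason. The
  map $a \otimes b \mapsto \sum a_{(1)} \otimes S(a_{(2)})b$ sends the range of $T_1$ into $A \otimes A$ by
  \<open>G_left\<close>, and it takes the same value on $a \otimes b$ and on $E(a \otimes b)$, which lies in
  that range, because $S$ absorbs \<open>E\<close>.
\<close>

lemma T1_inverse_exists: "\<exists>z. \<forall>c. l1 c z = tsum (T\<^sub>2 (c \<otimes> a)) (\<lambda>p q. p \<otimes> S q \<cdot> b)"
proof -
  obtain w where w: "T\<^sub>1 w = E\<^sub>l (a \<otimes> b)" by (rule El_preimage)
  obtain z where z: "\<And>c. l1 c z = tsum (T\<^sub>1 w) (\<lambda>u v. tsum (T\<^sub>2 (c \<otimes> u)) (\<lambda>p q. p \<otimes> S q \<cdot> v))"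
    using G_left by blast
  have "l1 c z = tsum (T\<^sub>2 (c \<otimes> a)) (\<lambda>p q. p \<otimes> S q \<cdot> b)" for c
  proof -
    have "l1 c z = tsum (T\<^sub>2 (c \<otimes> a)) (\<lambda>p q. tsum (E\<^sub>l (q \<otimes> b)) (\<lambda>u v. p \<otimes> S u \<cdot> v))"
      unfolding z w by (rule Delta_id_El_sum) (intro lin)+
    then show ?thesis by (simp add: pure_tsum_right[symmetric] antipode_left)
  qed
  then show ?thesis by blast
qed

definition T1_inverse where "T1_inverse a b = (SOME z. \<forall>c. l1 c z = tsum (T\<^sub>2 (c \<otimes> a)) (\<lambda>p q. p \<otimes> S q \<cdot> b))"

lemma l1_T1_inverse: "l1 c (T1_inverse a b) = tsum (T\<^sub>2 (c \<otimes> a)) (\<lambda>p q. p \<otimes> S q \<cdot> b)"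
  unfolding T1_inverse_def using someI_ex[OF T1_inverse_exists] by blast

text \<open>
  So $T_1$ composed with this map is the left multiplication by \<open>E\<close>, the projection onto the
  range of $T_1$; hence the name.
\<close>

lemma T1_T1_inverse: "T\<^sub>1 (T1_inverse a b) = E\<^sub>l (a \<otimes> b)"
proof (rule l12_cancel)
  fix c d
  obtain w where w: "T\<^sub>2 w = E\<^sub>r (c \<otimes> d)" by (rule Er_preimage)
  let ?D = "tensor_map (\<lambda>x. c \<cdot> x) (\<lambda>x. d \<cdot> x)"
  have pure: "?D (T\<^sub>1 (r \<otimes> s)) = tsum w (\<lambda>x y. l1 x (T\<^sub>1 (y \<cdot> r \<otimes> s)))" for r s
  proof -
    have "?D (T\<^sub>1 (r \<otimes> s)) = l2 d (l1 c (T\<^sub>1 (r \<otimes> s)))" by (simp add: expand lin)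
    also have "\<dots> = r2 s (l2 d (T\<^sub>2 (c \<otimes> r)))" by (simp add: T1_T2 expand lin mul_assoc)
    also have "\<dots> = tsum w (\<lambda>x y. l1 x (T\<^sub>1 (y \<cdot> r \<otimes> s)))"
      by (simp add: T2_mul_tsum[OF w] tmap_tsum T1_T2 lin)
    finally show ?thesis .
  qed
  have "?D (T\<^sub>1 z) = tsum w (\<lambda>x y. l1 x (T\<^sub>1 (l1 y z)))" for z
    by (rule tensor_map_eqI[where f="\<lambda>z. ?D (T\<^sub>1 z)"]) (simp_all add: pure expand lin)
  from this[of "T1_inverse a b"]
  have "?D (T\<^sub>1 (T1_inverse a b)) = tsum w (\<lambda>x y. tsum (T\<^sub>2 (y \<otimes> a)) (\<lambda>u v. l1 x (T\<^sub>1 (u \<otimes> S v \<cdot> b))))"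
    by (simp add: l1_T1_inverse linear_tsum[of "\<lambda>z. l1 _ (T\<^sub>1 z)"] lin)
  also have "\<dots> = tsum w (\<lambda>x y. tsum (T\<^sub>2 (y \<otimes> a)) (\<lambda>u v. tsum (T\<^sub>2 (x \<otimes> u)) (\<lambda>p q. p \<otimes> q \<cdot> (S v \<cdot> b))))"
    by (simp add: T1_T2) (simp add: tensor_map_def)
  also have "\<dots> = tsum (T\<^sub>2 (c \<otimes> a)) (\<lambda>p q. tsum (T\<^sub>2 (d \<otimes> q)) (\<lambda>u v. p \<otimes> u \<cdot> (S v \<cdot> b)))"
    by (rule T2_coassoc_sum[OF w]) (intro lin)+
  finally show "?D (T\<^sub>1 (T1_inverse a b)) = ?D (E\<^sub>l (a \<otimes> b))" by (simp add: E_left)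
qed

text \<open>
  The element $(1 \otimes b)\Delta(a)$: apply $S^{-1}$ to the second leg of $\sum a_{(1)} \otimes
  S(a_{(2)})S(b)$.
\<close>

definition left_cover where "left_cover b a = tensor_map (\<lambda>x. x) (inv S) (T1_inverse a (S b))"

lemma l1_left_cover: "l1 c (left_cover b a) = l2 b (T\<^sub>2 (c \<otimes> a))"
proof -
  have "l1 c (left_cover b a) = tensor_map (\<lambda>x. x) (inv S) (l1 c (T1_inverse a (S b)))"
    by (simp add: left_cover_def expand lin)
  also have "\<dots> = tsum (T\<^sub>2 (c \<otimes> a)) (\<lambda>p q. p \<otimes> inv S (S (b \<cdot> q)))"
    by (simp add: l1_T1_inverse S_mul tmap_tsum expand lin)
  finally show ?thesis by (simp add: tensor_map_def)
qed

lemma r2_left_cover: "r2 c (left_cover b a) = l2 b (T\<^sub>1 (a \<otimes> c))"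
proof (rule l1_cancel)
  fix d
  have "l1 d (r2 c (left_cover b a)) = r2 c (l1 d (left_cover b a))" by (simp add: expand lin)
  also have "\<dots> = l2 b (r2 c (T\<^sub>2 (d \<otimes> a)))" by (simp add: l1_left_cover expand lin mul_assoc)
  also have "\<dots> = l1 d (l2 b (T\<^sub>1 (a \<otimes> c)))" by (simp add: T1_T2[symmetric] expand lin)
  finally show "l1 d (r2 c (left_cover b a)) = l1 d (l2 b (T\<^sub>1 (a \<otimes> c)))" .
qed

lemma T1_inverse_left_cover: "tensor_map (\<lambda>x. x) (\<lambda>y. S y \<cdot> d) (left_cover c b) = T1_inverse b (S c \<cdot> d)"
proof (rule l1_cancel)
  fix e
  have "l1 e (tensor_map (\<lambda>x. x) (\<lambda>y. S y \<cdot> d) (left_cover c b)) =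
      tensor_map (\<lambda>x. x) (\<lambda>y. S y \<cdot> d) (l1 e (left_cover c b))" by (simp add: expand lin)
  then show "l1 e (tensor_map (\<lambda>x. x) (\<lambda>y. S y \<cdot> d) (left_cover c b)) = l1 e (T1_inverse b (S c \<cdot> d))"
    by (simp add: l1_left_cover l1_T1_inverse tmap_tmap lin S_mul mul_assoc) (simp add: tensor_map_def)
qed

lemma tsum_eps_s_mul: "tsum (T\<^sub>1 z) (\<lambda>p q. S p \<cdot> q) = tsum z (\<lambda>x y. eps_s_mul x y)"
  unfolding eps_s_mul_def by (rule linear_eq_tsum[of "\<lambda>z. tsum (T\<^sub>1 z) (\<lambda>p q. S p \<cdot> q)"]) (intro lin)

text \<open>
  The identity $\sum aS(b_{(1)})b_{(2)}S(b_{(3)}) = aS(b)$ for the right multiplication by \<open>E\<close>.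
  Multiplied by $S(c)d$, the left-hand side is $\sum x\,S(cy)d$ over $x \otimes y = (a \otimes b)E$, and $(a
  \otimes cb)E = \sum a\varepsilon_s(b_{(1)}) \otimes cb_{(2)}$ with $(1 \otimes c)\Delta(b) \in A \otimes
  A$. Since $a\varepsilon_s(b_{(1)})$ needs a covering on the right, which is to be provided by the second
  leg, this is a case for \<open>tsum_contract\<close>. What remains is $\sum a
  S(b_{(1)})\,b_{(2)}S(b_{(3)})S(c)d$, where $\sum b_{(1)} \otimes b_{(2)}S(b_{(3)})S(c)d = E(b \otimes
  S(c)d)$, so the assumption on the left multiplication by \<open>E\<close> applies.
\<close>

lemma antipode_right: "tsum (E\<^sub>r (a \<otimes> b)) (\<lambda>x y. x \<cdot> S y) = a \<cdot> S b" (is "?X = _")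
proof -
  have "?X \<cdot> S c \<cdot> d = a \<cdot> S b \<cdot> S c \<cdot> d" for c d
  proof -
    have cover: "tensor_map (\<lambda>x. x \<cdot> e) (\<lambda>x. x) (l2 c (E\<^sub>r (a \<otimes> b))) =
        tensor_map (\<lambda>x. a \<cdot> eps_s_mul x e) (\<lambda>x. x) (left_cover c b)" for e
    proof (rule r2_cancel)
      fix f
      have "r2 f (r1 e (l2 c (E\<^sub>r (a \<otimes> b)))) =
          l2 c (tensor_map (\<lambda>x. x \<cdot> e) (\<lambda>x. x \<cdot> f) (E\<^sub>r (a \<otimes> b)))"
        by (simp add: expand lin mul_assoc)
      also have "\<dots> = tensor_map (\<lambda>x. a \<cdot> eps_s_mul x e) (\<lambda>x. x) (l2 c (T\<^sub>1 (b \<otimes> f)))"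
        by (simp add: E_right_eps_s tmap_tmap tmap_tsum tensor_map_pure lin) (simp add: tensor_map_def)
      also have "\<dots> = r2 f (tensor_map (\<lambda>x. a \<cdot> eps_s_mul x e) (\<lambda>x. x) (left_cover c b))"
        by (simp add: r2_left_cover[symmetric] tmap_tmap lin)
      finally show "r2 f (r1 e (l2 c (E\<^sub>r (a \<otimes> b)))) =
        r2 f (tensor_map (\<lambda>x. a \<cdot> eps_s_mul x e) (\<lambda>x. x) (left_cover c b))" .
    qed
    have "?X \<cdot> S c \<cdot> d = tsum (l2 c (E\<^sub>r (a \<otimes> b))) (\<lambda>x y. x \<cdot> (S y \<cdot> d))"
      by (simp add: expand lin S_mul mul_assoc mul_tsum_left)
    also have "\<dots> = tsum (left_cover c b) (\<lambda>x y. a \<cdot> eps_s_mul x (S y \<cdot> d))"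
      by (rule tsum_contract[where \<alpha>="\<lambda>x e. x \<cdot> e" and \<beta>="\<lambda>x e. a \<cdot> eps_s_mul x e" and \<theta>="\<lambda>y. S y \<cdot> d"])
        (intro lin cover)+
    also have "\<dots> = tsum (T1_inverse b (S c \<cdot> d)) (\<lambda>x y. a \<cdot> eps_s_mul x y)"
      by (simp add: T1_inverse_left_cover[symmetric] expand lin)
    also have "\<dots> = a \<cdot> tsum (T\<^sub>1 (T1_inverse b (S c \<cdot> d))) (\<lambda>p q. S p \<cdot> q)"
      unfolding tsum_eps_s_mul mul_tsum_right ..
    finally show ?thesis by (simp add: T1_T1_inverse antipode_left mul_assoc)
  qed
  note eq = this
  have "(?X - a \<cdot> S b) \<cdot> S c = 0" for c
  proof (rule nondeg_right)
    show "(?X - a \<cdot> S b) \<cdot> S c \<cdot> d = 0" for d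
      using eq[of c d] by (simp add: mul_diff_left)
  qed
  from this[of "inv S _"] have "(?X - a \<cdot> S b) \<cdot> c = 0" for c by simp
  then have "?X - a \<cdot> S b = 0" by (rule nondeg_right)
  then show ?thesis by simp
qed

text \<open>
  The opposite product together with the opposite coproduct: conjugation by the exchange of legs
  interchanges $T_1$ with $T_2$ and the left with the right multiplication by \<open>E\<close>, and
  \<open>S\<close> stays the same.
\<close>

lemma flipped: "weak_hopf_core_antipode (\<lambda>a b. b \<cdot> a) (\<lambda>z. tensor_swap (T\<^sub>2 (tensor_swap z)))
  (\<lambda>z. tensor_swap (T\<^sub>1 (tensor_swap z))) (\<lambda>z. tensor_swap (E\<^sub>r (tensor_swap z)))
  (\<lambda>z. tensor_swap (E\<^sub>l (tensor_swap z))) S"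
\<comment> \<open>The cases follow the order of the assumptions of the locales.\<close>
proof (intro weak_hopf_core_antipode.intro weak_hopf_core.intro weak_hopf_core_antipode_axioms.intro,
    goal_cases)
  case 1 show ?case by (simp add: lin)
next
  case (2 a b c) show ?case by (simp add: mul_assoc)
next
  case (3 a) then show ?case by (rule nondeg_right)
next
  case (4 a) then show ?case by (rule nondeg_left)
next
  case 5
  have "{b \<cdot> a | a b. True} = {a \<cdot> b | a b. True}" by auto
  then show ?case using idempotent by simp
next
  case 6 show ?case by (simp add: lin)
next
  case 7 show ?case by (simp add: lin)
next
  case 8 show ?case by (simp add: lin)
next
  case 9 show ?case by (simp add: lin)
next
  case 10 show ?case by (simp add: lin)
next
  case 11 show ?case by (rule S_bij)
next
  case 12 show ?case by (simp add: S_mul)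
next
  case (13 c a b) show ?case
    by (simp add: tensor_swap_pure tmap_swap T1_T2 lin)
next
  case (14 b c a)
  show ?case
    using coassoc_sum[where H="\<lambda>p q v. v \<otimes> (q \<otimes> p)" and a=a and b=c and c=b, symmetric]
    by (simp add: tensor_swap_pure tsum_swap lin)
next
  case (15 c d a b)
  then show ?case
    using E_compat[of b a d c] by (simp add: tensor_swap_pure tmap_swap lin)
next
  case 16 show ?case by (simp add: swap_swap Er_idem)
next
  case 17 show ?case by (simp add: swap_swap El_idem)
next
  case 18 show ?case by (simp add: range_conj_swap range_T2)
next
  case 19 show ?case by (simp add: range_conj_swap range_T1)
next
  case (20 w a b u)
  then have "T\<^sub>2 (tensor_swap w) = E\<^sub>r (b \<otimes> a)"
    by (metis swap_swap tensor_swap_pure)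
  from T2_mul[OF this, of u] show ?case
    by (simp add: tensor_swap_pure tmap_swap lin)
next
  case (21 w c d u)
  then have "T\<^sub>1 (tensor_swap w) = E\<^sub>l (d \<otimes> c)"
    by (metis swap_swap tensor_swap_pure)
  from T1_mul[OF this, of u] show ?case
    by (simp add: tensor_swap_pure tmap_swap lin)
next
  case (22 c d a b)
  show ?case
    using E_right[of d c b a] by (simp add: tensor_swap_pure tmap_swap tsum_swap swap_tsum lin mul_assoc)
next
  case (23 c d a b)
  show ?case
    using E_left[of d c b a] by (simp add: tensor_swap_pure tmap_swap tsum_swap swap_tsum lin mul_assoc)
next
  case (24 w)
  obtain z where "\<forall>c. r2 c z = tsum (T\<^sub>2 (tensor_swap w)) (\<lambda>u v. tsum (T\<^sub>1 (v \<otimes> c)) (\<lambda>p q. (u \<cdot> S p) \<otimes> q))"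
    using G_right by blast
  then show ?case
    by (intro exI[of _ "tensor_swap z"])
      (simp add: tensor_swap_pure tmap_swap tsum_swap swap_tsum lin)
next
  case (25 w)
  obtain z where "\<forall>c. l1 c z = tsum (T\<^sub>1 (tensor_swap w)) (\<lambda>u v. tsum (T\<^sub>2 (c \<otimes> u)) (\<lambda>p q. p \<otimes> S q \<cdot> v))"
    using G_left by blast
  then show ?case
    by (intro exI[of _ "tensor_swap z"])
      (simp add: tensor_swap_pure tmap_swap tsum_swap swap_tsum lin)
next
  case (26 a b c)
  show ?case
    using E_comm_sum(2)[where H="\<lambda>p q v. v \<otimes> (q \<otimes> p)" and a=a and b=c and c=b, symmetric]
    by (simp add: tensor_swap_pure tsum_swap lin)
next
  case (27 a b c)
  show ?case
    using E_comm_sum(1)[where H="\<lambda>p q v. v \<otimes> (q \<otimes> p)" and a=a and b=c and c=b, symmetric]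
    by (simp add: tensor_swap_pure tsum_swap lin)
next
  case (28 a b)
  show ?case using antipode_right[of b a] by (simp add: tensor_swap_pure tsum_swap lin)
qed

end

section \<open>Local units\<close>

context weak_hopf_core_antipode
begin

interpretation flip: weak_hopf_core_antipode "\<lambda>a b. b \<cdot> a" "\<lambda>z. tensor_swap (T\<^sub>2 (tensor_swap z))"
  "\<lambda>z. tensor_swap (T\<^sub>1 (tensor_swap z))" "\<lambda>z. tensor_swap (E\<^sub>r (tensor_swap z))"
  "\<lambda>z. tensor_swap (E\<^sub>l (tensor_swap z))" S
  by (rule flipped)

text \<open>
  The element $\Delta(a)(b \otimes 1)$.
\<close>

definition right_cover where "right_cover a b = tensor_swap (flip.left_cover b a)"

lemma l1_right_cover: "l1 c (right_cover a b) = r1 b (T\<^sub>2 (c \<otimes> a))"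
  using flip.r2_left_cover[of c b a]
  by (simp add: right_cover_def tmap_swap tensor_swap_pure lin) (simp add: tmap_swap[symmetric] swap_swap lin)

lemma Er_T1_sum:
  assumes H: "\<And>b c. clinear (\<lambda>a. H a b c)" "\<And>a c. clinear (\<lambda>b. H a b c)" "\<And>a b. clinear (\<lambda>c. H a b c)"
  shows "tsum (E\<^sub>r (a \<otimes> b)) (\<lambda>u v. tsum (T\<^sub>1 (v \<otimes> c)) (\<lambda>p q. H u p q)) =
    tsum (T\<^sub>1 (b \<otimes> c)) (\<lambda>p q. tsum (E\<^sub>r (a \<otimes> p)) (\<lambda>r s. H r s q))"
  using flip.Delta_id_El_sum[where H="\<lambda>p q v. H v q p" and a=b and b=a and c=c] H
  by (simp add: tensor_swap_pure tsum_swap lin)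

text \<open>
  This is $(id \otimes \Delta)((a \otimes b)E) = (a \otimes \Delta(b))(E \otimes 1)$, the mirror image of
  \<open>Delta_id_El\<close>, covered by \<open>e\<close> in the middle leg.
\<close>

lemma id_Delta_Er:
  "tsum (E\<^sub>r (a \<otimes> b)) (\<lambda>u v. u \<otimes> T\<^sub>2 (e \<otimes> v)) =
    tsum (T\<^sub>2 (e \<otimes> b)) (\<lambda>p q. tsum (E\<^sub>r (a \<otimes> p)) (\<lambda>r s. r \<otimes> (s \<otimes> q)))" (is "?L = ?R")
proof (rule tmap_right_cancel[of r2])
  fix c
  have "tensor_map (\<lambda>x. x) (r2 c) ?L = tsum (E\<^sub>r (a \<otimes> b)) (\<lambda>u v. u \<otimes> l1 e (T\<^sub>1 (v \<otimes> c)))"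
    by (simp add: tmap_tsum T1_T2 expand lin)
  also have "\<dots> = tsum (E\<^sub>r (a \<otimes> b)) (\<lambda>u v. tsum (T\<^sub>1 (v \<otimes> c)) (\<lambda>p q. u \<otimes> (e \<cdot> p \<otimes> q)))"
    by (simp add: tensor_map_def pure_tsum_right)
  also have "\<dots> = tsum (T\<^sub>1 (b \<otimes> c)) (\<lambda>p q. tsum (E\<^sub>r (a \<otimes> p)) (\<lambda>r s. r \<otimes> (e \<cdot> s \<otimes> q)))"
    by (rule Er_T1_sum) (intro lin)+
  also have "\<dots> = tsum (l1 e (T\<^sub>1 (b \<otimes> c))) (\<lambda>p q. tsum (E\<^sub>r (a \<otimes> p)) (\<lambda>r s. r \<otimes> (s \<otimes> q)))"
    by (simp add: expand lin Er_times_right_leg)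
  also have "\<dots> = tensor_map (\<lambda>x. x) (r2 c) ?R"
    by (simp add: T1_T2 tmap_tsum expand lin)
  finally show "tensor_map (\<lambda>x. x) (r2 c) ?L = tensor_map (\<lambda>x. x) (r2 c) ?R" .
qed (simp add: lin, erule r2_cancel_zero)

text \<open>
  The element $\varepsilon_t(v)q$. Its covering $d\,\varepsilon_t(v)q$ is given directly, but the element
  itself is obtained by multiplying the legs of $\sum v_{(1)} \otimes S(v_{(2)})q$.
\<close>

definition eps_t_mul where "eps_t_mul v q = tsum (T1_inverse v q) (\<lambda>r s. r \<cdot> s)"

lemma mul_eps_t_mul: "d \<cdot> eps_t_mul v q = mul_eps_t d v \<cdot> q"
proof -
  have "d \<cdot> eps_t_mul v q = tsum (l1 d (T1_inverse v q)) (\<lambda>r s. r \<cdot> s)"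
    by (simp add: eps_t_mul_def mul_tsum_right expand lin mul_assoc)
  then show ?thesis by (simp add: l1_T1_inverse expand lin mul_eps_t_def mul_tsum_left mul_assoc)
qed

lemma mul_left_cancel: "(\<And>d. d \<cdot> a = d \<cdot> b) \<Longrightarrow> a = b"
  using nondeg_left[of "a - b"] by (simp add: mul_diff_right)

lemma mul_right_cancel: "(\<And>d. a \<cdot> d = b \<cdot> d) \<Longrightarrow> a = b"
  using nondeg_right[of "a - b"] by (simp add: mul_diff_left)

lemma clinear_eps_t_mul [lin]:
  "clinear f \<Longrightarrow> clinear (\<lambda>x. eps_t_mul (f x) q)"
  "clinear f \<Longrightarrow> clinear (\<lambda>x. eps_t_mul v (f x))"
proof -
  have r: "d \<cdot> (a + b) = d \<cdot> a + d \<cdot> b" "d \<cdot> (k *\<^sub>c a) = k *\<^sub>c (d \<cdot> a)" for d a b k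
    using clinear_add[of "\<lambda>x. d \<cdot> x"] clinear_cscale[of "\<lambda>x. d \<cdot> x"] by (simp_all add: lin)
  have l: "(a + b) \<cdot> d = a \<cdot> d + b \<cdot> d" "(k *\<^sub>c a) \<cdot> d = k *\<^sub>c (a \<cdot> d)" for d a b k
    using clinear_add[of "\<lambda>x. x \<cdot> d"] clinear_cscale[of "\<lambda>x. x \<cdot> d"] by (simp_all add: lin)
  have e: "mul_eps_t d (a + b) = mul_eps_t d a + mul_eps_t d b"
    "mul_eps_t d (k *\<^sub>c a) = k *\<^sub>c mul_eps_t d a" for d a b k
    using clinear_add[of "\<lambda>x. mul_eps_t d x"] clinear_cscale[of "\<lambda>x. mul_eps_t d x"] by (simp_all add: lin)
  have "clinear (\<lambda>v. eps_t_mul v q)" for q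
    by (rule clinearI; rule mul_left_cancel) (simp_all add: r l e mul_eps_t_mul)
  then show "clinear f \<Longrightarrow> clinear (\<lambda>x. eps_t_mul (f x) q)" by (rule clinear_compose)
  have "clinear (\<lambda>q. eps_t_mul v q)" for v
    by (rule clinearI; rule mul_left_cancel) (simp_all add: r l e mul_eps_t_mul)
  then show "clinear f \<Longrightarrow> clinear (\<lambda>x. eps_t_mul v (f x))" by (rule clinear_compose)
qed

text \<open>
  $E(x \otimes 1)$ belongs to $A \otimes M(A)$: for $x = bb'$ it is $\sum u \otimes \varepsilon_t(v)$ over
  $u \otimes v = \Delta(b)(b' \otimes 1)$, and \<open>A\<close> is spanned by products.
\<close>

lemma El_first_leg: "\<exists>z. \<forall>q. E\<^sub>l (x \<otimes> q) = tensor_map (\<lambda>u. u) (\<lambda>v. eps_t_mul v q) z" (is "?P x")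
proof -
  have "x \<in> cvec.span {a \<cdot> b | a b. True}" using idempotent by simp
  then show ?thesis
  proof (induction rule: cvec.span_induct_alt)
    case base
    have "E\<^sub>l (0 \<otimes> q) = 0" for q
      using clinear_zero[of "\<lambda>x. E\<^sub>l (x \<otimes> q)"] by (simp add: lin)
    then show ?case by (intro exI[of _ 0]) (simp add: tmap_zero lin)
  next
    case (step k y x)
    then obtain z b b' where z: "\<And>q. E\<^sub>l (x \<otimes> q) = tensor_map (\<lambda>u. u) (\<lambda>v. eps_t_mul v q) z" and y: "y = b \<cdot> b'"
      by blast
    have "E\<^sub>l (y \<otimes> q) = tensor_map (\<lambda>u. u) (\<lambda>v. eps_t_mul v q) (right_cover b b')" for q
    proof (rule l12_cancel)
      fix c d
      let ?D = "tensor_map (\<lambda>x. c \<cdot> x) (\<lambda>x. d \<cdot> x)"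
      have "?D (E\<^sub>l (y \<otimes> q)) = r1 b' (?D (E\<^sub>l (b \<otimes> q)))"
        by (simp add: E_compat y tmap_tmap lin mul_assoc)
      also have "\<dots> = tensor_map (\<lambda>u. u) (\<lambda>v. mul_eps_t d v \<cdot> q) (r1 b' (T\<^sub>2 (c \<otimes> b)))"
        by (simp add: E_left_eps_t tmap_tmap tmap_tsum tensor_map_pure lin) (simp add: tensor_map_def)
      also have "\<dots> = ?D (tensor_map (\<lambda>u. u) (\<lambda>v. eps_t_mul v q) (right_cover b b'))"
        by (simp add: l1_right_cover[symmetric] tmap_tmap lin mul_eps_t_mul)
      finally show "?D (E\<^sub>l (y \<otimes> q)) = ?D (tensor_map (\<lambda>u. u) (\<lambda>v. eps_t_mul v q) (right_cover b b'))" .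
    qed
    note y = this
    show ?case
    proof (intro exI allI)
      fix q
      have l: "clinear (\<lambda>x. E\<^sub>l (x \<otimes> q))" "clinear (tensor_map (\<lambda>u. u) (\<lambda>v. eps_t_mul v q))"
        by (intro lin)+
      show "E\<^sub>l ((k *\<^sub>c y + x) \<otimes> q) = tensor_map (\<lambda>u. u) (\<lambda>v. eps_t_mul v q) (k *\<^sub>c right_cover b b' + z)"
        by (simp add: clinear_add[OF l(1)] clinear_cscale[OF l(1)] clinear_add[OF l(2)]
          clinear_cscale[OF l(2)] y z)
    qed
  qed
qed

lemma l2_El: "l2 b (E\<^sub>l (x \<otimes> q)) = tsum (T\<^sub>1 (b \<otimes> q)) (\<lambda>u v. eps_s_mul u x \<otimes> v)"
proof (rule l1_cancel)
  fix a
  have "l1 a (l2 b (E\<^sub>l (x \<otimes> q))) = tensor_map (\<lambda>t. a \<cdot> t) (\<lambda>t. b \<cdot> t) (E\<^sub>l (x \<otimes> q))"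
    by (simp add: tmap_tmap lin)
  then show "l1 a (l2 b (E\<^sub>l (x \<otimes> q))) = l1 a (tsum (T\<^sub>1 (b \<otimes> q)) (\<lambda>u v. eps_s_mul u x \<otimes> v))"
    by (simp add: E_compat E_right_eps_s tmap_tsum expand lin)
qed

text \<open>
  Write $E(x \otimes 1) = \sum u \otimes \varepsilon_t(v)$ as in \<open>El_first_leg\<close>. The first leg
  lies in the left ideal $Ax$: indeed $(1 \otimes b)E(x \otimes q) = \sum \varepsilon_s(u')x \otimes v'$,
  and $\varepsilon_s(u')x = \sum S(u'_{(1)})u'_{(2)}x$ is in $Ax$. Replacing every $u$ by $\kappa(u)x$, the
  identity $S(x)q = \sum S(u)\varepsilon_t(v)q$ becomes $S(x)q = S(x)\sum S(\kappa(u))\varepsilon_t(v)q$,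
  and the last sum is \<open>yq\<close> for some $y \in A$.
\<close>

lemma S_right_unit: "\<exists>y. S x \<cdot> y = S x"
proof -
  \<comment> \<open>A linear choice of \<open>\<kappa>(v)\<close> with \<open>\<kappa>(v)x = v\<close> for \<open>v\<close> in \<open>Ax\<close>; then \<open>P\<close> projects along \<open>Ax\<close>, and \<open>Pu = 0\<close> means that \<open>u\<close> is in \<open>Ax\<close>.\<close>
  have "\<exists>\<kappa>. clinear \<kappa> \<and> (\<forall>v\<in>range (\<lambda>a. a \<cdot> x). \<kappa> v \<cdot> x = v)"
    using vector_space_pair.linear_exists_right_inverse_on[OF vector_space_pair.intro[OF
      cvec.vector_space_axioms cvec.vector_space_axioms], of "\<lambda>a. a \<cdot> x" UNIV]
    by (auto simp: lin)
  then obtain \<kappa> where \<kappa>: "clinear \<kappa>" "\<And>a. \<kappa> (a \<cdot> x) \<cdot> x = a \<cdot> x" by blast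
  have l\<kappa>: "clinear f \<Longrightarrow> clinear (\<lambda>x. \<kappa> (f x))" for f :: "'a \<Rightarrow> 'a" by (rule clinear_compose[OF \<kappa>(1)])
  define P where "P u = u - \<kappa> u \<cdot> x" for u
  have lP: "clinear f \<Longrightarrow> clinear (\<lambda>x. P (f x))" for f :: "'a \<Rightarrow> 'a"
    unfolding P_def by (intro lin l\<kappa>)
  have P0: "P (a \<cdot> x) = 0" for a by (simp add: P_def \<kappa>)
  have T1_P: "tensor_map (\<lambda>t. t) P (T\<^sub>1 (u \<otimes> x)) = 0" for u
  proof (rule l1_cancel_zero)
    fix c
    have "l1 c (tensor_map (\<lambda>t. t) P (T\<^sub>1 (u \<otimes> x))) = tensor_map (\<lambda>t. t) P (l1 c (T\<^sub>1 (u \<otimes> x)))"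
      by (simp add: tmap_tmap lin lP)
    also have "\<dots> = tensor_map (\<lambda>t. t) (\<lambda>t. 0) (T\<^sub>2 (c \<otimes> u))"
      by (simp add: T1_T2 tmap_tmap lin lP P0)
    also have "\<dots> = 0"
      by (rule tensor_map_eqI[where g="\<lambda>z. 0"]) (simp_all add: lin tensor_map_pure pure_tensor_zero_right)
    finally show "l1 c (tensor_map (\<lambda>t. t) P (T\<^sub>1 (u \<otimes> x))) = 0" .
  qed
  have P_es: "P (eps_s_mul u x) = 0" for u
  proof -
    have split: "P (a \<cdot> P b) = P (a \<cdot> b)" for a b
      using P0[of "a \<cdot> \<kappa> b"] clinear_minus_eq[OF lP[OF clinear_ident(1)], of "a \<cdot> b" "a \<cdot> \<kappa> b \<cdot> x"]
      by (simp add: P_def[of b] mul_diff_right mul_assoc)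
    have "P (eps_s_mul u x) = tsum (T\<^sub>1 (u \<otimes> x)) (\<lambda>p q. P (S p \<cdot> P q))"
      unfolding eps_s_mul_def split by (rule linear_tsum[OF lP[OF clinear_ident(1)]])
    also have "\<dots> = tsum (tensor_map (\<lambda>t. t) P (T\<^sub>1 (u \<otimes> x))) (\<lambda>p q. P (S p \<cdot> q))"
      by (simp add: tsum_tmap lin lP)
    finally show ?thesis
      unfolding T1_P using clinear_zero[of "\<lambda>z. tsum z (\<lambda>p q. P (S p \<cdot> q))"] by (simp add: lin lP)
  qed
  have El_P: "tensor_map P (\<lambda>t. t) (E\<^sub>l (x \<otimes> q)) = 0" for q
  proof (rule l2_cancel_zero)
    fix b
    have "l2 b (tensor_map P (\<lambda>t. t) (E\<^sub>l (x \<otimes> q))) = tensor_map P (\<lambda>t. t) (l2 b (E\<^sub>l (x \<otimes> q)))"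
      by (simp add: tmap_tmap lin lP)
    also have "\<dots> = 0"
      by (simp add: l2_El tmap_tsum tensor_map_pure lin lP P_es pure_tensor_zero_left)
        (simp add: tensor_lift_def case_prod_unfold)
    finally show "l2 b (tensor_map P (\<lambda>t. t) (E\<^sub>l (x \<otimes> q))) = 0" .
  qed
  obtain Z where Z: "\<And>q. E\<^sub>l (x \<otimes> q) = tensor_map (\<lambda>u. u) (\<lambda>v. eps_t_mul v q) Z"
    using El_first_leg by blast
  have "S x \<cdot> q = S x \<cdot> tsum Z (\<lambda>u v. mul_eps_t (S (\<kappa> u)) v) \<cdot> q" for q
  proof -
    have "S x \<cdot> q = tsum Z (\<lambda>u v. S u \<cdot> eps_t_mul v q)"
      unfolding antipode_left[symmetric, of x q] by (simp add: Z expand lin)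
    also have "\<dots> = tsum Z (\<lambda>u v. S (P u) \<cdot> eps_t_mul v q) + tsum Z (\<lambda>u v. S (\<kappa> u \<cdot> x) \<cdot> eps_t_mul v q)"
    proof -
      have "tsum Z (\<lambda>u v. f u v + g u v) = tsum Z f + tsum Z g" for f g :: "'a \<Rightarrow> 'a \<Rightarrow> 'a"
        by (simp add: tensor_lift_def case_prod_unfold sum_list_addf)
      moreover have "tsum Z (\<lambda>u v. S u \<cdot> eps_t_mul v q) =
          tsum Z (\<lambda>u v. S (P u) \<cdot> eps_t_mul v q + S (\<kappa> u \<cdot> x) \<cdot> eps_t_mul v q)"
        using clinear_minus_eq[OF linear_maps(5), of _ "\<kappa> _ \<cdot> x"]
        by (intro arg_cong[where f="\<lambda>h. tensor_lift h Z"] ext) (simp add: P_def mul_diff_left)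
      ultimately show ?thesis by simp
    qed
    also have "tsum Z (\<lambda>u v. S (P u) \<cdot> eps_t_mul v q) =
        tsum (tensor_map P (\<lambda>t. t) (E\<^sub>l (x \<otimes> q))) (\<lambda>u v. S u \<cdot> v)"
      by (simp add: Z expand lin lP)
    also have "\<dots> = 0"
      unfolding El_P using clinear_zero[of "\<lambda>z. tsum z (\<lambda>p q. S p \<cdot> q)"] by (simp add: lin)
    also have "0 + tsum Z (\<lambda>u v. S (\<kappa> u \<cdot> x) \<cdot> eps_t_mul v q) = S x \<cdot> tsum Z (\<lambda>u v. mul_eps_t (S (\<kappa> u)) v) \<cdot> q"
      unfolding S_mul mul_assoc unfolding mul_eps_t_mul mul_tsum_left mul_tsum_right by simp
    finally show ?thesis .
  qed
  then have "S x = S x \<cdot> tsum Z (\<lambda>u v. mul_eps_t (S (\<kappa> u)) v)" by (rule mul_right_cancel)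
  then show ?thesis by metis
qed

lemma right_unit: "\<exists>e. x \<cdot> e = x"
  using S_right_unit[of "inv S x"] by simp

text \<open>
  The usual step from one to finitely many elements: if \<open>e\<close> is a unit for the elements of
  \<open>B\<close> and \<open>f\<close> one for $b - be$, then $e + f - ef$ is a unit for all of them.
\<close>

lemma right_units: "finite B \<Longrightarrow> \<exists>e. \<forall>b\<in>B. b \<cdot> e = b"
proof (induction B rule: finite_induct)
  case (insert b B)
  then obtain e where e: "\<And>c. c \<in> B \<Longrightarrow> c \<cdot> e = c" by blast
  obtain f where f: "(b - b \<cdot> e) \<cdot> f = b - b \<cdot> e" using right_unit by blast
  have d: "a \<cdot> (p + q) = a \<cdot> p + a \<cdot> q" for a p q
    by (rule clinear_add) (intro lin)
  show ?case
  proof (intro exI[of _ "e + (f - e \<cdot> f)"] ballI)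
    fix c assume "c \<in> insert b B"
    then show "c \<cdot> (e + (f - e \<cdot> f)) = c"
      using f e[of c] by (auto simp: d mul_diff_right mul_diff_left mul_assoc[symmetric])
  qed
qed simp

section \<open>Invariant functionals\<close>

text \<open>
  The equation for \<open>\<phi>\<close> is $(id \otimes \varphi)((b \otimes 1)\Delta(h)) = b$, the covered
  form of $(id \otimes \varphi)\Delta(h) = 1$. Testing it with all functionals \<open>g\<close> turns it
  into a prescription of values of \<open>\<phi>\<close>.
\<close>

lemma normalized_functional_exists:
  assumes faithful: "\<And>f. clinear f \<Longrightarrow> (\<And>b. slice_left f (T\<^sub>1 (h \<otimes> b)) = 0) \<Longrightarrow> f = (\<lambda>_. 0)"
  shows "\<exists>\<phi>. clinear \<phi> \<and> (\<forall>b. slice_right \<phi> (T\<^sub>2 (b \<otimes> h)) = b)"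
proof -
  have "\<exists>\<phi>. clinear \<phi> \<and> (\<forall>i\<in>{(g, b :: 'a). clinear g}.
      \<phi> ((\<lambda>(g, b). slice_left g (T\<^sub>2 (b \<otimes> h))) i) = (\<lambda>(g, b). g b) i)"
  proof (rule linear_functional_prescribed)
    fix F and c :: "('a \<Rightarrow> complex) \<times> 'a \<Rightarrow> complex"
    assume F: "finite F" "F \<subseteq> {(g, b :: 'a). clinear g}"
      and rel: "(\<Sum>i\<in>F. c i *\<^sub>c (\<lambda>(g, b). slice_left g (T\<^sub>2 (b \<otimes> h))) i) = 0"
    have lin_g: "clinear f \<Longrightarrow> clinear (\<lambda>x. fst i (f x))" if "i \<in> F" for i and f :: "'a \<Rightarrow> 'a"
      using clinear_compose[of "fst i" f] F(2) that by (cases i) auto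
    \<comment> \<open>The sum of the \<open>g\<^sub>i(b\<^sub>i \<cdot> x)\<close>, weighted with the coefficients of the relation.\<close>
    define G where "G x = (\<Sum>i\<in>F. c i * fst i (snd i \<cdot> x))" for x
    have "slice_left G (T\<^sub>1 (h \<otimes> d)) = 0" for d
    proof -
      have "slice_left G (T\<^sub>1 (h \<otimes> d)) = (\<Sum>i\<in>F. c i *\<^sub>c slice_left (\<lambda>x. fst i (snd i \<cdot> x)) (T\<^sub>1 (h \<otimes> d)))"
        unfolding G_def by (rule slice_left_sum) (intro lin_g lin)
      also have "\<dots> = (\<Sum>i\<in>F. c i *\<^sub>c (slice_left (fst i) (T\<^sub>2 (snd i \<otimes> h)) \<cdot> d))"
      proof (rule sum.cong[OF HOL.refl])
        fix i assume i: "i \<in> F"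
        have "slice_left (\<lambda>x. fst i (snd i \<cdot> x)) (T\<^sub>1 (h \<otimes> d)) = slice_left (fst i) (l1 (snd i) (T\<^sub>1 (h \<otimes> d)))"
          by (simp add: slice_left_tmap lin lin_g[OF i clinear_ident(1)])
        also have "\<dots> = slice_left (fst i) (T\<^sub>2 (snd i \<otimes> h)) \<cdot> d"
          by (simp add: T1_T2 slice_left_tmap lin lin_g[OF i clinear_ident(1)])
        finally show "c i *\<^sub>c slice_left (\<lambda>x. fst i (snd i \<cdot> x)) (T\<^sub>1 (h \<otimes> d)) =
          c i *\<^sub>c (slice_left (fst i) (T\<^sub>2 (snd i \<otimes> h)) \<cdot> d)" by simp
      qed
      also have "\<dots> = (\<Sum>i\<in>F. c i *\<^sub>c slice_left (fst i) (T\<^sub>2 (snd i \<otimes> h))) \<cdot> d"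
      proof -
        have l: "clinear (\<lambda>x. x \<cdot> d)" by (intro lin)
        show ?thesis unfolding clinear_sum[OF l] clinear_cscale[OF l] ..
      qed
      also have "\<dots> = 0"
        using rel clinear_zero[of "\<lambda>x. x \<cdot> d"] by (simp add: case_prod_unfold lin)
      finally show ?thesis .
    qed
    moreover have "clinear G"
      unfolding G_def cscale_complex[symmetric] by (intro clinear_functional_sum lin lin_g)
    ultimately have G: "G = (\<lambda>_. 0)" by (intro faithful)
    obtain e where e: "\<forall>b\<in>snd ` F. b \<cdot> e = b" using right_units F(1) by blast
    have "(\<Sum>i\<in>F. c i * (\<lambda>(g, b). g b) i) = G e"
      unfolding G_def by (intro sum.cong) (use e in \<open>auto simp: case_prod_unfold\<close>)
    then show "(\<Sum>i\<in>F. c i * (\<lambda>(g, b). g b) i) = 0" by (simp add: G)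
  qed
  then obtain \<phi> where \<phi>: "clinear \<phi>" "\<And>g b. clinear g \<Longrightarrow> \<phi> (slice_left g (T\<^sub>2 (b \<otimes> h))) = g b"
    by auto
  have "slice_right \<phi> (T\<^sub>2 (b \<otimes> h)) = b" for b
  proof (rule functionals_separate)
    fix g :: "'a \<Rightarrow> complex" assume g: "clinear g"
    have "g (slice_right \<phi> z) = \<phi> (slice_left g z)" for z
      unfolding slice_right_def slice_left_def linear_tsum[OF g] linear_tsum[OF \<phi>(1)]
      by (simp add: clinear_cscale[OF g] clinear_cscale[OF \<phi>(1)] cscale_complex mult.commute)
    then show "g (slice_right \<phi> (T\<^sub>2 (b \<otimes> h))) = g b" using \<phi>(2)[OF g] by simp
  qed
  then show ?thesis using \<phi>(1) by blast
qed

text \<open>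
  $\sum ch_{(1)} \otimes dh_{(2)}\varphi(h_{(3)}) = (c \otimes d)E$, that is, $\Delta$ applied to $(id
  \otimes \varphi)\Delta(h) = 1$.
\<close>

lemma normalized_functional_E:
  assumes \<phi>: "clinear \<phi>" "\<And>b. slice_right \<phi> (T\<^sub>2 (b \<otimes> h)) = b"
  shows "tsum (T\<^sub>2 (c \<otimes> h)) (\<lambda>u v. u \<otimes> slice_right \<phi> (T\<^sub>2 (d \<otimes> v))) = E\<^sub>r (c \<otimes> d)"
proof -
  have lin_\<phi>: "clinear f \<Longrightarrow> clinear (\<lambda>x. \<phi> (f x))" for f :: "'a \<Rightarrow> 'a"
    by (rule clinear_compose[OF \<phi>(1)])
  obtain w where w: "T\<^sub>2 w = E\<^sub>r (c \<otimes> d)" by (rule Er_preimage)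
  have "tsum (T\<^sub>2 (c \<otimes> h)) (\<lambda>u v. u \<otimes> slice_right \<phi> (T\<^sub>2 (d \<otimes> v))) =
      tsum (T\<^sub>2 (c \<otimes> h)) (\<lambda>p q. tsum (T\<^sub>2 (d \<otimes> q)) (\<lambda>u v. \<phi> v *\<^sub>c (p \<otimes> u)))"
    by (simp add: slice_right_def pure_tsum_right pure_tensor_cscale_right)
  also have "\<dots> = tsum w (\<lambda>x y. tsum (T\<^sub>2 (y \<otimes> h)) (\<lambda>u v. tsum (T\<^sub>2 (x \<otimes> u)) (\<lambda>p q. \<phi> v *\<^sub>c (p \<otimes> q))))"
    by (rule T2_coassoc_sum[OF w, symmetric]) (intro lin lin_\<phi>)+
  also have "\<dots> = tsum w (\<lambda>x y. T\<^sub>2 (x \<otimes> slice_right \<phi> (T\<^sub>2 (y \<otimes> h))))"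
  proof -
    have "tsum z (\<lambda>p q. k *\<^sub>c (p \<otimes> q)) = k *\<^sub>c z" for k and z :: "('a, 'a) tensor"
      using linear_eq_tsum[of "\<lambda>z. k *\<^sub>c z" z] by (simp add: lin)
    moreover have "T\<^sub>2 (x \<otimes> slice_right \<phi> z) = tsum z (\<lambda>u v. \<phi> v *\<^sub>c T\<^sub>2 (x \<otimes> u))" for x z
      unfolding slice_right_def
      by (subst linear_tsum[of "\<lambda>t. T\<^sub>2 (x \<otimes> t)"])
        (simp_all add: lin pure_tensor_cscale_right clinear_cscale[OF linear_maps(2)])
    ultimately show ?thesis by simp
  qed
  also have "\<dots> = T\<^sub>2 w"
    unfolding \<phi>(2) by (rule linear_eq_tsum[OF linear_maps(2), symmetric])
  finally show ?thesis by (simp add: w)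
qed

text \<open>
  With $x_a = (id \otimes \varphi)\Delta(a)$, acting on the right by \<open>\<rho> a\<close>, and $(c
  \otimes d)E = \sum (x \otimes 1)\Delta(y)$ over \<open>w\<close>, the conclusion says that $\sum (x
  \otimes 1)\Delta(yx_a) = (cx_a \otimes d)E$, which is $(c \otimes d)\Delta(x_a) = (c \otimes d)(x_a
  \otimes 1)E$ for the extended $\Delta$. The difference \<open>H a\<close> of the two sides is linear in
  \<open>a\<close>, so by faithfulness it suffices that $\sum qh_{(1)} \otimes H(h_{(2)}) = 0$ for all
  \<open>q\<close>. By \<open>normalized_functional_E\<close> the two terms are $(q \otimes c \otimes d)(1
  \otimes E)(E \otimes 1)$ and $(q \otimes c \otimes d)(E \otimes 1)(1 \otimes E)$.
\<close>

lemma slice_invariance: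
  assumes \<phi>: "clinear \<phi>" "\<And>b. slice_right \<phi> (T\<^sub>2 (b \<otimes> h)) = b"
    and faithful: "\<And>f. clinear f \<Longrightarrow> (\<And>b. slice_right f (T\<^sub>2 (b \<otimes> h)) = 0) \<Longrightarrow> f = (\<lambda>_. 0)"
    and w: "T\<^sub>2 w = E\<^sub>r (c \<otimes> d)"
  shows "T\<^sub>2 (tensor_map (\<lambda>x. x) (\<lambda>x. slice_right \<phi> (T\<^sub>2 (x \<otimes> a))) w) = E\<^sub>r (slice_right \<phi> (T\<^sub>2 (c \<otimes> a)) \<otimes> d)"
proof -
  define \<rho> where "\<rho> a x = slice_right \<phi> (T\<^sub>2 (x \<otimes> a))" for a x
  have lin_\<rho>: "clinear f \<Longrightarrow> clinear (\<lambda>x. \<rho> a (f x))" "clinear f \<Longrightarrow> clinear (\<lambda>x. \<rho> (f x) a)" for a f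
    unfolding \<rho>_def by (intro lin \<phi>(1); assumption)+
  define H where "H a = T\<^sub>2 (tensor_map (\<lambda>x. x) (\<rho> a) w) - E\<^sub>r (\<rho> a c \<otimes> d)" for a
  have H_tsum: "H a = tsum w (\<lambda>x y. T\<^sub>2 (x \<otimes> \<rho> a y)) - E\<^sub>r (\<rho> a c \<otimes> d)" for a
    unfolding H_def
    by (subst linear_eq_tsum[of "\<lambda>w. T\<^sub>2 (tensor_map (\<lambda>x. x) (\<rho> a) w)"])
      (simp_all add: lin lin_\<rho> expand)
  have lin_H: "clinear f \<Longrightarrow> clinear (\<lambda>x. H (f x))" for f :: "'a \<Rightarrow> 'a"
    unfolding H_tsum by (intro lin lin_\<rho>)
  have zero: "tensor_map (\<lambda>x. x) H (T\<^sub>2 (q \<otimes> h)) = 0" for q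
  proof -
    have E: "tsum (T\<^sub>2 (q \<otimes> h)) (\<lambda>u v. u \<otimes> F (\<rho> v y)) = tsum (E\<^sub>r (q \<otimes> y)) (\<lambda>r s. r \<otimes> F s)"
      if "clinear F" for F :: "'a \<Rightarrow> ('a, 'a) tensor" and y
      unfolding normalized_functional_E[OF \<phi>, symmetric] \<rho>_def
      by (simp add: expand lin clinear_compose[OF that])
    have "tsum (T\<^sub>2 (q \<otimes> h)) (\<lambda>u v. tsum w (\<lambda>x y. u \<otimes> T\<^sub>2 (x \<otimes> \<rho> v y))) =
        tsum w (\<lambda>x y. tsum (E\<^sub>r (q \<otimes> y)) (\<lambda>r s. r \<otimes> T\<^sub>2 (x \<otimes> s)))"
      by (subst tsum_commute) (simp add: E[of "\<lambda>s. T\<^sub>2 (x \<otimes> s)" for x] lin)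
    also have "\<dots> = tsum w (\<lambda>x y. tsum (T\<^sub>2 (x \<otimes> y)) (\<lambda>p p'. tsum (E\<^sub>r (q \<otimes> p)) (\<lambda>r s. r \<otimes> (s \<otimes> p'))))"
      by (simp add: id_Delta_Er)
    also have "\<dots> = tsum (T\<^sub>2 w) (\<lambda>p p'. tsum (E\<^sub>r (q \<otimes> p)) (\<lambda>r s. r \<otimes> (s \<otimes> p')))"
      by (subst (2) linear_eq_tsum[OF linear_maps(2)]) (simp add: tsum_tsum lin)
    also have "\<dots> = tsum (E\<^sub>r (q \<otimes> c)) (\<lambda>p s. tsum (E\<^sub>r (s \<otimes> d)) (\<lambda>r t. p \<otimes> (r \<otimes> t)))"
      unfolding w by (rule Er_comm[symmetric])
    also have "\<dots> = tsum (T\<^sub>2 (q \<otimes> h)) (\<lambda>u v. u \<otimes> E\<^sub>r (\<rho> v c \<otimes> d))"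
      by (simp add: E[of "\<lambda>s. E\<^sub>r (s \<otimes> d)"] lin pure_tsum_right[symmetric] tsum_eq_pure)
    finally have "tsum (T\<^sub>2 (q \<otimes> h)) (\<lambda>u v. tsum w (\<lambda>x y. u \<otimes> T\<^sub>2 (x \<otimes> \<rho> v y))) =
      tsum (T\<^sub>2 (q \<otimes> h)) (\<lambda>u v. u \<otimes> E\<^sub>r (\<rho> v c \<otimes> d))" .
    moreover have "tsum z (\<lambda>u v. f u v - g u v) = tsum z f - tsum z g" for f g ::
        "'a \<Rightarrow> 'a \<Rightarrow> ('a, ('a, 'a) tensor) tensor" and z
      by (simp add: tensor_lift_def case_prod_unfold sum_list_subtractf)
    moreover have "u \<otimes> (s - t) = u \<otimes> s - u \<otimes> t" for u :: 'a and s t :: "('a, 'a) tensor"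
      by (rule clinear_minus_eq) (intro lin)
    ultimately show ?thesis
      unfolding tensor_map_def by (simp add: H_tsum pure_tsum_right)
  qed
  have "H a = 0"
  proof (rule functionals_separate)
    fix \<omega> :: "('a, 'a) tensor \<Rightarrow> complex" assume \<omega>: "clinear \<omega>"
    have "(\<lambda>x. \<omega> (H x)) = (\<lambda>_. 0)"
    proof (rule faithful)
      show "clinear (\<lambda>x. \<omega> (H x))" by (rule clinear_compose[OF \<omega>]) (intro lin_H lin)
      fix b
      have "slice_right (\<lambda>x. \<omega> (H x)) (T\<^sub>2 (b \<otimes> h)) = slice_right \<omega> (tensor_map (\<lambda>x. x) H (T\<^sub>2 (b \<otimes> h)))"
        by (simp add: slice_right_tmap \<omega> lin lin_H)
      then show "slice_right (\<lambda>x. \<omega> (H x)) (T\<^sub>2 (b \<otimes> h)) = 0"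
        unfolding zero using clinear_zero[OF clinear_slice_right[OF \<omega> clinear_ident(1)]] by simp
    qed
    then show "\<omega> (H a) = \<omega> 0" using clinear_zero[OF \<omega>] by metis
  qed
  then show ?thesis unfolding H_def \<rho>_def by simp
qed

lemma left_invariant_functional:
  assumes "\<And>f. clinear f \<Longrightarrow> (\<And>b. slice_left f (T\<^sub>1 (h \<otimes> b)) = 0) \<Longrightarrow> f = (\<lambda>_. 0)"
    and "\<And>f. clinear f \<Longrightarrow> (\<And>b. slice_right f (T\<^sub>2 (b \<otimes> h)) = 0) \<Longrightarrow> f = (\<lambda>_. 0)"
  shows "\<exists>\<phi>. clinear \<phi> \<and> (\<forall>b. slice_right \<phi> (T\<^sub>2 (b \<otimes> h)) = b) \<and>
    (\<forall>a c d w. T\<^sub>2 w = E\<^sub>r (c \<otimes> d) \<longrightarrow>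
      T\<^sub>2 (tensor_map (\<lambda>x. x) (\<lambda>x. slice_right \<phi> (T\<^sub>2 (x \<otimes> a))) w) =
      E\<^sub>r (slice_right \<phi> (T\<^sub>2 (c \<otimes> a)) \<otimes> d))"
proof -
  obtain \<phi> where \<phi>: "clinear \<phi>" "\<And>b. slice_right \<phi> (T\<^sub>2 (b \<otimes> h)) = b"
    using normalized_functional_exists[OF assms(1)] by blast
  show ?thesis
    using \<phi> slice_invariance[OF \<phi> assms(2)] by blast
qed

end

context weak_hopf_core_antipode
begin

text \<open>
  The interpretation is renewed so that it includes \<open>left_invariant_functional\<close>.
\<close>

interpretation flip: weak_hopf_core_antipode "\<lambda>a b. b \<cdot> a" "\<lambda>z. tensor_swap (T\<^sub>2 (tensor_swap z))"
  "\<lambda>z. tensor_swap (T\<^sub>1 (tensor_swap z))" "\<lambda>z. tensor_swap (E\<^sub>r (tensor_swap z))"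
  "\<lambda>z. tensor_swap (E\<^sub>l (tensor_swap z))" S
  by (rule flipped)

text \<open>
  This is \<open>left_invariant_functional\<close> for the opposite structure.
\<close>

lemma right_invariant_functional:
  assumes "\<And>f. clinear f \<Longrightarrow> (\<And>b. slice_left f (T\<^sub>1 (h \<otimes> b)) = 0) \<Longrightarrow> f = (\<lambda>_. 0)"
    and "\<And>f. clinear f \<Longrightarrow> (\<And>b. slice_right f (T\<^sub>2 (b \<otimes> h)) = 0) \<Longrightarrow> f = (\<lambda>_. 0)"
  shows "\<exists>\<psi>. clinear \<psi> \<and> (\<forall>b. slice_left \<psi> (T\<^sub>1 (h \<otimes> b)) = b) \<and>
    (\<forall>a c d w. T\<^sub>1 w = E\<^sub>l (c \<otimes> d) \<longrightarrow>
      T\<^sub>1 (tensor_map (\<lambda>x. slice_left \<psi> (T\<^sub>1 (a \<otimes> x))) (\<lambda>x. x) w) =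
      E\<^sub>l (c \<otimes> slice_left \<psi> (T\<^sub>1 (a \<otimes> d))))"
proof -
  have 1: "f = (\<lambda>_. 0)" if "clinear f" "\<And>b. slice_left f (tensor_swap (T\<^sub>2 (tensor_swap (h \<otimes> b)))) = 0" for f
    using assms(2) that by (simp add: tensor_swap_pure slice_left_swap)
  have 2: "f = (\<lambda>_. 0)" if "clinear f" "\<And>b. slice_right f (tensor_swap (T\<^sub>1 (tensor_swap (b \<otimes> h)))) = 0" for f
    using assms(1) that by (simp add: tensor_swap_pure slice_right_swap)
  obtain \<psi> where \<psi>: "clinear \<psi>"
    "\<And>b. slice_right \<psi> (tensor_swap (T\<^sub>1 (tensor_swap (b \<otimes> h)))) = b"
    "\<And>a c d w. tensor_swap (T\<^sub>1 (tensor_swap w)) = tensor_swap (E\<^sub>l (tensor_swap (c \<otimes> d))) \<Longrightarrow>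
      tensor_swap (T\<^sub>1 (tensor_swap (tensor_map (\<lambda>x. x)
        (\<lambda>x. slice_right \<psi> (tensor_swap (T\<^sub>1 (tensor_swap (x \<otimes> a))))) w))) =
      tensor_swap (E\<^sub>l (tensor_swap (slice_right \<psi> (tensor_swap (T\<^sub>1 (tensor_swap (c \<otimes> a)))) \<otimes> d)))"
    using flip.left_invariant_functional[of h, OF 1 2] by blast
  have slice: "slice_right \<psi> (tensor_swap z) = slice_left \<psi> z" for z :: "('a, 'a) tensor"
    by (rule slice_right_swap[OF \<psi>(1)])
  have "T\<^sub>1 (tensor_map (\<lambda>x. slice_left \<psi> (T\<^sub>1 (a \<otimes> x))) (\<lambda>x. x) w) = E\<^sub>l (c \<otimes> slice_left \<psi> (T\<^sub>1 (a \<otimes> d)))"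
    if "T\<^sub>1 w = E\<^sub>l (c \<otimes> d)" for a c d w
  proof -
    have "tensor_swap (T\<^sub>1 (tensor_swap (tensor_swap w))) = tensor_swap (E\<^sub>l (tensor_swap (d \<otimes> c)))"
      by (simp add: swap_swap tensor_swap_pure that)
    from arg_cong[OF \<psi>(3)[OF this, of a], of tensor_swap] show ?thesis
      by (simp add: swap_swap tensor_swap_pure slice tmap_swap lin \<psi>(1))
  qed
  then show ?thesis using \<psi>(1,2) by (auto simp: tensor_swap_pure slice)
qed

end

section \<open>Multipliers\<close>

lemma clinear_lact_right [lin]: "clinear f \<Longrightarrow> clinear (\<lambda>x. lact m (f x))"
  by (rule clinear_compose[OF clinear_lact])

lemma clinear_ract_left [lin]: "clinear f \<Longrightarrow> clinear (\<lambda>x. ract (f x) m)"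
  by (rule clinear_compose[OF clinear_ract])

lemma lact_linear: "lact (m + n) a = lact m a + lact n a" "lact (c *\<^sub>c m) a = c *\<^sub>c lact m a" "lact 0 a = 0"
  by (transfer; auto)+

lemma ract_linear: "ract a (m + n) = ract a m + ract a n" "ract a (c *\<^sub>c m) = c *\<^sub>c ract a m" "ract a 0 = 0"
  by (transfer; auto)+

lemma clinear_embed [lin]: "clinear f \<Longrightarrow> clinear (\<lambda>x. embed (f x))"
  by (auto intro!: clinearI multiplier_eqI simp: lact_linear ract_linear lact_embed ract_embed
      clinear_add clinear_cscale distrib_left distrib_right mult_cscale_left mult_cscale_right)

lemma lact_tensor_mult: "lact (m \<otimes>\<^sub>m n) z = tensor_map (lact m) (lact n) z"
  by transfer auto

lemma ract_tensor_mult: "ract z (m \<otimes>\<^sub>m n) = tensor_map (\<lambda>a. ract a m) (\<lambda>b. ract b n) z"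
  by transfer auto

lemmas act_simps = lact_mult[abs_def] ract_mult lact_one[abs_def] ract_one lact_embed[abs_def] ract_embed
  lact_tensor_mult[abs_def] ract_tensor_mult

lemma tensor_mult_times: "(m \<otimes>\<^sub>m n) * (m' \<otimes>\<^sub>m n') = (m * m') \<otimes>\<^sub>m (n * n')"
  by (rule multiplier_eqI) (simp_all add: act_simps tmap_tmap lin)

lemma times_pure_right: "z * (a \<otimes> b) = tensor_map (\<lambda>x. x * a) (\<lambda>x. x * b) z"
  by (rule tensor_map_eqI[where f="\<lambda>z. z * (a \<otimes> b)"]) (simp_all add: lin pure_tensor_times tensor_map_pure)

lemma times_pure_left: "(a \<otimes> b) * z = tensor_map (\<lambda>x. a * x) (\<lambda>x. b * x) z"
  by (rule tensor_map_eqI[where f="\<lambda>z. (a \<otimes> b) * z"]) (simp_all add: lin pure_tensor_times tensor_map_pure)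

lemma embed_pure: "embed (a \<otimes> b) = embed a \<otimes>\<^sub>m embed b"
  by (rule multiplier_eqI) (simp_all add: act_simps times_pure_right times_pure_left)

lemma embed_times: "embed (a * b) = embed a * embed b"
  by (rule multiplier_eqI) (simp_all add: act_simps mult.assoc)

lemma embed_lact: "embed (lact m a) = m * embed a"
  by (rule multiplier_eqI) (simp_all add: act_simps lact_times times_lact)

lemma embed_ract: "embed (ract a m) = embed a * m"
  by (rule multiplier_eqI) (simp_all add: act_simps ract_times times_lact)

lemma embed_legs:
  "embed (tensor_map (\<lambda>x. c * x) (\<lambda>x. x) z) = (embed c \<otimes>\<^sub>m 1) * embed z"
  "embed (tensor_map (\<lambda>x. x) (\<lambda>x. c' * x) z) = (1 \<otimes>\<^sub>m embed c') * embed z"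
  "embed (tensor_map (\<lambda>x. x * c) (\<lambda>x. x) z) = embed z * (embed c \<otimes>\<^sub>m 1)"
  "embed (tensor_map (\<lambda>x. x) (\<lambda>x. x * c') z) = embed z * (1 \<otimes>\<^sub>m embed c')"
  by (simp_all add: embed_lact[symmetric] embed_ract[symmetric] act_simps)

lemma embed_both_legs:
  "embed (tensor_map (\<lambda>x. c * x) (\<lambda>x. d * x) z) = (embed c \<otimes>\<^sub>m embed d) * embed z"
  "embed (tensor_map (\<lambda>x. x * c) (\<lambda>x. x * d) z) = embed z * (embed c \<otimes>\<^sub>m embed d)"
  by (simp_all add: embed_lact[symmetric] embed_ract[symmetric] act_simps)

lemma clinear_tensor_mult [lin]:
  "clinear f \<Longrightarrow> clinear (\<lambda>x. f x \<otimes>\<^sub>m n)" "clinear f \<Longrightarrow> clinear (\<lambda>x. m \<otimes>\<^sub>m f x)"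
proof -
  have l: "tensor_map (\<lambda>a. F a + F' a) G z = tensor_map F G z + tensor_map F' G z"
    "tensor_map G (\<lambda>a. F a + F' a) y = tensor_map G F y + tensor_map G F' y"
    "tensor_map (\<lambda>a. c *\<^sub>c F a) G z = c *\<^sub>c tensor_map F G z"
    "tensor_map G (\<lambda>a. c *\<^sub>c F a) y = c *\<^sub>c tensor_map G F y"
    if "clinear F" "clinear G" "clinear F'" for F F' :: "'x::complex_vector \<Rightarrow> 'y::complex_vector"
      and G :: "'u::complex_vector \<Rightarrow> 'v::complex_vector" and c and z :: "('x, 'u) tensor" and y ::
          "('u, 'x) tensor"
  proof -
    note p = tensor_map_pure pure_tensor_add_left pure_tensor_add_right
      pure_tensor_cscale_left pure_tensor_cscale_right
    show "tensor_map (\<lambda>a. F a + F' a) G z = tensor_map F G z + tensor_map F' G z"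
      by (rule tensor_map_eqI[where f="\<lambda>z. tensor_map (\<lambda>a. F a + F' a) G z"]) (simp_all add: lin that p)
    show "tensor_map G (\<lambda>a. F a + F' a) y = tensor_map G F y + tensor_map G F' y"
      by (rule tensor_map_eqI[where f="\<lambda>z. tensor_map G (\<lambda>a. F a + F' a) z"]) (simp_all add: lin that p)
    show "tensor_map (\<lambda>a. c *\<^sub>c F a) G z = c *\<^sub>c tensor_map F G z"
      by (rule tensor_map_eqI[where f="\<lambda>z. tensor_map (\<lambda>a. c *\<^sub>c F a) G z"]) (simp_all add: lin that p)
    show "tensor_map G (\<lambda>a. c *\<^sub>c F a) y = c *\<^sub>c tensor_map G F y"
      by (rule tensor_map_eqI[where f="\<lambda>z. tensor_map G (\<lambda>a. c *\<^sub>c F a) z"]) (simp_all add: lin that p)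
  qed
  have "clinear (\<lambda>m. m \<otimes>\<^sub>m n)"
    by (auto intro!: clinearI multiplier_eqI
      simp: lact_linear[abs_def] ract_linear[abs_def] act_simps l(1,2) l(3,4)[OF _ _ clinear_const0] lin
          clinear_lact)
  then show "clinear f \<Longrightarrow> clinear (\<lambda>x. f x \<otimes>\<^sub>m n)" by (rule clinear_compose)
  have "clinear (\<lambda>n. m \<otimes>\<^sub>m n)"
    by (auto intro!: clinearI multiplier_eqI
      simp: lact_linear[abs_def] ract_linear[abs_def] act_simps l(1,2) l(3,4)[OF _ _ clinear_const0] lin
          clinear_lact)
  then show "clinear f \<Longrightarrow> clinear (\<lambda>x. m \<otimes>\<^sub>m f x)" by (rule clinear_compose)
qed

lemma nondegenerate_tensor:
  assumes a: "nondegenerate TYPE('a::complex_algebra)" and b: "nondegenerate TYPE('b::complex_algebra)"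
  shows "nondegenerate TYPE(('a, 'b) tensor)"
  unfolding nondegenerate_def
proof (intro conjI allI impI)
  fix z :: "('a, 'b) tensor"
  have 0: "tensor_map f g 0 = 0" if "clinear f" "clinear g" for f :: "'a \<Rightarrow> 'a" and g :: "'b \<Rightarrow> 'b"
    by (rule clinear_zero[OF clinear_tensor_map[OF that]])
  have sep: "x = 0" if "\<And>c. (x::'a) * c = 0" for x using a that unfolding nondegenerate_def by blast
  have sep1: "x = 0" if "\<And>c. c * (x::'a) = 0" for x using a that unfolding nondegenerate_def by blast
  have sep2: "x = 0" if "\<And>c. (x::'b) * c = 0" for x using b that unfolding nondegenerate_def by blast
  have sep3: "x = 0" if "\<And>c. c * (x::'b) = 0" for x using b that unfolding nondegenerate_def by blast
  {
    assume z: "\<forall>y. z * y = 0"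
    show "z = 0"
    proof (rule tmap_left_cancel[of "\<lambda>c x. x * c"])
      fix c :: 'a
      have "tensor_map (\<lambda>x. x * c) (\<lambda>x. x) z = 0"
      proof (rule tmap_right_cancel[of "\<lambda>c x. x * c"])
        fix d :: 'b
        show "tensor_map (\<lambda>x. x) (\<lambda>x. x * d) (tensor_map (\<lambda>x. x * c) (\<lambda>x. x) z) =
            tensor_map (\<lambda>x. x) (\<lambda>x. x * d) 0"
          using z times_pure_right[of z c d] by (simp add: tmap_tmap lin 0)
      qed (simp add: lin, erule sep2)
      then show "tensor_map (\<lambda>x. x * c) (\<lambda>x. x) z = tensor_map (\<lambda>x. x * c) (\<lambda>x. x) 0"
        by (simp add: 0 lin)
    qed (simp add: lin, erule sep)
  next
    assume z: "\<forall>y. y * z = 0"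
    show "z = 0"
    proof (rule tmap_left_cancel[of "\<lambda>c x. c * x"])
      fix c :: 'a
      have "tensor_map (\<lambda>x. c * x) (\<lambda>x. x) z = 0"
      proof (rule tmap_right_cancel[of "\<lambda>c x. c * x"])
        fix d :: 'b
        show "tensor_map (\<lambda>x. x) (\<lambda>x. d * x) (tensor_map (\<lambda>x. c * x) (\<lambda>x. x) z) =
            tensor_map (\<lambda>x. x) (\<lambda>x. d * x) 0"
          using z times_pure_left[of c d z] by (simp add: tmap_tmap lin 0)
      qed (simp add: lin, erule sep3)
      then show "tensor_map (\<lambda>x. c * x) (\<lambda>x. x) z = tensor_map (\<lambda>x. c * x) (\<lambda>x. x) 0"
        by (simp add: 0 lin)
    qed (simp add: lin, erule sep1)
  }
qed

text \<open>
  By non-degeneracy $amb = anb$ for all \<open>b\<close> forces $am = an$.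
\<close>

lemma multiplier_eq_lact:
  assumes "nondegenerate TYPE('a::complex_algebra)" "\<And>a. lact m a = lact n (a::'a)"
  shows "m = n"
proof (rule multiplier_eqI)
  fix a
  have "(ract a m - ract a n) * b = 0" for b
    using times_lact[of a m b] times_lact[of a n b] assms(2) by (simp add: left_diff_distrib)
  then show "ract a m = ract a n" using assms(1) unfolding nondegenerate_def by (metis right_minus_eq)
qed (rule assms)

lemma multiplier_eq_ract:
  assumes "nondegenerate TYPE('a::complex_algebra)" "\<And>a. ract a m = ract (a::'a) n"
  shows "m = n"
proof (rule multiplier_eqI)
  fix a
  have "b * (lact m a - lact n a) = 0" for b
    using times_lact[of b m a] times_lact[of b n a] assms(2) by (simp add: right_diff_distrib)
  then show "lact m a = lact n a" using assms(1) unfolding nondegenerate_def by (metis right_minus_eq)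
qed (rule assms)

lemma element_of_embed: "nondegenerate TYPE('a::complex_algebra) \<Longrightarrow> element_of (embed (a::'a)) = a"
  unfolding element_of_def by (rule the_equality) (auto dest: injD[OF inj_embed])

lemma embed_element_of: "nondegenerate TYPE('a::complex_algebra) \<Longrightarrow> m \<in> range embed \<Longrightarrow>
    embed (element_of m :: 'a) = m"
  by (auto simp: element_of_embed)

lemma clinear_element_of:
  assumes "nondegenerate TYPE('a::complex_algebra)" "clinear F" "\<And>x. F x \<in> range (embed :: 'a \<Rightarrow> _)"
  shows "clinear (\<lambda>x. element_of (F x))"
proof (rule clinearI; rule injD[OF inj_embed[OF assms(1)]])
  have e: "embed (a + b) = embed a + embed (b::'a)" "embed (c *\<^sub>c a) = c *\<^sub>c embed a" for a b c
    using clinear_add[of "embed :: 'a \<Rightarrow> _"] clinear_cscale[of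
        "embed :: 'a \<Rightarrow> _"] clinear_embed[OF clinear_ident(1)] by auto
  show "embed (element_of (F (x + y))) = embed (element_of (F x) + element_of (F y))"
    "embed (element_of (F (c *\<^sub>c x))) = embed (c *\<^sub>c element_of (F x))" for x y c
    unfolding e embed_element_of[OF assms(1,3)]
    by (simp_all only: clinear_add[OF assms(2)] clinear_cscale[OF assms(2)])
qed

lemma left_leg_cancel:
  assumes nd: "nondegenerate TYPE('a::complex_algebra)" "nondegenerate TYPE('b::complex_algebra)"
    and eq: "\<And>c. (embed c \<otimes>\<^sub>m 1) * m = (embed c \<otimes>\<^sub>m 1) * (n :: ('a, 'b) tensor multiplier)"
  shows "m = n"
proof (rule multiplier_eq_lact[OF nondegenerate_tensor[OF nd]])
  fix z
  show "lact m z = lact n z"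
  proof (rule tmap_left_cancel[of "\<lambda>c x. c * x"])
    fix c
    show "tensor_map (\<lambda>x. c * x) (\<lambda>x. x) (lact m z) = tensor_map (\<lambda>x. c * x) (\<lambda>x. x) (lact n z)"
      using arg_cong[OF eq[of c], of "\<lambda>m. lact m z"] by (simp add: act_simps)
  next
    show "x = 0" if "\<And>c. c * (x::'a) = 0" for x using nd that unfolding nondegenerate_def by blast
  qed (simp add: lin)
qed

lemma right_leg_cancel:
  assumes nd: "nondegenerate TYPE('a::complex_algebra)" "nondegenerate TYPE('b::complex_algebra)"
    and eq: "\<And>c. m * (1 \<otimes>\<^sub>m embed c) = (n :: ('a, 'b) tensor multiplier) * (1 \<otimes>\<^sub>m embed c)"
  shows "m = n"
proof (rule multiplier_eq_ract[OF nondegenerate_tensor[OF nd]])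
  fix z
  show "ract z m = ract z n"
  proof (rule tmap_right_cancel[of "\<lambda>c x. x * c"])
    fix c
    show "tensor_map (\<lambda>x. x) (\<lambda>x. x * c) (ract z m) = tensor_map (\<lambda>x. x) (\<lambda>x. x * c) (ract z n)"
      using arg_cong[OF eq[of c], of "\<lambda>m. ract z m"] by (simp add: act_simps)
  next
    show "x = 0" if "\<And>c. (x::'b) * c = 0" for x using nd that unfolding nondegenerate_def by blast
  qed (simp add: lin)
qed

lemma mult_assoc_act:
  "lact (mult_assoc m) (tensor_assoc z) = tensor_assoc (lact m z)"
  "ract (tensor_assoc z) (mult_assoc m) = tensor_assoc (ract z m)"
  unfolding mult_assoc_def by (rule transport_iso[OF algebra_hom_tensor_assoc bij_tensor_assoc])+

lemma mult_assoc_eqI: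
  assumes "\<And>z. lact m (tensor_assoc z) = lact n (tensor_assoc z)"
    "\<And>z. ract (tensor_assoc z) m = ract (tensor_assoc z) n"
  shows "m = n"
  by (rule multiplier_eqI) (metis assms bij_tensor_assoc bij_is_surj surjD)+

lemma tensor_assoc_times: "tensor_assoc (x * y) = tensor_assoc x * tensor_assoc y"
  using algebra_hom_tensor_assoc unfolding algebra_hom_def by blast

lemma clinear_assoc [lin]: "clinear f \<Longrightarrow> clinear (\<lambda>x. tensor_assoc (f x))"
  by (rule clinear_compose[OF clinear_tensor_assoc])

lemma mult_assoc_times: "mult_assoc (m * n) = mult_assoc m * mult_assoc n"
  by (rule mult_assoc_eqI) (simp_all add: mult_assoc_act act_simps)

lemma clinear_mult_assoc [lin]: "clinear f \<Longrightarrow> clinear (\<lambda>x. mult_assoc (f x))"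
proof -
  note l = clinear_tensor_assoc
  have "clinear mult_assoc"
    by (rule clinearI; rule mult_assoc_eqI)
      (simp_all add: mult_assoc_act lact_linear ract_linear clinear_add[OF l] clinear_cscale[OF l])
  then show "clinear f \<Longrightarrow> clinear (\<lambda>x. mult_assoc (f x))" by (rule clinear_compose)
qed

lemma mult_assoc_embed: "mult_assoc (embed z) = embed (tensor_assoc z)"
  by (rule mult_assoc_eqI) (simp_all add: mult_assoc_act act_simps tensor_assoc_times)

lemma tensor_assoc_map:
  assumes "clinear f" "clinear g" "clinear k"
  shows "tensor_assoc (tensor_map (tensor_map f g) k z) = tensor_map f (tensor_map g k) (tensor_assoc z)"
proof (rule tensor_map_eqI[where f="\<lambda>z. tensor_assoc (tensor_map (tensor_map f g) k z)"])
  show "tensor_assoc (tensor_map (tensor_map f g) k (x \<otimes> c)) =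
      tensor_map f (tensor_map g k) (tensor_assoc (x \<otimes> c))" for x c
    by (rule tensor_map_eqI[where f="\<lambda>x. tensor_assoc (tensor_map (tensor_map f g) k (x \<otimes> c))"])
      (simp_all add: assms lin tensor_map_pure tensor_assoc_pure)
qed (simp_all add: assms lin)

lemma mult_assoc_tensor_mult: "mult_assoc ((m \<otimes>\<^sub>m n) \<otimes>\<^sub>m k) = m \<otimes>\<^sub>m (n \<otimes>\<^sub>m k)"
  by (rule mult_assoc_eqI)
    (simp_all add: mult_assoc_act act_simps tensor_assoc_map lin lact_tensor_mult[abs_def]
        ract_tensor_mult[abs_def])

lemma tensor_assoc_tsum: "tensor_assoc (z \<otimes> c) = tsum z (\<lambda>a b. a \<otimes> (b \<otimes> c))"
  using linear_eq_tsum[of "\<lambda>z. tensor_assoc (z \<otimes> c)"] by (simp add: lin tensor_assoc_pure)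

section \<open>The structure maps of a weak multiplier Hopf algebra\<close>

context weak_multiplier_Hopf_algebra
begin

lemma nondegenerate2: "nondegenerate TYPE(('a, 'a) tensor)"
  by (rule nondegenerate_tensor[OF nondegenerate nondegenerate])

lemma nondegenerate3: "nondegenerate TYPE(('a, ('a, 'a) tensor) tensor)"
  by (rule nondegenerate_tensor[OF nondegenerate nondegenerate2])

lemma embed2_inject: "embed x = embed y \<longleftrightarrow> x = (y :: ('a, 'a) tensor)"
  using inj_embed[OF nondegenerate2] by (auto dest: injD)

lemma clinear_Delta [lin]: "clinear f \<Longrightarrow> clinear (\<lambda>x. \<Delta> (f x))"
  using coproduct unfolding coproduct_def algebra_hom_def by (auto intro: clinear_compose[of \<Delta>])

lemma Delta_times: "\<Delta> (a * b) = \<Delta> a * \<Delta> b"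
  using coproduct unfolding coproduct_def algebra_hom_def by blast

lemma cbilinear_T: "cbilinear (\<lambda>a b. element_of (\<Delta> a * (1 \<otimes>\<^sub>m embed b)))"
  "cbilinear (\<lambda>a b. element_of ((embed a \<otimes>\<^sub>m 1) * \<Delta> b))"
  using coproduct unfolding cbilinear_iff coproduct_def
  by (auto intro!: clinear_element_of[OF nondegenerate2] lin)

lemma clinear_T1 [lin]: "clinear f \<Longrightarrow> clinear (\<lambda>x. T1 \<Delta> (f x))"
  unfolding T1_def by (rule clinear_compose[OF clinear_tensor_lift[OF cbilinear_T(1)]])

lemma clinear_T2 [lin]: "clinear f \<Longrightarrow> clinear (\<lambda>x. T2 \<Delta> (f x))"
  unfolding T2_def by (rule clinear_compose[OF clinear_tensor_lift[OF cbilinear_T(2)]])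

lemma embed_T1: "embed (T1 \<Delta> (a \<otimes> b)) = \<Delta> a * (1 \<otimes>\<^sub>m embed b)"
  unfolding T1_def tsum_pure[OF cbilinear_T(1)]
  by (rule embed_element_of[OF nondegenerate2]) (use coproduct in \<open>auto simp: coproduct_def\<close>)

lemma embed_T2: "embed (T2 \<Delta> (a \<otimes> b)) = (embed a \<otimes>\<^sub>m 1) * \<Delta> b"
  unfolding T2_def tsum_pure[OF cbilinear_T(2)]
  by (rule embed_element_of[OF nondegenerate2]) (use coproduct in \<open>auto simp: coproduct_def\<close>)

lemma E_T1: "lact E (T1 \<Delta> z) = T1 \<Delta> z"
proof -
  obtain y where "T1 \<Delta> z = lact E y" using range_T1 by (metis rangeE rangeI)
  then show ?thesis by (simp add: lact_mult[symmetric] E_idempotent)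
qed

lemma E_T2: "ract (T2 \<Delta> z) E = T2 \<Delta> z"
proof -
  obtain y where "T2 \<Delta> z = ract y E" using range_T2 by (metis (no_types, lifting) rangeE rangeI)
  then show ?thesis by (simp add: ract_mult[symmetric] E_idempotent)
qed

text \<open>
  From $T_1(A \otimes A) = E(A \otimes A)$, as \<open>E\<close> is idempotent.
\<close>

lemma E_Delta: "E * \<Delta> a = \<Delta> a"
proof (rule right_leg_cancel[OF nondegenerate nondegenerate])
  fix c
  show "E * \<Delta> a * (1 \<otimes>\<^sub>m embed c) = \<Delta> a * (1 \<otimes>\<^sub>m embed c)"
    using arg_cong[OF E_T1[of "a \<otimes> c"], of embed] by (simp add: embed_lact embed_T1 mult.assoc)
qed

lemma Delta_E: "\<Delta> a * E = \<Delta> a"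
proof (rule left_leg_cancel[OF nondegenerate nondegenerate])
  fix c
  show "(embed c \<otimes>\<^sub>m 1) * (\<Delta> a * E) = (embed c \<otimes>\<^sub>m 1) * \<Delta> a"
    using arg_cong[OF E_T2[of "c \<otimes> a"], of embed] by (simp add: embed_ract embed_T2 mult.assoc)
qed

lemma T1_times_left: "T1 \<Delta> (tensor_map (\<lambda>x. u * x) (\<lambda>x. x) w) = lact (\<Delta> u) (T1 \<Delta> w)"
  by (rule tensor_map_eqI[where f="\<lambda>w. T1 \<Delta> (tensor_map (\<lambda>x. u * x) (\<lambda>x. x) w)"])
    (simp_all add: lin tensor_map_pure embed2_inject[symmetric] embed_T1 embed_lact Delta_times mult.assoc)

lemma T2_times_right: "T2 \<Delta> (tensor_map (\<lambda>x. x) (\<lambda>x. x * u) w) = ract (T2 \<Delta> w) (\<Delta> u)"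
  by (rule tensor_map_eqI[where f="\<lambda>w. T2 \<Delta> (tensor_map (\<lambda>x. x) (\<lambda>x. x * u) w)"])
    (simp_all add: lin tensor_map_pure embed2_inject[symmetric] embed_T2 embed_ract Delta_times mult.assoc)

lemma Delta_coassoc:
  "tsum (T1 \<Delta> (b \<otimes> c)) (\<lambda>u v. tsum (T2 \<Delta> (a \<otimes> u)) (\<lambda>p q. p \<otimes> (q \<otimes> v))) =
      tsum (T2 \<Delta> (a \<otimes> b)) (\<lambda>p q. tsum (T1 \<Delta> (q \<otimes> c)) (\<lambda>u v. p \<otimes> (u \<otimes> v)))" (is "?L = ?R")
proof (rule injD[OF inj_embed[OF nondegenerate3]])
  have D1: "cbilinear (\<lambda>a b. mult_assoc (\<Delta> a \<otimes>\<^sub>m embed b))" by (simp add: lin)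
  have D2: "cbilinear (\<lambda>a b. embed a \<otimes>\<^sub>m \<Delta> b)" by (simp add: lin)
  have "(embed a \<otimes>\<^sub>m 1 \<otimes>\<^sub>m 1) * mult_assoc (\<Delta> u \<otimes>\<^sub>m embed v) =
      embed (tensor_assoc (T2 \<Delta> (a \<otimes> u) \<otimes> v))" for u v :: 'a
    by (simp add: mult_assoc_tensor_mult[symmetric] mult_assoc_times[symmetric] tensor_mult_times
        embed_T2[symmetric] embed_pure[symmetric] mult_assoc_embed)
  then have "(embed a \<otimes>\<^sub>m 1 \<otimes>\<^sub>m 1) * Delta_id \<Delta> z =
      embed (tsum z (\<lambda>u v. tensor_assoc (T2 \<Delta> (a \<otimes> u) \<otimes> v)))" for z :: "('a, 'a) tensor"
    unfolding Delta_id_def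
    by (simp add: linear_tsum[of "\<lambda>m. (embed a \<otimes>\<^sub>m 1 \<otimes>\<^sub>m 1) * m"] linear_tsum[of embed] lin)
  moreover have "(embed p \<otimes>\<^sub>m \<Delta> q) * (1 \<otimes>\<^sub>m 1 \<otimes>\<^sub>m embed c) = embed (p \<otimes> T1 \<Delta> (q \<otimes> c))" for p q :: 'a
    by (simp add: tensor_mult_times embed_T1[symmetric] embed_pure)
  then have "id_Delta \<Delta> z * (1 \<otimes>\<^sub>m 1 \<otimes>\<^sub>m embed c) = embed (tsum z (\<lambda>p q. p \<otimes> T1 \<Delta> (q \<otimes> c)))" for z
    unfolding id_Delta_def
    by (simp add: linear_tsum[of "\<lambda>m. m * (1 \<otimes>\<^sub>m 1 \<otimes>\<^sub>m embed c)"] linear_tsum[of embed] lin)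
  moreover have "(embed a \<otimes>\<^sub>m 1 \<otimes>\<^sub>m 1) * Delta_id \<Delta> (T1 \<Delta> (b \<otimes> c)) =
        id_Delta \<Delta> (T2 \<Delta> (a \<otimes> b)) * (1 \<otimes>\<^sub>m 1 \<otimes>\<^sub>m embed c)"
    using coproduct unfolding coproduct_def by blast
  moreover have "p \<otimes> T1 \<Delta> z = tsum (T1 \<Delta> z) (\<lambda>u v. p \<otimes> (u \<otimes> v))" for p :: 'a and z :: "('a, 'a) tensor"
    by (rule linear_eq_tsum[of "\<lambda>z. p \<otimes> z"]) (intro lin)
  ultimately show "embed ?L = embed ?R"
    by (simp add: tensor_assoc_tsum)
qed

lemma lact_E12:
  fixes w :: "('a, 'a) tensor"
  shows "lact (mult_assoc (E \<otimes>\<^sub>m 1)) (a \<otimes> w) = tsum w (\<lambda>p q. tsum (lact E (a \<otimes> p)) (\<lambda>r s. r \<otimes> (s \<otimes> q)))"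
proof -
  have "lact (mult_assoc (E \<otimes>\<^sub>m 1)) (a \<otimes> (p \<otimes> q)) = tensor_assoc (lact E (a \<otimes> p) \<otimes> q)" for p q :: 'a
    unfolding tensor_assoc_pure[symmetric] mult_assoc_act
    by (simp add: act_simps tensor_map_pure lin)
  then show ?thesis
    using linear_eq_tsum[of "\<lambda>w. lact (mult_assoc (E \<otimes>\<^sub>m 1)) (a \<otimes> w)" w]
    by (simp add: lin tensor_assoc_tsum)
qed

lemma ract_E12:
  fixes w :: "('a, 'a) tensor"
  shows "ract (a \<otimes> w) (mult_assoc (E \<otimes>\<^sub>m 1)) = tsum w (\<lambda>p q. tsum (ract (a \<otimes> p) E) (\<lambda>r s. r \<otimes> (s \<otimes> q)))"
proof -
  have "ract (a \<otimes> (p \<otimes> q)) (mult_assoc (E \<otimes>\<^sub>m 1)) = tensor_assoc (ract (a \<otimes> p) E \<otimes> q)" for p q :: 'a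
    unfolding tensor_assoc_pure[symmetric] mult_assoc_act
    by (simp add: act_simps tensor_map_pure lin)
  then show ?thesis
    using linear_eq_tsum[of "\<lambda>w. ract (a \<otimes> w) (mult_assoc (E \<otimes>\<^sub>m 1))" w]
    by (simp add: lin tensor_assoc_tsum)
qed

lemma E_legs_commute: "mult_assoc (E \<otimes>\<^sub>m 1) * (1 \<otimes>\<^sub>m E) = (1 \<otimes>\<^sub>m E) * mult_assoc (E \<otimes>\<^sub>m 1)"
  using id_Delta_E1 id_Delta_E2 by simp

lemma E_commute:
  "tsum (lact E (a \<otimes> b)) (\<lambda>p q. tsum (lact E (q \<otimes> c)) (\<lambda>r s. p \<otimes> (r \<otimes> s))) =
      tsum (lact E (b \<otimes> c)) (\<lambda>p q. tsum (lact E (a \<otimes> p)) (\<lambda>r s. r \<otimes> (s \<otimes> q)))"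
  "tsum (ract (a \<otimes> b) E) (\<lambda>p q. tsum (ract (q \<otimes> c) E) (\<lambda>r s. p \<otimes> (r \<otimes> s))) =
      tsum (ract (b \<otimes> c) E) (\<lambda>p q. tsum (ract (a \<otimes> p) E) (\<lambda>r s. r \<otimes> (s \<otimes> q)))"
proof -
  have p: "tsum z (\<lambda>r s. p \<otimes> (r \<otimes> s)) = p \<otimes> z" for p :: 'a and z :: "('a, 'a) tensor"
    by (rule linear_eq_tsum[of "\<lambda>z. p \<otimes> z", symmetric]) (intro lin)
  have l: "lact (1 \<otimes>\<^sub>m E) (tsum z h) = tsum z (\<lambda>u v. lact (1 \<otimes>\<^sub>m E) (h u v))"
    "ract (tsum z h) (1 \<otimes>\<^sub>m E) = tsum z (\<lambda>u v. ract (h u v) (1 \<otimes>\<^sub>m E))"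
    for z :: "('a, 'a) tensor" and h :: "'a \<Rightarrow> 'a \<Rightarrow> ('a, ('a, 'a) tensor) tensor"
    by (rule linear_tsum[of "\<lambda>z. lact (1 \<otimes>\<^sub>m E) z"] linear_tsum[of "\<lambda>z. ract z (1 \<otimes>\<^sub>m E)"]; intro lin)+
  have one: "lact (1 \<otimes>\<^sub>m E) (a \<otimes> z) = a \<otimes> lact E z" "ract (a \<otimes> z) (1 \<otimes>\<^sub>m E) = a \<otimes> ract z E" for a :: 'a and z
    by (simp_all add: act_simps tensor_map_pure lin)
  have "lact (mult_assoc (E \<otimes>\<^sub>m 1)) (lact (1 \<otimes>\<^sub>m E) (a \<otimes> (b \<otimes> c))) =
      lact (1 \<otimes>\<^sub>m E) (lact (mult_assoc (E \<otimes>\<^sub>m 1)) (a \<otimes> (b \<otimes> c)))"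
    unfolding lact_mult[symmetric] E_legs_commute ..
  then show "tsum (lact E (a \<otimes> b)) (\<lambda>p q. tsum (lact E (q \<otimes> c)) (\<lambda>r s. p \<otimes> (r \<otimes> s))) =
      tsum (lact E (b \<otimes> c)) (\<lambda>p q. tsum (lact E (a \<otimes> p)) (\<lambda>r s. r \<otimes> (s \<otimes> q)))"
    unfolding p one lact_E12 by (simp add: tsum_pure lin l one)
  have "ract (ract (a \<otimes> (b \<otimes> c)) (mult_assoc (E \<otimes>\<^sub>m 1))) (1 \<otimes>\<^sub>m E) =
      ract (ract (a \<otimes> (b \<otimes> c)) (1 \<otimes>\<^sub>m E)) (mult_assoc (E \<otimes>\<^sub>m 1))"
    unfolding ract_mult[symmetric] E_legs_commute ..
  then show "tsum (ract (a \<otimes> b) E) (\<lambda>p q. tsum (ract (q \<otimes> c) E) (\<lambda>r s. p \<otimes> (r \<otimes> s))) =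
      tsum (ract (b \<otimes> c) E) (\<lambda>p q. tsum (ract (a \<otimes> p) E) (\<lambda>r s. r \<otimes> (s \<otimes> q)))"
    unfolding p one ract_E12 by (simp add: tsum_pure lin l one)
qed

end

context regular_weak_multiplier_Hopf_algebra
begin

definition antipode where "antipode a = element_of (S a)"

lemma embed_antipode: "embed (antipode a) = S a"
  unfolding antipode_def using antipode_bij by (intro embed_element_of[OF nondegenerate]) (auto
      simp: bij_betw_def)

lemma lact_S: "lact (S a) b = antipode a * b" and ract_S: "ract b (S a) = b * antipode a"
  by (simp_all add: embed_antipode[symmetric] lact_embed ract_embed)

lemma linear_antipode: "clinear antipode"
  unfolding antipode_def[abs_def]
  by (rule clinear_element_of[OF nondegenerate])
    (use antipode_antihom antipode_bij in \<open>auto simp: algebra_antihom_def bij_betw_def\<close>)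

lemma clinear_antipode [lin]: "clinear f \<Longrightarrow> clinear (\<lambda>x. antipode (f x))"
  by (rule clinear_compose[OF linear_antipode])

text \<open>
  The antipode takes values in \<open>A\<close> because the algebra is regular, so the Sweedler formulas can
  be read in \<open>A\<close>.
\<close>

lemma elementwise_core: "weak_hopf_core_antipode (*) (T1 \<Delta>) (T2 \<Delta>) (lact E) (\<lambda>z. ract z E) antipode"
\<comment> \<open>The cases follow the order of the assumptions of the locales.\<close>
proof (intro weak_hopf_core_antipode.intro weak_hopf_core.intro weak_hopf_core_antipode_axioms.intro,
    goal_cases)
  case 1 show ?case by (simp add: lin)
next
  case (2 a b c) show ?case by (simp add: mult.assoc)
next
  case (3 a) then show ?case using nondegenerate unfolding nondegenerate_def by blast
next
  case (4 a) then show ?case using nondegenerate unfolding nondegenerate_def by blast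
next
  case 5 show ?case using idempotent unfolding idempotent_algebra_def .
next
  case 6 show ?case by (simp add: lin)
next
  case 7 show ?case by (simp add: lin)
next
  case 8 show ?case by (simp add: lin)
next
  case 9 show ?case by (simp add: lin)
next
  case 10 show ?case by (rule linear_antipode)
next
  case 11
  have "bij_betw (\<lambda>a. embed (antipode a)) UNIV (range embed)" unfolding embed_antipode by (rule antipode_bij)
  then have inj: "inj (\<lambda>a. embed (antipode a))" and surj: "range (\<lambda>a. embed (antipode a)) = range embed"
    unfolding bij_betw_def by blast+
  show ?case
  proof (rule bijI)
    show "inj antipode" using inj by (auto simp: inj_def)
    have "\<exists>a. y = antipode a" for y
    proof -
      have "embed y \<in> range (\<lambda>a. embed (antipode a))" unfolding surj by (rule rangeI)
      then obtain a where "embed y = embed (antipode a)" by blast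
      then show ?thesis using injD[OF inj_embed[OF nondegenerate]] by blast
    qed
    then show "surj antipode" unfolding surj_def by blast
  qed
next
  case (12 a b)
  have "embed (antipode (a * b)) = embed (antipode b * antipode a)"
    using antipode_antihom by (simp add: embed_antipode embed_times algebra_antihom_def)
  then show ?case using inj_embed[OF nondegenerate] by (simp add: injD)
next
  case (13 c a b) show ?case
    by (simp add: embed2_inject[symmetric] embed_legs embed_T1 embed_T2 mult.assoc)
next
  case (14 b c a) show ?case by (rule Delta_coassoc)
next
  case (15 c d a b) show ?case
    by (simp add: embed2_inject[symmetric] embed_both_legs embed_lact embed_ract embed_pure mult.assoc)
next
  case 16 show ?case by (simp add: lact_mult[symmetric] E_idempotent)
next
  case 17 show ?case by (simp add: ract_mult[symmetric] E_idempotent)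
next
  case 18 show ?case by (rule range_T1)
next
  case 19 show ?case by (rule range_T2)
next
  case (20 w a b u)
  have "(1 \<otimes>\<^sub>m embed b) * (embed a \<otimes>\<^sub>m 1) = embed a \<otimes>\<^sub>m embed b"
    by (simp add: tensor_mult_times)
  then show ?case
    unfolding T1_times_left 20 lact_mult[symmetric] Delta_E
    by (simp add: embed2_inject[symmetric] embed_legs embed_lact embed_T1 embed_pure mult.assoc)
next
  case (21 w c d u)
  have "(1 \<otimes>\<^sub>m embed d) * (embed c \<otimes>\<^sub>m 1) = embed c \<otimes>\<^sub>m embed d"
    by (simp add: tensor_mult_times)
  then show ?case
    unfolding T2_times_right 21 ract_mult[symmetric] E_Delta
    by (simp add: embed2_inject[symmetric] embed_legs embed_ract embed_T2 embed_pure mult.assoc[symmetric])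
next
  case (22 c d a b) show ?case
    using antipode_E_left[of c d a b] by (simp add: lact_S times_pure_left pure_tsum_right)
next
  case (23 c d a b) show ?case
    using antipode_E_right[of a b c d] by (simp add: ract_S times_pure_right pure_tsum_left)
next
  case (24 w)
  have "tensor_map (\<lambda>x. c * x) (\<lambda>x. x) (G1 w) =
      tsum (T1 \<Delta> w) (\<lambda>u v. tsum (T2 \<Delta> (c \<otimes> u)) (\<lambda>p q. p \<otimes> (antipode q * v)))" for c
    by (rule tensor_map_eqI[where f="\<lambda>w. tensor_map (\<lambda>x. c * x) (\<lambda>x. x) (G1 w)"])
      (use antipode_G1[of c] in \<open>simp_all add: lin clinear_compose[OF G1_linear] G1_linear lact_S act_simps\<close>)
  then show ?case by blast
next
  case (25 w)
  have "tensor_map (\<lambda>x. x) (\<lambda>x. x * c) (G2 w) =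
      tsum (T2 \<Delta> w) (\<lambda>u v. tsum (T1 \<Delta> (v \<otimes> c)) (\<lambda>p q. (u * antipode p) \<otimes> q))" for c
    by (rule tensor_map_eqI[where f="\<lambda>w. tensor_map (\<lambda>x. x) (\<lambda>x. x * c) (G2 w)"])
      (use antipode_G2[of _ _ c] in \<open>simp_all add: lin clinear_compose[OF G2_linear] G2_linear ract_S
          act_simps\<close>)
  then show ?case by blast
next
  case (26 a b c) show ?case by (rule E_commute)
next
  case (27 a b c) show ?case by (rule E_commute)
next
  case (28 a b) show ?case using antipode_S[of a b] by (simp add: lact_S)
qed

end

section \<open>Slices and the extension of the coproduct\<close>

text \<open>
  The two actions prescribed for the slice are compatible, since both compute the slice of $(a \otimes 1)X(b
  \otimes 1)$; so the multiplier exists.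
\<close>

lemma mult_slice_right_act:
  fixes X :: "('a::complex_algebra, 'b::complex_algebra) tensor multiplier"
  assumes nd: "nondegenerate TYPE('a)" "nondegenerate TYPE('b)" and f: "clinear f"
    and X: "\<And>b. X * (embed b \<otimes>\<^sub>m 1) \<in> range embed" "\<And>b. (embed b \<otimes>\<^sub>m 1) * X \<in> range embed"
  shows "ract b (mult_slice_right f X) = slice_right f (element_of ((embed b \<otimes>\<^sub>m 1) * X))"
proof -
  note nd2 = nondegenerate_tensor[OF nd]
  define L where "L b = slice_right f (element_of (X * (embed b \<otimes>\<^sub>m 1)))" for b
  define R where "R b = slice_right f (element_of ((embed b \<otimes>\<^sub>m 1) * X))" for b
  note inj = injD[OF inj_embed[OF nd2]] and eX = X[THEN embed_element_of[OF nd2]]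
  have "clinear L" unfolding L_def[abs_def] by (intro lin f clinear_element_of[OF nd2] X)
  moreover have "clinear R" unfolding R_def[abs_def] by (intro lin f clinear_element_of[OF nd2] X)
  moreover have "L (a * b) = L a * b" for a b
  proof -
    have "element_of (X * (embed (a * b) \<otimes>\<^sub>m 1)) = tensor_map (\<lambda>x. x * b) (\<lambda>x.
        x) (element_of (X * (embed a \<otimes>\<^sub>m 1)))"
      by (rule inj) (unfold embed_legs eX, simp add: embed_times mult.assoc tensor_mult_times)
    then show ?thesis by (simp add: L_def slice_right_tmap f lin)
  qed
  moreover have "R (a * b) = a * R b" for a b
  proof -
    have "element_of ((embed (a * b) \<otimes>\<^sub>m 1) * X) = tensor_map (\<lambda>x. a * x) (\<lambda>x.
        x) (element_of ((embed b \<otimes>\<^sub>m 1) * X))"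
      by (rule inj) (unfold embed_legs eX, simp add: embed_times mult.assoc[symmetric] tensor_mult_times)
    then show ?thesis by (simp add: R_def slice_right_tmap f lin)
  qed
  moreover have "a * L b = R a * b" for a b
  proof -
    have "tensor_map (\<lambda>x. a * x) (\<lambda>x. x) (element_of (X * (embed b \<otimes>\<^sub>m 1))) =
        tensor_map (\<lambda>x. x * b) (\<lambda>x. x) (element_of ((embed a \<otimes>\<^sub>m 1) * X))"
      by (rule inj) (simp add: embed_legs eX mult.assoc)
    from arg_cong[OF this, of "slice_right f"] show ?thesis
      by (simp add: L_def R_def slice_right_tmap f lin)
  qed
  ultimately have "(L, R) \<in> {(L, R). clinear L \<and> clinear R \<and> (\<forall>a b. L (a * b) = L a * b) \<and>
      (\<forall>a b. R (a * b) = a * R b) \<and> (\<forall>a b. a * L b = R a * b)}" by blast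
  then have m: "lact (Abs_multiplier (L, R)) b = L b" "ract b (Abs_multiplier (L, R)) = R b" for b
    by (simp_all add: lact.rep_eq ract.rep_eq Abs_multiplier_inverse)
  have "mult_slice_right f X = Abs_multiplier (L, R)"
    unfolding mult_slice_right_def L_def[symmetric] R_def[symmetric]
    by (rule the_equality) (auto simp: m intro: multiplier_eqI)
  then show ?thesis by (simp add: m R_def)
qed

lemma mult_slice_left_act:
  fixes X :: "('a::complex_algebra, 'b::complex_algebra) tensor multiplier"
  assumes nd: "nondegenerate TYPE('a)" "nondegenerate TYPE('b)" and f: "clinear f"
    and X: "\<And>b. X * (1 \<otimes>\<^sub>m embed b) \<in> range embed" "\<And>b. (1 \<otimes>\<^sub>m embed b) * X \<in> range embed"
  shows "lact (mult_slice_left f X) b = slice_left f (element_of (X * (1 \<otimes>\<^sub>m embed b)))"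
proof -
  note nd2 = nondegenerate_tensor[OF nd]
  define L where "L b = slice_left f (element_of (X * (1 \<otimes>\<^sub>m embed b)))" for b
  define R where "R b = slice_left f (element_of ((1 \<otimes>\<^sub>m embed b) * X))" for b
  note inj = injD[OF inj_embed[OF nd2]] and eX = X[THEN embed_element_of[OF nd2]]
  have "clinear L" unfolding L_def[abs_def] by (intro lin f clinear_element_of[OF nd2] X)
  moreover have "clinear R" unfolding R_def[abs_def] by (intro lin f clinear_element_of[OF nd2] X)
  moreover have "L (a * b) = L a * b" for a b
  proof -
    have "element_of (X * (1 \<otimes>\<^sub>m embed (a * b))) = tensor_map (\<lambda>x. x) (\<lambda>x.
        x * b) (element_of (X * (1 \<otimes>\<^sub>m embed a)))"
      by (rule inj) (unfold embed_legs eX, simp add: embed_times mult.assoc tensor_mult_times)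
    then show ?thesis by (simp add: L_def slice_left_tmap f lin)
  qed
  moreover have "R (a * b) = a * R b" for a b
  proof -
    have "element_of ((1 \<otimes>\<^sub>m embed (a * b)) * X) = tensor_map (\<lambda>x. x) (\<lambda>x.
        a * x) (element_of ((1 \<otimes>\<^sub>m embed b) * X))"
      by (rule inj) (unfold embed_legs eX, simp add: embed_times mult.assoc[symmetric] tensor_mult_times)
    then show ?thesis by (simp add: R_def slice_left_tmap f lin)
  qed
  moreover have "a * L b = R a * b" for a b
  proof -
    have "tensor_map (\<lambda>x. x) (\<lambda>x. a * x) (element_of (X * (1 \<otimes>\<^sub>m embed b))) =
        tensor_map (\<lambda>x. x) (\<lambda>x. x * b) (element_of ((1 \<otimes>\<^sub>m embed a) * X))"
      by (rule inj) (simp add: embed_legs eX mult.assoc)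
    from arg_cong[OF this, of "slice_left f"] show ?thesis
      by (simp add: L_def R_def slice_left_tmap f lin)
  qed
  ultimately have "(L, R) \<in> {(L, R). clinear L \<and> clinear R \<and> (\<forall>a b. L (a * b) = L a * b) \<and>
      (\<forall>a b. R (a * b) = a * R b) \<and> (\<forall>a b. a * L b = R a * b)}" by blast
  then have m: "lact (Abs_multiplier (L, R)) b = L b" "ract b (Abs_multiplier (L, R)) = R b" for b
    by (simp_all add: lact.rep_eq ract.rep_eq Abs_multiplier_inverse)
  have "mult_slice_left f X = Abs_multiplier (L, R)"
    unfolding mult_slice_left_def L_def[symmetric] R_def[symmetric]
    by (rule the_equality) (auto simp: m intro: multiplier_eqI)
  then show ?thesis by (simp add: m L_def)
qed

context weak_multiplier_Hopf_algebra
begin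

lemma T1_lact: "T1 \<Delta> (tensor_map (\<lambda>x. u * x) (\<lambda>x. x) (tensor_map (lact m) (\<lambda>x. x) w)) =
    lact (\<Delta> (ract u m)) (T1 \<Delta> w)"
  by (simp add: T1_times_left[symmetric] tmap_tmap lin times_lact)

lemma T2_ract: "T2 \<Delta> (tensor_map (\<lambda>x. x) (\<lambda>x. x * u) (tensor_map (\<lambda>x. x) (\<lambda>x. ract x m) w)) =
    ract (T2 \<Delta> w) (\<Delta> (lact m u))"
  by (simp add: T2_times_right[symmetric] tmap_tmap lin times_lact)

lemma T2_times: "T2 \<Delta> (a \<otimes> b) * u = tensor_map (\<lambda>x. a * x) (\<lambda>x. x) (lact (\<Delta> b) u)"
  by (simp add: embed2_inject[symmetric] embed_times embed_T2 embed_legs embed_lact mult.assoc)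

lemma ract_E_Delta: "ract x E * u = 0" if "\<And>p. lact (\<Delta> p) u = 0"
proof -
  obtain y where y: "ract x E = T2 \<Delta> y" using range_T2 by (metis rangeE rangeI)
  have "T2 \<Delta> y * u = 0"
  proof (rule tensor_map_eqI[where f="\<lambda>y. T2 \<Delta> y * u" and g="\<lambda>_. 0"])
    fix a b
    show "T2 \<Delta> (a \<otimes> b) * u = 0"
      by (simp add: T2_times that clinear_zero[OF clinear_tensor_map] lin)
  qed (simp_all add: lin)
  then show ?thesis by (simp add: y)
qed

text \<open>
  As $(A \otimes A)E$ is spanned by the elements $(a \otimes 1)\Delta(p)$, an element $u = Eu$ annihilated
  by all $\Delta(p)$ from the left satisfies $zu = (zE)u = 0$ for all \<open>z\<close>, hence $u = 0$.
\<close>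

lemma E_fixed_eqI:
  assumes "lact E u = u" "lact E v = v" "\<And>p. lact (\<Delta> p) u = lact (\<Delta> p) v"
  shows "u = v"
proof -
  have "x * (u - v) = 0" for x
  proof -
    have "x * (u - v) = x * lact E (u - v)"
      using assms(1,2) clinear_minus_eq[OF clinear_lact, of E u v] by simp
    also have "\<dots> = ract x E * (u - v)" by (rule times_lact)
    also have "\<dots> = 0"
      by (rule ract_E_Delta) (simp add: clinear_minus_eq[OF clinear_lact] assms(3))
    finally show ?thesis .
  qed
  then have "u - v = 0" using nondegenerate2 unfolding nondegenerate_def by blast
  then show ?thesis by simp
qed

text \<open>
  The extension is defined by $\Delta(m)z = \sum \Delta(mx)(1 \otimes y)$ for $Ez = \sum \Delta(x)(1 \otimes
  y)$ and by $z\Delta(m) = \sum (x \otimes 1)\Delta(ym)$ for $zE = \sum (x \otimes 1)\Delta(y)$. The first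
  action is characterized by $E\,\Delta(m)z = \Delta(m)z$ and $\Delta(p)\,\Delta(m)z = \Delta(pm)z$, so its
  linearity and multiplicativity in \<open>m\<close> follow by \<open>E_fixed_eqI\<close>.
\<close>

lemma Delta_extension_exists:
  "\<exists>\<Phi>. algebra_hom \<Phi> \<and> (\<forall>a. \<Phi> (embed a) = \<Delta> a) \<and> \<Phi> 1 = E"
proof -
  note vsp = vector_space_pair.intro[OF cvec.vector_space_axioms cvec.vector_space_axioms]
  have "clinear (T1 \<Delta>)" "clinear (T2 \<Delta>)" by (intro lin)+
  \<comment> \<open>Linear right inverses, so that the representations of \<open>Ez\<close> and \<open>zE\<close> depend linearly on \<open>z\<close>.\<close>
  then obtain \<kappa>1 \<kappa>2 where \<kappa>: "clinear \<kappa>1" "\<And>z. T1 \<Delta> (\<kappa>1 (T1 \<Delta> z)) = T1 \<Delta> z"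
      "clinear \<kappa>2" "\<And>z. T2 \<Delta> (\<kappa>2 (T2 \<Delta> z)) = T2 \<Delta> z"
    using vector_space_pair.linear_exists_right_inverse_on[OF vsp, of "T1 \<Delta>" UNIV]
      vector_space_pair.linear_exists_right_inverse_on[OF vsp, of "T2 \<Delta>" UNIV] by auto
  have \<kappa>E: "T1 \<Delta> (\<kappa>1 (lact E z)) = lact E z" "T2 \<Delta> (\<kappa>2 (ract z E)) = ract z E" for z
  proof -
    obtain x y where "lact E z = T1 \<Delta> x" "ract z E = T2 \<Delta> y" using range_T1 range_T2 by (metis rangeE rangeI)
    then show "T1 \<Delta> (\<kappa>1 (lact E z)) = lact E z" "T2 \<Delta> (\<kappa>2 (ract z E)) = ract z E" by (simp_all add: \<kappa>)
  qed
  define L where "L m z = T1 \<Delta> (tensor_map (lact m) (\<lambda>x. x) (\<kappa>1 (lact E z)))" for m z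
  define R where "R m z = T2 \<Delta> (tensor_map (\<lambda>x. x) (\<lambda>x. ract x m) (\<kappa>2 (ract z E)))" for m z
  have E_L: "lact E (L m z) = L m z" for m z unfolding L_def by (rule E_T1)
  have Delta_L: "lact (\<Delta> p) (L m z) = lact (\<Delta> (ract p m)) z" for p m z
    unfolding L_def T1_times_left[symmetric] T1_lact \<kappa>E lact_mult[symmetric] Delta_E ..
  have lin_L: "clinear (L m)" for m
    unfolding L_def[abs_def] by (intro lin clinear_compose[OF \<kappa>(1)] clinear_lact)
  have lin_R: "clinear (R m)" for m
    unfolding R_def[abs_def] by (intro lin clinear_compose[OF \<kappa>(3)] clinear_ract)
  have R_Delta: "ract (R m z) (\<Delta> p) = ract z (\<Delta> (lact m p))" for p m z
    unfolding R_def T2_times_right[symmetric] T2_ract \<kappa>E ract_mult[symmetric] E_Delta ..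
  have LL: "L m (z * y) = L m z * y" for m z y
    by (rule E_fixed_eqI) (simp_all add: E_L Delta_L lact_times)
  have LR: "x * L m y = R m x * y" for m x y
  proof -
    obtain v where v: "ract x E = T2 \<Delta> v" using range_T2 by (metis rangeE rangeI)
    have "R m x = T2 \<Delta> (tensor_map (\<lambda>x. x) (\<lambda>x. ract x m) (\<kappa>2 (ract x E)))" by (simp add: R_def)
    have T: "T2 \<Delta> w * L m y = T2 \<Delta> (tensor_map (\<lambda>x. x) (\<lambda>x. ract x m) w) * y" for w
    proof (rule tensor_map_eqI[where f="\<lambda>w. T2 \<Delta> w * L m y"])
      fix a b
      show "T2 \<Delta> (a \<otimes> b) * L m y = T2 \<Delta> (tensor_map (\<lambda>x. x) (\<lambda>x. ract x m) (a \<otimes> b)) * y"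
        by (simp add: tensor_map_pure lin T2_times Delta_L)
    qed (simp_all add: lin)
    have "x * L m y = x * lact E (L m y)" by (simp add: E_L)
    also have "\<dots> = ract x E * L m y" by (rule times_lact)
    also have "\<dots> = T2 \<Delta> (\<kappa>2 (ract x E)) * L m y" by (simp add: \<kappa>E)
    also have "\<dots> = R m x * y" unfolding T R_def ..
    finally show ?thesis .
  qed
  have RR: "R m (x * y) = x * R m y" for m x y
  proof -
    have "(R m (x * y) - x * R m y) * z = 0" for z
      by (simp add: left_diff_distrib LR[symmetric] mult.assoc)
    then have "R m (x * y) - x * R m y = 0" using nondegenerate2 unfolding nondegenerate_def by blast
    then show ?thesis by simp
  qed
  define \<Phi> where "\<Phi> m = Abs_multiplier (L m, R m)" for m
  have "(L m, R m) \<in> {(L, R). clinear L \<and> clinear R \<and> (\<forall>a b. L (a * b) = L a * b) \<and>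
      (\<forall>a b. R (a * b) = a * R b) \<and> (\<forall>a b. a * L b = R a * b)}" for m
    using lin_L lin_R LL RR LR by blast
  then have \<Phi>: "lact (\<Phi> m) z = L m z" for m z
    by (simp add: \<Phi>_def lact.rep_eq Abs_multiplier_inverse)
  have lact_E: "lact E (x + y) = lact E x + lact E y" "lact E (c *\<^sub>c x) = c *\<^sub>c lact E x"
    "lact (\<Delta> p) (x + y) = lact (\<Delta> p) x + lact (\<Delta> p) y" "lact (\<Delta> p) (c *\<^sub>c x) = c *\<^sub>c lact (\<Delta> p) x"
    for x y c p by (simp_all add: clinear_add[OF clinear_lact] clinear_cscale[OF clinear_lact])
  note D = clinear_add[OF clinear_Delta[OF clinear_ident(1)]] clinear_cscale[OF clinear_Delta[OF
      clinear_ident(1)]]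
  have "clinear \<Phi>"
    by (rule clinearI; rule multiplier_eq_lact[OF nondegenerate2])
      (simp_all add: \<Phi> lact_linear, (rule E_fixed_eqI; simp add: E_L Delta_L lact_E ract_linear D lact_linear)+)
  moreover have "\<Phi> (m * n) = \<Phi> m * \<Phi> n" for m n
    by (rule multiplier_eq_lact[OF nondegenerate2])
      (simp add: \<Phi> lact_mult, rule E_fixed_eqI, simp_all add: E_L Delta_L ract_mult)
  moreover have "\<Phi> (embed a) = \<Delta> a" for a
    by (rule multiplier_eq_lact[OF nondegenerate2])
      (simp add: \<Phi>, rule E_fixed_eqI, simp_all add: E_L Delta_L ract_embed Delta_times lact_mult[symmetric]
          E_Delta)
  moreover have "\<Phi> 1 = E"
    by (rule multiplier_eq_lact[OF nondegenerate2])
      (simp add: \<Phi>, rule E_fixed_eqI, simp_all add: E_L Delta_L ract_one lact_mult[symmetric] Delta_E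
          E_idempotent)
  ultimately show ?thesis unfolding algebra_hom_def by blast
qed

lemma Delta_ext_props:
  "algebra_hom (Delta_ext \<Delta> E)" "Delta_ext \<Delta> E (embed a) = \<Delta> a" "Delta_ext \<Delta> E 1 = E"
proof -
  let ?P = "\<lambda>\<Phi>. algebra_hom \<Phi> \<and> (\<forall>a. \<Phi> (embed a) = \<Delta> a) \<and> \<Phi> 1 = E"
  have unique: "\<Phi> = \<Psi>" if "?P \<Phi>" "?P \<Psi>" for \<Phi> \<Psi>
  proof
    fix m
    have E: "lact E (lact (\<Theta> m) z) = lact (\<Theta> m) z" and D: "lact (\<Delta> p) (lact (\<Theta> m) z) = lact (\<Delta> (ract p m)) z"
      if "?P \<Theta>" for \<Theta> z p
    proof -
      have t: "\<Theta> (x * y) = \<Theta> x * \<Theta> y" for x y using that unfolding algebra_hom_def by blast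
      show "lact E (lact (\<Theta> m) z) = lact (\<Theta> m) z" using t[of 1 m] that by (simp add: lact_mult[symmetric])
      show "lact (\<Delta> p) (lact (\<Theta> m) z) = lact (\<Delta> (ract p m)) z"
        using t[of "embed p" m] that by (metis embed_ract lact_mult)
    qed
    show "\<Phi> m = \<Psi> m"
      by (rule multiplier_eq_lact[OF nondegenerate2], rule E_fixed_eqI) (simp_all only: E[OF that(1)] E[OF
          that(2)] D[OF that(1)] D[OF that(2)])
  qed
  have "\<exists>!\<Phi>. ?P \<Phi>" using Delta_extension_exists unique by (rule ex_ex1I)
  from theI'[OF this] have "?P (Delta_ext \<Delta> E)"
    unfolding Delta_ext_def mult_extension_def .
  then show "algebra_hom (Delta_ext \<Delta> E)" "Delta_ext \<Delta> E (embed a) = \<Delta> a" "Delta_ext \<Delta> E 1 = E" by blast+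
qed

lemma Delta_ext_times: "Delta_ext \<Delta> E (m * n) = Delta_ext \<Delta> E m * Delta_ext \<Delta> E n"
  using Delta_ext_props(1) unfolding algebra_hom_def by blast

lemma ract_Delta_ext:
  assumes "T2 \<Delta> w = ract z E"
  shows "ract z (Delta_ext \<Delta> E m) = T2 \<Delta> (tensor_map (\<lambda>x. x) (\<lambda>x. ract x m) w)"
proof -
  have T: "ract (T2 \<Delta> w) (Delta_ext \<Delta> E m) = T2 \<Delta> (tensor_map (\<lambda>x. x) (\<lambda>x. ract x m) w)" for w
  proof (rule tensor_map_eqI[where f="\<lambda>w. ract (T2 \<Delta> w) (Delta_ext \<Delta> E m)"])
    fix a b
    have "\<Delta> b * Delta_ext \<Delta> E m = \<Delta> (ract b m)"
      using Delta_ext_times[of "embed b" m] by (simp only: Delta_ext_props(2) embed_ract[symmetric])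
    then show "ract (T2 \<Delta> (a \<otimes> b)) (Delta_ext \<Delta> E m) = T2 \<Delta> (tensor_map (\<lambda>x. x) (\<lambda>x. ract x m) (a \<otimes> b))"
      by (simp add: embed2_inject[symmetric] embed_ract embed_T2 mult.assoc tensor_map_pure lin)
  qed (simp_all add: lin)
  have "ract z (Delta_ext \<Delta> E m) = ract (ract z E) (Delta_ext \<Delta> E m)"
    using Delta_ext_times[of 1 m] by (simp add: Delta_ext_props(3) ract_mult[symmetric])
  then show ?thesis by (simp add: assms[symmetric] T)
qed

lemma lact_Delta_ext:
  assumes "T1 \<Delta> w = lact E z"
  shows "lact (Delta_ext \<Delta> E m) z = T1 \<Delta> (tensor_map (lact m) (\<lambda>x. x) w)"
proof -
  have T: "lact (Delta_ext \<Delta> E m) (T1 \<Delta> w) = T1 \<Delta> (tensor_map (lact m) (\<lambda>x. x) w)" for w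
  proof (rule tensor_map_eqI[where f="\<lambda>w. lact (Delta_ext \<Delta> E m) (T1 \<Delta> w)"])
    fix a b
    have "Delta_ext \<Delta> E m * \<Delta> a = \<Delta> (lact m a)"
      using Delta_ext_times[of m "embed a"] by (simp only: Delta_ext_props(2) embed_lact[symmetric])
    then show "lact (Delta_ext \<Delta> E m) (T1 \<Delta> (a \<otimes> b)) = T1 \<Delta> (tensor_map (lact m) (\<lambda>x. x) (a \<otimes> b))"
      by (simp add: embed2_inject[symmetric] embed_lact embed_T1 mult.assoc[symmetric] tensor_map_pure
          clinear_lact lin)
  qed (simp_all add: lin clinear_lact)
  have "lact (Delta_ext \<Delta> E m) z = lact (Delta_ext \<Delta> E m) (lact E z)"
    using Delta_ext_times[of m 1] by (simp add: Delta_ext_props(3) lact_mult[symmetric])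
  then show ?thesis by (simp add: assms[symmetric] T)
qed

end

section \<open>Integrals\<close>

context regular_weak_multiplier_Hopf_algebra
begin

interpretation core: weak_hopf_core_antipode "(*)" "T1 \<Delta>" "T2 \<Delta>" "lact E" "\<lambda>z. ract z E" antipode
  by (rule elementwise_core)

lemma Delta_coverings:
  "\<Delta> a * (1 \<otimes>\<^sub>m embed b) \<in> range embed" "(embed b \<otimes>\<^sub>m 1) * \<Delta> a \<in> range embed"
  "\<Delta> a * (embed b \<otimes>\<^sub>m 1) \<in> range embed" "(1 \<otimes>\<^sub>m embed b) * \<Delta> a \<in> range embed"
proof -
  show "\<Delta> a * (1 \<otimes>\<^sub>m embed b) \<in> range embed" unfolding embed_T1[symmetric] by (rule rangeI)
  show "(embed b \<otimes>\<^sub>m 1) * \<Delta> a \<in> range embed" unfolding embed_T2[symmetric] by (rule rangeI)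
  have "embed (core.right_cover a b) = \<Delta> a * (embed b \<otimes>\<^sub>m 1)"
  proof (rule left_leg_cancel[OF nondegenerate nondegenerate])
    fix c
    show "(embed c \<otimes>\<^sub>m 1) * embed (core.right_cover a b) = (embed c \<otimes>\<^sub>m 1) * (\<Delta> a * (embed b \<otimes>\<^sub>m 1))"
      using arg_cong[OF core.l1_right_cover[of c a b], of embed] by (simp add: embed_legs embed_T2 mult.assoc)
  qed
  then show "\<Delta> a * (embed b \<otimes>\<^sub>m 1) \<in> range embed" by (metis rangeI)
  have "embed (core.left_cover b a) = (1 \<otimes>\<^sub>m embed b) * \<Delta> a"
  proof (rule right_leg_cancel[OF nondegenerate nondegenerate])
    fix c
    show "embed (core.left_cover b a) * (1 \<otimes>\<^sub>m embed c) = (1 \<otimes>\<^sub>m embed b) * \<Delta> a * (1 \<otimes>\<^sub>m embed c)"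
      using arg_cong[OF core.r2_left_cover[of c b a], of embed] by (simp add: embed_legs embed_T1 mult.assoc)
  qed
  then show "(1 \<otimes>\<^sub>m embed b) * \<Delta> a \<in> range embed" by (metis rangeI)
qed

lemma ract_mult_slice: "clinear f \<Longrightarrow> ract b (mult_slice_right f (\<Delta> a)) = slice_right f (T2 \<Delta> (b \<otimes> a))"
  by (simp add: mult_slice_right_act[OF nondegenerate nondegenerate] Delta_coverings
      embed_T2[symmetric] element_of_embed[OF nondegenerate2])

lemma lact_mult_slice: "clinear f \<Longrightarrow> lact (mult_slice_left f (\<Delta> a)) b = slice_left f (T1 \<Delta> (a \<otimes> b))"
  by (simp add: mult_slice_left_act[OF nondegenerate nondegenerate] Delta_coverings
      embed_T1[symmetric] element_of_embed[OF nondegenerate2])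

lemma integrals_exist:
  assumes h: "h \<noteq> 0" and faithful: "faithful_cointegral \<Delta> E (embed h)"
  shows "(\<exists>\<phi>. left_integral \<Delta> E \<phi>) \<and> (\<exists>\<psi>. right_integral \<Delta> E \<psi>)"
proof -
  have fL: "f = (\<lambda>_. 0)" if "clinear f" "\<And>b. slice_left f (T1 \<Delta> (h \<otimes> b)) = 0" for f
  proof -
    have "mult_slice_left f (\<Delta> h) = 0"
      by (rule multiplier_eq_lact[OF nondegenerate]) (simp add: lact_mult_slice that lact_linear)
    then show ?thesis using faithful that(1) unfolding faithful_cointegral_def Delta_ext_props(2) by blast
  qed
  have fR: "f = (\<lambda>_. 0)" if "clinear f" "\<And>b. slice_right f (T2 \<Delta> (b \<otimes> h)) = 0" for f
  proof -
    have "mult_slice_right f (\<Delta> h) = 0"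
      by (rule multiplier_eq_ract[OF nondegenerate]) (simp add: ract_mult_slice that ract_linear)
    then show ?thesis using faithful that(1) unfolding faithful_cointegral_def Delta_ext_props(2) by blast
  qed
  have zero: "slice_left (\<lambda>_. 0) z = 0" "slice_right (\<lambda>_. 0) z = 0" for z :: "('a, 'a) tensor"
    by (simp_all add: slice_left_def slice_right_def tensor_lift_def case_prod_unfold)
  obtain \<phi> where \<phi>: "clinear \<phi>" "\<And>b. slice_right \<phi> (T2 \<Delta> (b \<otimes> h)) = b"
    "\<And>a c d w. T2 \<Delta> w = ract (c \<otimes> d) E \<Longrightarrow>
      T2 \<Delta> (tensor_map (\<lambda>x. x) (\<lambda>x. slice_right \<phi> (T2 \<Delta> (x \<otimes> a))) w) =
      ract (slice_right \<phi> (T2 \<Delta> (c \<otimes> a)) \<otimes> d) E"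
    using core.left_invariant_functional[of h, OF fL fR] by blast
  have "left_integral \<Delta> E \<phi>"
    unfolding left_integral_def
  proof (intro conjI allI)
    show "\<phi> \<noteq> (\<lambda>_. 0)" using \<phi>(2)[of h] h zero by auto
    fix a
    let ?x = "mult_slice_right \<phi> (\<Delta> a)"
    have "ract z (Delta_ext \<Delta> E ?x) = ract z ((?x \<otimes>\<^sub>m 1) * E)" for z
    proof (rule tensor_map_eqI[where f="\<lambda>z. ract z (Delta_ext \<Delta> E ?x)"])
      fix c d
      obtain w where w: "T2 \<Delta> w = ract (c \<otimes> d) E" using range_T2 by (metis rangeE rangeI)
      show "ract (c \<otimes> d) (Delta_ext \<Delta> E ?x) = ract (c \<otimes> d) ((?x \<otimes>\<^sub>m 1) * E)"
        by (simp add: ract_Delta_ext[OF w] ract_mult_slice[OF \<phi>(1)] \<phi>(3)[OF w] act_simps tensor_map_pure lin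
            \<phi>(1))
    qed (simp_all add: lin)
    then show "?x \<in> A_t \<Delta> E"
      unfolding A_t_def by (simp add: multiplier_eq_ract[OF nondegenerate2])
  qed (rule \<phi>(1))
  obtain \<psi> where \<psi>: "clinear \<psi>" "\<And>b. slice_left \<psi> (T1 \<Delta> (h \<otimes> b)) = b"
    "\<And>a c d w. T1 \<Delta> w = lact E (c \<otimes> d) \<Longrightarrow>
      T1 \<Delta> (tensor_map (\<lambda>x. slice_left \<psi> (T1 \<Delta> (a \<otimes> x))) (\<lambda>x. x) w) =
      lact E (c \<otimes> slice_left \<psi> (T1 \<Delta> (a \<otimes> d)))"
    using core.right_invariant_functional[of h, OF fL fR] by blast
  have "right_integral \<Delta> E \<psi>"
    unfolding right_integral_def
  proof (intro conjI allI)
    show "\<psi> \<noteq> (\<lambda>_. 0)" using \<psi>(2)[of h] h zero by auto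
    fix a
    let ?y = "mult_slice_left \<psi> (\<Delta> a)"
    have lact_y: "lact ?y = (\<lambda>x. slice_left \<psi> (T1 \<Delta> (a \<otimes> x)))"
      using lact_mult_slice[OF \<psi>(1)] by auto
    have "lact (Delta_ext \<Delta> E ?y) z = lact (E * (1 \<otimes>\<^sub>m ?y)) z" for z
    proof (rule tensor_map_eqI[where f="\<lambda>z. lact (Delta_ext \<Delta> E ?y) z"])
      fix c d
      obtain w where w: "T1 \<Delta> w = lact E (c \<otimes> d)" using range_T1 by (metis rangeE rangeI)
      show "lact (Delta_ext \<Delta> E ?y) (c \<otimes> d) = lact (E * (1 \<otimes>\<^sub>m ?y)) (c \<otimes> d)"
        by (simp add: lact_Delta_ext[OF w] lact_y \<psi>(3)[OF w] act_simps tensor_map_pure lin \<psi>(1))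
    qed (simp_all add: lin)
    then show "?y \<in> A_s \<Delta> E"
      unfolding A_s_def by (simp add: multiplier_eq_lact[OF nondegenerate2])
  qed (rule \<psi>(1))
  show ?thesis using \<open>left_integral \<Delta> E \<phi>\<close> \<open>right_integral \<Delta> E \<psi>\<close> by blast
qed

end

theorem theorem4p9:
  fixes \<Delta> :: "'a::complex_algebra \<Rightarrow> ('a, 'a) tensor multiplier"
    and \<epsilon> :: "'a \<Rightarrow> complex"
    and E :: "('a, 'a) tensor multiplier"
    and G1 G2 :: "('a, 'a) tensor \<Rightarrow> ('a, 'a) tensor"
    and S :: "'a \<Rightarrow> 'a multiplier"
    and h :: 'a
  assumes "regular_weak_multiplier_Hopf_algebra \<Delta> \<epsilon> E G1 G2 S"
    and "left_cointegral \<Delta> S (embed h)"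
    and "faithful_cointegral \<Delta> E (embed h)"
  shows "(\<exists>\<phi>. left_integral \<Delta> E \<phi>) \<and> (\<exists>\<psi>. right_integral \<Delta> E \<psi>)"
proof -
  interpret regular_weak_multiplier_Hopf_algebra \<Delta> \<epsilon> E G1 G2 S by (rule assms(1))
  have "embed h \<noteq> 0" using assms(2) unfolding left_cointegral_def by blast
  moreover have "embed (0 :: 'a) = 0" by (rule clinear_zero) (intro lin)
  ultimately have "h \<noteq> 0" by auto
  then show ?thesis using assms(3) by (rule integrals_exist)
qed

end
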